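(* Let $M=B\times_f\overline{F}$ be an $m$-dimensional nontrivial warped product proper pointwise semi-slant submanifold of a $(2n+1)$-dimensional cosymplectic manifold $(N,\phi,\xi,\eta,g)$ with the semi-slant function $\theta$ such that $\mathcal{D}_1=TB$, $\mathcal{D}_2=T\overline{F}$, and $\xi$ is tangent to $M$. Write $\dim\mathcal{D}_1=2m_1+1$ and $\dim\mathcal{D}_2=2m_2$ (so $m=2m_1+2m_2+1$). Assume that $n=m_1+2m_2$. Then $$\|h\|^2\ \ge\ 4m_2(\csc^2\theta+\cot^2\theta)\,\|\phi\nabla(\ln f)\|^2,$$ with equality holding if and only if $g(h(Z,W),V)=0$ for all $Z,W\in\Gamma(T\overline{F})$ and $V\in\Gamma(TM^{\perp})$.
   Context: An almost contact metric manifold $(N,\phi,\xi,\eta,g)$ is a smooth manifold $N$ of dimension $2n+1$ with a tensor field $\phi$ of type $(1,1)$, a vector field $\xi$, a $1$-form $\eta$ and a Riemannian metric $g$ such that $\phi^2=-I+\eta\otimes\xi$, $\eta(\xi)=1$ and $g(\phi X,\phi Y)=g(X,Y)-\eta(X)\eta(Y)$ for all vector fields $X,Y$ (hence $\phi\xi=0$, $\eta\circ\phi=0$, $\eta(X)=g(X,\xi)$). With $\overline{\nabla}$ the Levi-Civita connection of $(N,g)$, it is cosymplectic iff $\overline{\nabla}\phi=0$ (then also $\overline{\nabla}\eta=0$, $\overline{\nabla}\xi=0$). A submanifold $M$ of $N$ is a pointwise semi-slant submanifold if there is a distribution $\mathcal{D}_1\subset TM$ such that $TM=\mathcal{D}_1\oplus\mathcal{D}_2$,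 $\phi(\mathcal{D}_1)\subset\mathcal{D}_1$, and at each given point $p\in M$ the angle $\theta=\theta(X)$ between $\phi X$ and $(\mathcal{D}_2)_p$ is constant for nonzero $X\in(\mathcal{D}_2)_p$, where $\mathcal{D}_2$ is the orthogonal complement of $\mathcal{D}_1$ in $TM$. The function $\theta$ on $M$ is the semi-slant function; $M$ is proper if $\theta$ takes values in $(0,\frac{\pi}{2})$. When $\xi$ is tangent to $M$, $\xi\in\Gamma(\mathcal{D}_1)$, $\dim\mathcal{D}_1$ is odd, and (for $M$ proper) $\dim\mathcal{D}_2$ is even. For Riemannian manifolds $(B,g_B)$, $(\overline{F},g_{\overline{F}})$ and a positive smooth function $f$ on $B$, the warped product $B\times_f\overline{F}$ is $B\times\overline{F}$ with metric $g_B+f^2g_{\overline{F}}$; it is trivial if the warping function $f$ is constant. Here $M$ with the induced metric is such a warped product, and $TB$, $T\overline{F}$ are identified with the corresponding subbundles of $TM$. $h$ is the second fundamental form of $M$ in $N$, $\|h\|^2=\sum_{i,j=1}^m g(h(e_i,e_j),h(e_i,e_j))$ for a local orthonormal frame $e_1,\dots,e_m$ of $TM$; $TM^\perp$ is the normal bundle; $\nabla(\ln f)$ is the gradient on $M$ of $\ln f$ (with $f$ regarded as a function on $M$). *)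

theory Defs
  imports "HOL-Analysis.Analysis"
begin

section \<open>Smooth maps between open subsets of Euclidean spaces\<close>

text \<open>Only meant for open \<open>S\<close>. In finite dimension, being \<open>C\<^sup>k\<^sup>+\<^sup>1\<close> amounts to being differentiable
  with all directional derivatives of class \<open>C\<^sup>k\<close>.\<close>

primrec Ck_on :: "nat \<Rightarrow> 'a::euclidean_space set \<Rightarrow> ('a \<Rightarrow> 'b::euclidean_space) \<Rightarrow> bool" where
  "Ck_on 0 S f = continuous_on S f"
| "Ck_on (Suc k) S f =
     ((\<forall>x\<in>S. f differentiable (at x)) \<and>
      (\<forall>v. Ck_on k S (\<lambda>x. frechet_derivative f (at x) v)))"

definition smooth_on :: "'a::euclidean_space set \<Rightarrow> ('a \<Rightarrow> 'b::euclidean_space) \<Rightarrow> bool" where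
  "smooth_on S f \<longleftrightarrow> (\<forall>k. Ck_on k S f)"

section \<open>Smooth manifolds\<close>

text \<open>A manifold is a Hausdorff second countable type together with a smooth atlas modelled on a
  Euclidean space. A chart is its domain paired with the coordinate map; the values of the
  coordinate map outside the domain are irrelevant.\<close>

type_synonym ('a, 'e) chart = "'a set \<times> ('a \<Rightarrow> 'e)"

definition chart_inv :: "('a, 'e) chart \<Rightarrow> 'e \<Rightarrow> 'a" where
  "chart_inv c = inv_into (fst c) (snd c)"

definition is_chart :: "('a::topological_space, 'e::euclidean_space) chart \<Rightarrow> bool" where
  "is_chart c \<longleftrightarrow> open (fst c) \<and> open (snd c ` fst c) \<and>
     homeomorphism (fst c) (snd c ` fst c) (snd c) (chart_inv c)"

definition smooth_atlas ::
    "('a::{t2_space, second_countable_topology}, 'e::euclidean_space) chart set \<Rightarrow> bool" where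
  "smooth_atlas A \<longleftrightarrow> (\<forall>c\<in>A. is_chart c) \<and> (\<Union>c\<in>A. fst c) = UNIV \<and>
     (\<forall>c\<in>A. \<forall>d\<in>A. smooth_on (snd c ` (fst c \<inter> fst d)) (snd d \<circ> chart_inv c))"

text \<open>The tangent space at \<open>p\<close> is the model space \<open>'e\<close>: a tangent vector is given by its components
  in a chart around \<open>p\<close> that is selected once and for all. Its components in another chart are
  obtained by the usual transformation law.\<close>

definition chart_at :: "('a, 'e) chart set \<Rightarrow> 'a \<Rightarrow> ('a, 'e) chart" where
  "chart_at A p = (SOME c. c \<in> A \<and> p \<in> fst c)"

definition components ::
    "('a, 'e::euclidean_space) chart set \<Rightarrow> ('a, 'e) chart \<Rightarrow> 'a \<Rightarrow> 'e \<Rightarrow> 'e" where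
  "components A c p v =
     frechet_derivative (snd c \<circ> chart_inv (chart_at A p)) (at (snd (chart_at A p) p)) v"

definition smooth_fun ::
    "('a, 'e::euclidean_space) chart set \<Rightarrow> 'a set \<Rightarrow> ('a \<Rightarrow> real) \<Rightarrow> bool" where
  "smooth_fun A U f \<longleftrightarrow> (\<forall>c\<in>A. smooth_on (snd c ` (fst c \<inter> U)) (f \<circ> chart_inv c))"

definition dfun :: "('a, 'e::euclidean_space) chart set \<Rightarrow> ('a \<Rightarrow> real) \<Rightarrow> 'a \<Rightarrow> 'e \<Rightarrow> real" where
  "dfun A f p = frechet_derivative (f \<circ> chart_inv (chart_at A p)) (at (snd (chart_at A p) p))"

definition smooth_map ::
    "('a::topological_space, 'e::euclidean_space) chart set \<Rightarrow>
     ('b::topological_space, 'd::euclidean_space) chart set \<Rightarrow> ('a \<Rightarrow> 'b) \<Rightarrow> bool" where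
  "smooth_map A B F \<longleftrightarrow> continuous_on UNIV F \<and>
     (\<forall>c\<in>A. \<forall>d\<in>B. smooth_on (snd c ` (fst c \<inter> F -` fst d)) (snd d \<circ> F \<circ> chart_inv c))"

definition dmap ::
    "('a, 'e::euclidean_space) chart set \<Rightarrow> ('b, 'd::euclidean_space) chart set \<Rightarrow>
     ('a \<Rightarrow> 'b) \<Rightarrow> 'a \<Rightarrow> 'e \<Rightarrow> 'd" where
  "dmap A B F p =
     frechet_derivative (snd (chart_at B (F p)) \<circ> F \<circ> chart_inv (chart_at A p))
       (at (snd (chart_at A p) p))"

text \<open>A smooth vector field on the open set \<open>U\<close>. As everywhere below, the values outside \<open>U\<close>
  are arbitrary; vector fields, like all sections, are local objects.\<close>

definition smooth_vf :: "('a, 'e::euclidean_space) chart set \<Rightarrow> 'a set \<Rightarrow> ('a \<Rightarrow> 'e) \<Rightarrow> bool" where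
  "smooth_vf A U X \<longleftrightarrow>
     (\<forall>c\<in>A. smooth_on (snd c ` (fst c \<inter> U))
        (\<lambda>x. components A c (chart_inv c x) (X (chart_inv c x))))"

text \<open>A smooth section over \<open>U\<close> of the pullback of the tangent bundle along \<open>F\<close>.\<close>

definition smooth_vf_along ::
    "('a, 'e::euclidean_space) chart set \<Rightarrow> ('b, 'd::euclidean_space) chart set \<Rightarrow>
     ('a \<Rightarrow> 'b) \<Rightarrow> 'a set \<Rightarrow> ('a \<Rightarrow> 'd) \<Rightarrow> bool" where
  "smooth_vf_along A B F U V \<longleftrightarrow>
     (\<forall>c\<in>A. \<forall>d\<in>B. smooth_on (snd c ` (fst c \<inter> U \<inter> F -` fst d))
        (\<lambda>x. components B d (F (chart_inv c x)) (V (chart_inv c x))))"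

definition smooth_distribution ::
    "('a::topological_space, 'e::euclidean_space) chart set \<Rightarrow> ('a \<Rightarrow> 'e set) \<Rightarrow> bool" where
  "smooth_distribution A D \<longleftrightarrow>
     (\<exists>k. \<forall>p. \<exists>U. open U \<and> p \<in> U \<and>
        (\<exists>X :: nat \<Rightarrow> 'a \<Rightarrow> 'e. (\<forall>i<k. smooth_vf A U (X i)) \<and>
           (\<forall>q\<in>U. D q = span ((\<lambda>i. X i q) ` {..<k}) \<and> dim (D q) = k)))"

definition prod_atlas ::
    "('a, 'e) chart set \<Rightarrow> ('b, 'd) chart set \<Rightarrow> ('a \<times> 'b, 'e \<times> 'd) chart set" where
  "prod_atlas A B = {(fst c \<times> fst d, map_prod (snd c) (snd d)) | c d. c \<in> A \<and> d \<in> B}"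

section \<open>Riemannian metrics and the Levi-Civita connection\<close>

definition inner_product :: "('e::real_vector \<Rightarrow> 'e \<Rightarrow> real) \<Rightarrow> bool" where
  "inner_product b \<longleftrightarrow> (\<forall>u. linear (b u)) \<and> (\<forall>u v. b u v = b v u) \<and> (\<forall>u. u \<noteq> 0 \<longrightarrow> b u u > 0)"

definition orth_proj :: "('e::real_vector \<Rightarrow> 'e \<Rightarrow> real) \<Rightarrow> 'e set \<Rightarrow> 'e \<Rightarrow> 'e" where
  "orth_proj b W v = (THE w. w \<in> W \<and> (\<forall>u\<in>W. b (v - w) u = 0))"

definition orthonormal_basis :: "('e::real_vector \<Rightarrow> 'e \<Rightarrow> real) \<Rightarrow> 'e set \<Rightarrow> bool" where
  "orthonormal_basis b E \<longleftrightarrow>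
     finite E \<and> span E = UNIV \<and> (\<forall>u\<in>E. \<forall>v\<in>E. b u v = (if u = v then 1 else 0))"

text \<open>The angle between a vector and a subspace is the angle between the vector and its
  orthogonal projection to the subspace.\<close>

definition angle_to_subspace :: "('e::real_vector \<Rightarrow> 'e \<Rightarrow> real) \<Rightarrow> 'e \<Rightarrow> 'e set \<Rightarrow> real" where
  "angle_to_subspace b v W =
     (let w = orth_proj b W v in arccos (sqrt (b w w) / sqrt (b v v)))"

definition riemannian_manifold ::
    "('a::{t2_space, second_countable_topology}, 'e::euclidean_space) chart set \<Rightarrow>
     ('a \<Rightarrow> 'e \<Rightarrow> 'e \<Rightarrow> real) \<Rightarrow> bool" where
  "riemannian_manifold A g \<longleftrightarrow> smooth_atlas A \<and> (\<forall>p. inner_product (g p)) \<and>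
     (\<forall>U X Y. open U \<and> smooth_vf A U X \<and> smooth_vf A U Y \<longrightarrow>
        smooth_fun A U (\<lambda>p. g p (X p) (Y p)))"

definition gradient ::
    "('a, 'e::euclidean_space) chart set \<Rightarrow> ('a \<Rightarrow> 'e \<Rightarrow> 'e \<Rightarrow> real) \<Rightarrow> ('a \<Rightarrow> real) \<Rightarrow> 'a \<Rightarrow> 'e" where
  "gradient A g f p = (THE v. \<forall>w. g p v w = dfun A f p w)"

text \<open>Connections act on vector fields defined on arbitrary open sets.\<close>

definition affine_connection ::
    "('a::topological_space, 'e::euclidean_space) chart set \<Rightarrow>
     (('a \<Rightarrow> 'e) \<Rightarrow> ('a \<Rightarrow> 'e) \<Rightarrow> 'a \<Rightarrow> 'e) \<Rightarrow> bool" where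
  "affine_connection A nab \<longleftrightarrow>
     (\<forall>U X Y. open U \<and> smooth_vf A U X \<and> smooth_vf A U Y \<longrightarrow>
        smooth_vf A U (nab X Y) \<and>
        (\<forall>Z. smooth_vf A U Z \<longrightarrow>
           (\<forall>p\<in>U. nab (\<lambda>q. X q + Z q) Y p = nab X Y p + nab Z Y p \<and>
                   nab X (\<lambda>q. Y q + Z q) p = nab X Y p + nab X Z p)) \<and>
        (\<forall>f. smooth_fun A U f \<longrightarrow>
           (\<forall>p\<in>U. nab (\<lambda>q. f q *\<^sub>R X q) Y p = f p *\<^sub>R nab X Y p \<and>
                   nab X (\<lambda>q. f q *\<^sub>R Y q) p = dfun A f p (X p) *\<^sub>R Y p + f p *\<^sub>R nab X Y p)))"

text \<open>The bracket enters through its action \<open>[X, Y] f = X (Y f) - Y (X f)\<close> on functions.\<close>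

definition torsion_free ::
    "('a::topological_space, 'e::euclidean_space) chart set \<Rightarrow>
     (('a \<Rightarrow> 'e) \<Rightarrow> ('a \<Rightarrow> 'e) \<Rightarrow> 'a \<Rightarrow> 'e) \<Rightarrow> bool" where
  "torsion_free A nab \<longleftrightarrow>
     (\<forall>U X Y f. open U \<and> smooth_vf A U X \<and> smooth_vf A U Y \<and> smooth_fun A U f \<longrightarrow>
        (\<forall>p\<in>U. dfun A f p (nab X Y p - nab Y X p) =
           dfun A (\<lambda>q. dfun A f q (Y q)) p (X p) - dfun A (\<lambda>q. dfun A f q (X q)) p (Y p)))"

definition metric_connection ::
    "('a::topological_space, 'e::euclidean_space) chart set \<Rightarrow> ('a \<Rightarrow> 'e \<Rightarrow> 'e \<Rightarrow> real) \<Rightarrow>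
     (('a \<Rightarrow> 'e) \<Rightarrow> ('a \<Rightarrow> 'e) \<Rightarrow> 'a \<Rightarrow> 'e) \<Rightarrow> bool" where
  "metric_connection A g nab \<longleftrightarrow>
     (\<forall>U X Y Z. open U \<and> smooth_vf A U X \<and> smooth_vf A U Y \<and> smooth_vf A U Z \<longrightarrow>
        (\<forall>p\<in>U. dfun A (\<lambda>q. g q (Y q) (Z q)) p (X p) =
           g p (nab X Y p) (Z p) + g p (Y p) (nab X Z p)))"

definition levi_civita_connection ::
    "('a::topological_space, 'e::euclidean_space) chart set \<Rightarrow> ('a \<Rightarrow> 'e \<Rightarrow> 'e \<Rightarrow> real) \<Rightarrow>
     (('a \<Rightarrow> 'e) \<Rightarrow> ('a \<Rightarrow> 'e) \<Rightarrow> 'a \<Rightarrow> 'e) \<Rightarrow> bool" where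
  "levi_civita_connection A g nab \<longleftrightarrow>
     affine_connection A nab \<and> torsion_free A nab \<and> metric_connection A g nab"

section \<open>Cosymplectic manifolds\<close>

definition almost_contact_metric_manifold ::
    "('a::{t2_space, second_countable_topology}, 'e::euclidean_space) chart set \<Rightarrow>
     ('a \<Rightarrow> 'e \<Rightarrow> 'e) \<Rightarrow> ('a \<Rightarrow> 'e) \<Rightarrow> ('a \<Rightarrow> 'e \<Rightarrow> real) \<Rightarrow> ('a \<Rightarrow> 'e \<Rightarrow> 'e \<Rightarrow> real) \<Rightarrow> bool" where
  "almost_contact_metric_manifold A \<phi> \<xi> \<eta> g \<longleftrightarrow>
     riemannian_manifold A g \<and> odd DIM('e) \<and>
     (\<forall>p. linear (\<phi> p)) \<and>
     (\<forall>U X. open U \<and> smooth_vf A U X \<longrightarrow> smooth_vf A U (\<lambda>p. \<phi> p (X p))) \<and>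
     smooth_vf A UNIV \<xi> \<and>
     (\<forall>p. linear (\<eta> p)) \<and>
     (\<forall>U X. open U \<and> smooth_vf A U X \<longrightarrow> smooth_fun A U (\<lambda>p. \<eta> p (X p))) \<and>
     (\<forall>p v. \<phi> p (\<phi> p v) = - v + \<eta> p v *\<^sub>R \<xi> p) \<and>
     (\<forall>p. \<eta> p (\<xi> p) = 1) \<and>
     (\<forall>p u v. g p (\<phi> p u) (\<phi> p v) = g p u v - \<eta> p u * \<eta> p v)"

text \<open>The Levi-Civita connection is carried along as the last argument.\<close>

definition cosymplectic_manifold ::
    "('a::{t2_space, second_countable_topology}, 'e::euclidean_space) chart set \<Rightarrow>
     ('a \<Rightarrow> 'e \<Rightarrow> 'e) \<Rightarrow> ('a \<Rightarrow> 'e) \<Rightarrow> ('a \<Rightarrow> 'e \<Rightarrow> real) \<Rightarrow> ('a \<Rightarrow> 'e \<Rightarrow> 'e \<Rightarrow> real) \<Rightarrow>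
     (('a \<Rightarrow> 'e) \<Rightarrow> ('a \<Rightarrow> 'e) \<Rightarrow> 'a \<Rightarrow> 'e) \<Rightarrow> bool" where
  "cosymplectic_manifold A \<phi> \<xi> \<eta> g nab \<longleftrightarrow>
     almost_contact_metric_manifold A \<phi> \<xi> \<eta> g \<and> levi_civita_connection A g nab \<and>
     (\<forall>U X Y. open U \<and> smooth_vf A U X \<and> smooth_vf A U Y \<longrightarrow>
        (\<forall>p\<in>U. nab X (\<lambda>q. \<phi> q (Y q)) p - \<phi> p (nab X Y p) = 0))"

section \<open>Submanifolds and the second fundamental form\<close>

text \<open>A submanifold is a manifold with an injective immersion \<open>i\<close>, the inclusion.\<close>

definition submanifold ::
    "('m::{t2_space, second_countable_topology}, 'd::euclidean_space) chart set \<Rightarrow>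
     ('a::{t2_space, second_countable_topology}, 'e::euclidean_space) chart set \<Rightarrow>
     ('m \<Rightarrow> 'a) \<Rightarrow> bool" where
  "submanifold AM A i \<longleftrightarrow>
     smooth_atlas AM \<and> smooth_map AM A i \<and> inj i \<and> (\<forall>p. inj (dmap AM A i p))"

definition induced_metric ::
    "('m, 'd::euclidean_space) chart set \<Rightarrow> ('a, 'e::euclidean_space) chart set \<Rightarrow> ('m \<Rightarrow> 'a) \<Rightarrow>
     ('a \<Rightarrow> 'e \<Rightarrow> 'e \<Rightarrow> real) \<Rightarrow> 'm \<Rightarrow> 'd \<Rightarrow> 'd \<Rightarrow> real" where
  "induced_metric AM A i g p u v = g (i p) (dmap AM A i p u) (dmap AM A i p v)"

definition normal_fibre ::
    "('m, 'd::euclidean_space) chart set \<Rightarrow> ('a, 'e::euclidean_space) chart set \<Rightarrow> ('m \<Rightarrow> 'a) \<Rightarrow>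
     ('a \<Rightarrow> 'e \<Rightarrow> 'e \<Rightarrow> real) \<Rightarrow> 'm \<Rightarrow> 'e set" where
  "normal_fibre AM A i g p = {v. \<forall>u. g (i p) v (dmap AM A i p u) = 0}"

text \<open>\<open>h(u, v)\<close> is the normal component of the ambient derivative of \<open>Y'\<close> along \<open>X'\<close>, where \<open>X'\<close>, \<open>Y'\<close>
  are local extensions to the ambient manifold of tangent fields \<open>X\<close>, \<open>Y\<close> with values \<open>u\<close>, \<open>v\<close> at \<open>p\<close>.
  It depends on \<open>u\<close> and \<open>v\<close> only.\<close>

definition second_fundamental_form ::
    "('m::topological_space, 'd::euclidean_space) chart set \<Rightarrow>
     ('a::topological_space, 'e::euclidean_space) chart set \<Rightarrow> ('m \<Rightarrow> 'a) \<Rightarrow>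
     ('a \<Rightarrow> 'e \<Rightarrow> 'e \<Rightarrow> real) \<Rightarrow> (('a \<Rightarrow> 'e) \<Rightarrow> ('a \<Rightarrow> 'e) \<Rightarrow> 'a \<Rightarrow> 'e) \<Rightarrow>
     'm \<Rightarrow> 'd \<Rightarrow> 'd \<Rightarrow> 'e" where
  "second_fundamental_form AM A i g nab p u v =
     (THE w. \<exists>U V X Y X' Y'.
        open U \<and> p \<in> U \<and> open V \<and> i ` U \<subseteq> V \<and>
        smooth_vf AM U X \<and> smooth_vf AM U Y \<and> smooth_vf A V X' \<and> smooth_vf A V Y' \<and>
        (\<forall>q\<in>U. X' (i q) = dmap AM A i q (X q) \<and> Y' (i q) = dmap AM A i q (Y q)) \<and>
        X p = u \<and> Y p = v \<and>
        w = nab X' Y' (i p) - orth_proj (g (i p)) (range (dmap AM A i p)) (nab X' Y' (i p)))"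

text \<open>The sum below does not depend on the orthonormal basis.\<close>

definition norm2_sff ::
    "('m::topological_space, 'd::euclidean_space) chart set \<Rightarrow>
     ('a::topological_space, 'e::euclidean_space) chart set \<Rightarrow> ('m \<Rightarrow> 'a) \<Rightarrow>
     ('a \<Rightarrow> 'e \<Rightarrow> 'e \<Rightarrow> real) \<Rightarrow> (('a \<Rightarrow> 'e) \<Rightarrow> ('a \<Rightarrow> 'e) \<Rightarrow> 'a \<Rightarrow> 'e) \<Rightarrow> 'm \<Rightarrow> real" where
  "norm2_sff AM A i g nab p =
     (let h = second_fundamental_form AM A i g nab p;
          E = (SOME E. orthonormal_basis (induced_metric AM A i g p) E)
      in \<Sum>u\<in>E. \<Sum>v\<in>E. g (i p) (h u v) (h u v))"

definition pointwise_semi_slant ::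
    "('m::{t2_space, second_countable_topology}, 'd::euclidean_space) chart set \<Rightarrow>
     ('a::{t2_space, second_countable_topology}, 'e::euclidean_space) chart set \<Rightarrow> ('m \<Rightarrow> 'a) \<Rightarrow>
     ('a \<Rightarrow> 'e \<Rightarrow> 'e) \<Rightarrow> ('a \<Rightarrow> 'e \<Rightarrow> 'e \<Rightarrow> real) \<Rightarrow>
     ('m \<Rightarrow> 'd set) \<Rightarrow> ('m \<Rightarrow> 'd set) \<Rightarrow> ('m \<Rightarrow> real) \<Rightarrow> bool" where
  "pointwise_semi_slant AM A i \<phi> g D1 D2 \<theta> \<longleftrightarrow>
     submanifold AM A i \<and> smooth_distribution AM D1 \<and>
     (\<forall>p. D2 p = {v. \<forall>u\<in>D1 p. induced_metric AM A i g p u v = 0}) \<and>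
     (\<forall>p. \<phi> (i p) ` dmap AM A i p ` D1 p \<subseteq> dmap AM A i p ` D1 p) \<and>
     (\<forall>p. \<forall>X\<in>D2 p. X \<noteq> 0 \<longrightarrow>
        angle_to_subspace (g (i p)) (\<phi> (i p) (dmap AM A i p X)) (dmap AM A i p ` D2 p) = \<theta> p)"

section \<open>Warped products\<close>

definition warped_metric ::
    "('b, 'd::euclidean_space) chart set \<Rightarrow> ('f, 'e::euclidean_space) chart set \<Rightarrow>
     ('b \<Rightarrow> 'd \<Rightarrow> 'd \<Rightarrow> real) \<Rightarrow> ('f \<Rightarrow> 'e \<Rightarrow> 'e \<Rightarrow> real) \<Rightarrow> ('b \<Rightarrow> real) \<Rightarrow>
     'b \<times> 'f \<Rightarrow> 'd \<times> 'e \<Rightarrow> 'd \<times> 'e \<Rightarrow> real" where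
  "warped_metric AB AF gB gF f p u v =
     gB (fst p) (dmap (prod_atlas AB AF) AB fst p u) (dmap (prod_atlas AB AF) AB fst p v) +
     (f (fst p))\<^sup>2 *
       gF (snd p) (dmap (prod_atlas AB AF) AF snd p u) (dmap (prod_atlas AB AF) AF snd p v)"

text \<open>The subbundles of \<open>T(B \<times> F)\<close> identified with \<open>TB\<close> and \<open>TF\<close>. The chart selected at a point of the
  product need not be the product of the selected charts, so these subspaces of \<open>'d \<times> 'e\<close> are in
  general not the coordinate subspaces.\<close>

definition TB ::
    "('b, 'd::euclidean_space) chart set \<Rightarrow> ('f, 'e::euclidean_space) chart set \<Rightarrow>
     'b \<times> 'f \<Rightarrow> ('d \<times> 'e) set" where
  "TB AB AF p = {v. dmap (prod_atlas AB AF) AF snd p v = 0}"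

definition TF ::
    "('b, 'd::euclidean_space) chart set \<Rightarrow> ('f, 'e::euclidean_space) chart set \<Rightarrow>
     'b \<times> 'f \<Rightarrow> ('d \<times> 'e) set" where
  "TF AB AF p = {v. dmap (prod_atlas AB AF) AB fst p v = 0}"

end

theory Submission
  imports Defs
begin

text \<open>Work at a point \<open>p\<close> with product coordinates of \<open>M\<close> and coordinates of \<open>N\<close>. Let \<open>G u v\<close> be the
  ambient covariant derivative of coordinate fields tangent to \<open>M\<close>, so that \<open>h u v\<close> is the normal
  component of \<open>G u v\<close>. For \<open>Z\<close> in \<open>D2\<close> write \<open>\<phi> Z = T Z + N Z\<close> with \<open>T Z\<close> tangent and \<open>N Z\<close> normal;
  slantness gives \<open>g (T Z) (T W) = cos\<^sup>2 \<theta> g Z W\<close> and \<open>g (N Z) (N W) = sin\<^sup>2 \<theta> g Z W\<close>, and the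
  assumption on \<open>n\<close> says that the normal space is \<open>N D2\<close>. Since \<open>\<phi>\<close> is parallel and skew,
  \<open>g (h u a) (N W)\<close> for \<open>a\<close> in \<open>D1\<close> reduces to Christoffel symbols of the warped metric: it vanishes for
  \<open>u\<close> in \<open>D1\<close>, and it equals \<open>-(\<phi> a) (ln f) g Z W - a (ln f) g Z (T W)\<close> for \<open>u = Z\<close> in \<open>D2\<close>.
  Summing squares over an adapted orthonormal basis, and using \<open>\<xi> (ln f) = 0\<close> (as \<open>\<xi>\<close> is parallel),
  \<open>norm2_sff\<close> is the asserted bound plus the square norm of the restriction of \<open>h\<close> to \<open>D2\<close>.\<close>

section \<open>Calculus of smooth maps\<close>

text \<open>The factor 4 m2 is 2 * (2 m2): each pair from D1 and D2 occurs in both orders, and D2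
  has 2 m2 directions. With v the gradient of ln f, a unit Z contributes (|\<phi> v|^2 + cos^2
  |v|^2) / sin^2. The division is there because N Z has length sin \<theta>; v is orthogonal to
  \<xi>, so |v| = |\<phi> v|, whence csc^2 + cot^2. The obstacle is that G is not a tensor and that
  the selected charts jump from point to point, so fibrewise components cannot be differentiated.
  All fields are therefore taken constant in the one chart selected at p. Being a product chart, it
  keeps them in D1 or D2 on its whole domain, and the vanishing of a parallel tensor on such fields
  can be differentiated at p. Two smooth objects have to be constructed: the ambient extensions that
  h is defined with, by the inverse function theorem, and, since the equality case speaks of
  sections, a normal section through a given normal vector, by solving the Gram system of the
  pushed-forward frame.\<close>

abbreviation der :: "('a::real_normed_vector \<Rightarrow> 'b::real_normed_vector) \<Rightarrow> 'a \<Rightarrow> 'a \<Rightarrow> 'b" where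
  "der f x \<equiv> frechet_derivative f (at x)"

lemma der_eqI: "(f has_derivative f') (at x) \<Longrightarrow> der f x = f'"
  using frechet_derivative_at by metis

text \<open>\<open>frechet_derivative\<close> is a choice among all derivatives, so the values agree
  even where neither function is differentiable: both choices range over the same set.\<close>

lemma der_cong_open:
  assumes "open S" "x \<in> S" "\<And>y. y \<in> S \<Longrightarrow> f y = g y"
  shows "der f x = der g x"
proof -
  have "(f has_derivative f') (at x) \<longleftrightarrow> (g has_derivative f') (at x)" for f'
    using has_derivative_transform_within_open[OF _ assms(1,2)] assms(3) by metis
  then show ?thesis
    unfolding frechet_derivative_def by simp
qed

lemma Ck_on_subset: "Ck_on k S f \<Longrightarrow> T \<subseteq> S \<Longrightarrow> Ck_on k T f"
  by (induction k arbitrary: f) (auto intro: continuous_on_subset)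

lemma Ck_on_cong:
  assumes "open S" "\<And>x. x \<in> S \<Longrightarrow> f x = g x" "Ck_on k S f"
  shows "Ck_on k S g"
  using assms(2,3)
proof (induction k arbitrary: f g)
  case 0
  then show ?case using continuous_on_eq by auto
next
  case (Suc k)
  have "(g has_derivative der f x) (at x)" if x: "x \<in> S" for x
  proof -
    from Suc.prems x have "(f has_derivative der f x) (at x)"
      by (auto simp: frechet_derivative_works)
    then show ?thesis
      using has_derivative_transform_within_open[OF _ assms(1) x] Suc.prems(1) by blast
  qed
  moreover have "Ck_on k S (\<lambda>x. der g x v)" for v
  proof (rule Suc.IH)
    show "der f x v = der g x v" if "x \<in> S" for x
      using der_cong_open[OF assms(1) that Suc.prems(1)] by simp
    show "Ck_on k S (\<lambda>x. der f x v)" using Suc.prems(2) by simp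
  qed
  ultimately show ?case
    by (auto simp: differentiable_def)
qed

text \<open>Lets the derivative be given explicitly by f' in place of the choice made by
  \<open>der\<close>; the inductive closure proofs below rest on it.\<close>

lemma Ck_on_SucI:
  assumes "open S" "\<And>x. x \<in> S \<Longrightarrow> (f has_derivative f' x) (at x)"
    and "\<And>v. Ck_on k S (\<lambda>x. f' x v)"
  shows "Ck_on (Suc k) S f"
proof -
  have "Ck_on k S (\<lambda>x. der f x v)" for v
    by (rule Ck_on_cong[OF assms(1) _ assms(3)[of v]]) (simp add: der_eqI[OF assms(2)])
  then show ?thesis
    using assms(2) by (auto simp: differentiable_def)
qed

lemma Ck_on_SucD:
  "Ck_on (Suc k) S f \<Longrightarrow> x \<in> S \<Longrightarrow> (f has_derivative der f x) (at x)"
  by (auto simp: frechet_derivative_works)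

lemma Ck_on_Suc_imp: "Ck_on (Suc k) S f \<Longrightarrow> Ck_on k S f"
proof (induction k arbitrary: f)
  case 0
  then show ?case
    by (auto simp: continuous_at_imp_continuous_on differentiable_imp_continuous_within)
qed auto

lemma Ck_on_const: "Ck_on k S (\<lambda>x. c)"
  by (induction k arbitrary: c) auto

lemma Ck_on_bounded_linear:
  assumes "open S" "bounded_linear f"
  shows "Ck_on k S f"
proof (cases k)
  case 0
  then show ?thesis using assms by (simp add: linear_continuous_on)
next
  case (Suc n)
  show ?thesis unfolding Suc
    by (rule Ck_on_SucI[OF assms(1)])
      (use assms(2) in \<open>auto intro: bounded_linear_imp_has_derivative Ck_on_const\<close>)
qed

lemma Ck_on_add:
  assumes "open S" "Ck_on k S f" "Ck_on k S g"
  shows "Ck_on k S (\<lambda>x. f x + g x)"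
  using assms(2,3)
proof (induction k arbitrary: f g)
  case 0
  then show ?case by (auto intro: continuous_intros)
next
  case (Suc k)
  show ?case
  proof (rule Ck_on_SucI[OF assms(1)])
    show "((\<lambda>x. f x + g x) has_derivative (\<lambda>v. der f x v + der g x v)) (at x)" if "x \<in> S" for x
      using Suc.prems[THEN Ck_on_SucD, OF that] by (rule has_derivative_add)
  qed (use Suc in auto)
qed

lemma Ck_on_sum:
  assumes "open S" "\<And>i. i \<in> I \<Longrightarrow> Ck_on k S (f i)"
  shows "Ck_on k S (\<lambda>x. \<Sum>i\<in>I. f i x)"
  using assms(2)
  by (induction I rule: infinite_finite_induct) (auto intro: Ck_on_const Ck_on_add[OF assms(1)])

text \<open>The product rule yields two terms of the same bilinear shape, so the induction closes
  once the undifferentiated factor is lowered from order Suc k to k.\<close>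

lemma Ck_on_bilinear:
  fixes bop :: "'a::euclidean_space \<Rightarrow> 'b::euclidean_space \<Rightarrow> 'c::euclidean_space"
  assumes "bounded_bilinear bop" "open S" "Ck_on k S f" "Ck_on k S g"
  shows "Ck_on k S (\<lambda>x. bop (f x) (g x))"
  using assms(3,4)
proof (induction k arbitrary: f g)
  case 0
  then show ?case using bounded_bilinear.continuous_on[OF assms(1)] by auto
next
  case (Suc k)
  note p = Suc.prems Suc.prems[THEN Ck_on_Suc_imp]
  show ?case
  proof (rule Ck_on_SucI[OF assms(2)])
    fix x assume x: "x \<in> S"
    show "((\<lambda>x. bop (f x) (g x)) has_derivative
        (\<lambda>v. bop (f x) (der g x v) + bop (der f x v) (g x))) (at x)"
      by (rule bounded_bilinear.FDERIV[OF assms(1) p(1,2)[THEN Ck_on_SucD, OF x]])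
  next
    show "Ck_on k S (\<lambda>x. bop (f x) (der g x v) + bop (der f x v) (g x))" for v
      by (intro Ck_on_add[OF assms(2)] Suc.IH) (use p in auto)
  qed
qed

lemma linear_sum_Basis:
  fixes L :: "'a::euclidean_space \<Rightarrow> 'b::real_vector"
  assumes "linear L"
  shows "L v = (\<Sum>e\<in>Basis. (v \<bullet> e) *\<^sub>R L e)"
proof -
  have "L v = L (\<Sum>e\<in>Basis. (v \<bullet> e) *\<^sub>R e)"
    by (simp add: euclidean_representation)
  also have "\<dots> = (\<Sum>e\<in>Basis. (v \<bullet> e) *\<^sub>R L e)"
    using assms by (simp add: linear_sum linear_scale)
  finally show ?thesis .
qed

text \<open>A family of linear maps is not a function into a Euclidean space type, so its regularity
  is stated for each fixed argument v. Expanding a x in the standard basis reduces the application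
  to finitely many products.\<close>

lemma Ck_on_linear_apply:
  fixes L :: "'c::euclidean_space \<Rightarrow> 'a::euclidean_space \<Rightarrow> 'b::euclidean_space"
  assumes "open S" "\<And>x. x \<in> S \<Longrightarrow> linear (L x)" "\<And>v. Ck_on k S (\<lambda>x. L x v)" "Ck_on k S a"
  shows "Ck_on k S (\<lambda>x. L x (a x))"
proof (rule Ck_on_cong[OF assms(1)])
  show "(\<Sum>e\<in>Basis. (a x \<bullet> e) *\<^sub>R L x e) = L x (a x)" if "x \<in> S" for x
    using linear_sum_Basis[OF assms(2)[OF that]] by metis
  show "Ck_on k S (\<lambda>x. \<Sum>e\<in>Basis. (a x \<bullet> e) *\<^sub>R L x e)"
    by (intro Ck_on_sum[OF assms(1)] Ck_on_bilinear[OF bounded_bilinear_scaleR assms(1)]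
        Ck_on_bilinear[OF bounded_bilinear_inner assms(1)] assms(3,4) Ck_on_const)
qed

text \<open>By the chain rule the derivative is the family \<open>der g (f x)\<close> applied to
  \<open>der f x v\<close>. The induction hypothesis, generalised over g, handles
  \<open>der g y w\<close> for fixed w, and the preceding lemma the application.\<close>

lemma Ck_on_compose:
  assumes "open S" "open T" "f ` S \<subseteq> T" "Ck_on k S f" "Ck_on k T g"
  shows "Ck_on k S (\<lambda>x. g (f x))"
  using assms(4,5)
proof (induction k arbitrary: g)
  case 0
  then show ?case
    using assms(3) continuous_on_compose2 by auto
next
  case (Suc k)
  note p = Suc.prems Suc.prems[THEN Ck_on_Suc_imp]
  have d: "(g has_derivative der g (f x)) (at (f x))" if "x \<in> S" for x
    using Ck_on_SucD[OF p(2)] that assms(3) by blast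
  show ?case
  proof (rule Ck_on_SucI[OF assms(1)])
    fix x assume x: "x \<in> S"
    show "((\<lambda>x. g (f x)) has_derivative (\<lambda>v. der g (f x) (der f x v))) (at x)"
      by (rule has_derivative_compose[OF Ck_on_SucD[OF p(1) x] d[OF x]])
  next
    fix v
    show "Ck_on k S (\<lambda>x. der g (f x) (der f x v))"
    proof (rule Ck_on_linear_apply[OF assms(1), of "\<lambda>x. der g (f x)"])
      show "linear (der g (f x))" if "x \<in> S" for x
        using d[OF that] by (rule has_derivative_linear)
      show "Ck_on k S (\<lambda>x. der g (f x) w)" for w
        using Suc.IH[of "\<lambda>y. der g y w"] p by simp
      show "Ck_on k S (\<lambda>x. der f x v)"
        using p by simp
    qed
  qed
qed

section \<open>Closure properties of smooth functions\<close>

lemma smooth_on_subset: "smooth_on S f \<Longrightarrow> T \<subseteq> S \<Longrightarrow> smooth_on T f"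
  unfolding smooth_on_def by (metis Ck_on_subset)

lemma smooth_on_cong:
  assumes "open S" "\<And>x. x \<in> S \<Longrightarrow> f x = g x" "smooth_on S f"
  shows "smooth_on S g"
  using assms(3) Ck_on_cong[OF assms(1,2)] by (auto simp: smooth_on_def)

lemma smooth_on_const: "smooth_on S (\<lambda>x. c)"
  by (simp add: smooth_on_def Ck_on_const)

lemma smooth_on_bounded_linear: "open S \<Longrightarrow> bounded_linear f \<Longrightarrow> smooth_on S f"
  by (simp add: smooth_on_def Ck_on_bounded_linear)

lemma smooth_on_add:
  "open S \<Longrightarrow> smooth_on S f \<Longrightarrow> smooth_on S g \<Longrightarrow> smooth_on S (\<lambda>x. f x + g x)"
  by (simp add: smooth_on_def Ck_on_add)

lemma smooth_on_sum:
  "open S \<Longrightarrow> (\<And>i. i \<in> I \<Longrightarrow> smooth_on S (f i)) \<Longrightarrow> smooth_on S (\<lambda>x. \<Sum>i\<in>I. f i x)"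
  by (simp add: smooth_on_def Ck_on_sum)

lemma smooth_on_compose:
  assumes "open S" "open T" "f ` S \<subseteq> T" "smooth_on S f" "smooth_on T g"
  shows "smooth_on S (\<lambda>x. g (f x))"
  unfolding smooth_on_def
proof
  show "Ck_on k S (\<lambda>x. g (f x))" for k
    by (rule Ck_on_compose[OF assms(1-3)]) (use assms(4,5) in \<open>simp_all add: smooth_on_def\<close>)
qed

lemma smooth_on_bilinear:
  "bounded_bilinear bop \<Longrightarrow> open S \<Longrightarrow> smooth_on S f \<Longrightarrow> smooth_on S g \<Longrightarrow>
    smooth_on S (\<lambda>x. bop (f x) (g x))"
  unfolding smooth_on_def by (rule allI, rule Ck_on_bilinear[where bop = bop and f = f and g = g]) auto

lemma smooth_on_linear_apply:
  "open S \<Longrightarrow> (\<And>x. x \<in> S \<Longrightarrow> linear (L x)) \<Longrightarrow> (\<And>v. smooth_on S (\<lambda>x. L x v)) \<Longrightarrow> smooth_on S a \<Longrightarrow>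
    smooth_on S (\<lambda>x. L x (a x))"
  unfolding smooth_on_def by (rule allI, rule Ck_on_linear_apply[where L = L and a = a]) auto

lemma smooth_on_has_der: "smooth_on S f \<Longrightarrow> x \<in> S \<Longrightarrow> (f has_derivative der f x) (at x)"
  using Ck_on_SucD[of 0 S f] by (simp only: smooth_on_def)

lemma smooth_on_imp_continuous_on:
  assumes "smooth_on S f"
  shows "continuous_on S f"
proof -
  have "Ck_on 0 S f" using assms unfolding smooth_on_def ..
  then show ?thesis by simp
qed

lemma smooth_on_der:
  assumes "smooth_on S f"
  shows "smooth_on S (\<lambda>x. der f x v)"
  unfolding smooth_on_def
proof
  fix k
  have "Ck_on (Suc k) S f" using assms unfolding smooth_on_def ..
  then show "Ck_on k S (\<lambda>x. der f x v)" by simp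
qed

lemma smooth_on_der_apply:
  assumes "open S" "smooth_on S f" "smooth_on S a"
  shows "smooth_on S (\<lambda>x. der f x (a x))"
proof (rule smooth_on_linear_apply[where L = "der f", OF assms(1) _ smooth_on_der[OF assms(2)]
    assms(3)])
  show "linear (der f x)" if "x \<in> S" for x
    using smooth_on_has_der[OF assms(2) that] by (rule has_derivative_linear)
qed

lemma smooth_on_bounded_linear_compose:
  "open S \<Longrightarrow> bounded_linear L \<Longrightarrow> smooth_on S f \<Longrightarrow> smooth_on S (\<lambda>x. L (f x))"
  by (rule smooth_on_compose[OF _ open_UNIV, where f = f and g = L])
    (simp_all add: smooth_on_bounded_linear)

section \<open>Inverses\<close>

text \<open>Only the maps x \<mapsto> A x v with v fixed are assumed differentiable. The basis
  expansion gives a finite sum of products, and uniqueness of derivatives shows that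
  \<open>dA v w\<close> is linear in v, which reassembles the sum.\<close>

lemma has_derivative_linear_family_apply:
  fixes A :: "'c::euclidean_space \<Rightarrow> 'a::euclidean_space \<Rightarrow> 'b::euclidean_space"
  assumes "open S" "x \<in> S" and lin: "\<And>x. x \<in> S \<Longrightarrow> linear (A x)"
    and dA: "\<And>v. ((\<lambda>x. A x v) has_derivative dA v) (at x)"
    and da: "(a has_derivative da) (at x)"
  shows "((\<lambda>x. A x (a x)) has_derivative (\<lambda>w. dA (a x) w + A x (da w))) (at x)"
proof -
  have "((\<lambda>x. \<Sum>e\<in>Basis. (a x \<bullet> e) *\<^sub>R A x e) has_derivative
      (\<lambda>w. \<Sum>e\<in>Basis. (a x \<bullet> e) *\<^sub>R dA e w + (da w \<bullet> e) *\<^sub>R A x e)) (at x)"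
    by (intro has_derivative_sum has_derivative_scaleR has_derivative_inner_left dA da)
  then have d: "((\<lambda>x. A x (a x)) has_derivative
      (\<lambda>w. \<Sum>e\<in>Basis. (a x \<bullet> e) *\<^sub>R dA e w + (da w \<bullet> e) *\<^sub>R A x e)) (at x)"
    by (rule has_derivative_transform_within_open[OF _ assms(1,2)])
      (rule linear_sum_Basis[OF lin, symmetric])
  have "((\<lambda>x. \<Sum>e\<in>Basis. (v \<bullet> e) *\<^sub>R A x e) has_derivative
      (\<lambda>w. \<Sum>e\<in>Basis. (v \<bullet> e) *\<^sub>R dA e w)) (at x)" for v
    by (intro has_derivative_sum has_derivative_scaleR_right dA)
  then have "((\<lambda>y. A y v) has_derivative (\<lambda>w. \<Sum>e\<in>Basis. (v \<bullet> e) *\<^sub>R dA e w)) (at x)" for v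
    by (rule has_derivative_transform_within_open[OF _ assms(1,2)])
      (rule linear_sum_Basis[OF lin, symmetric])
  from has_derivative_unique[OF dA this]
  have dA_sum: "dA v w = (\<Sum>e\<in>Basis. (v \<bullet> e) *\<^sub>R dA e w)" for v w
    by (rule fun_cong)
  have "dA (a x) w + A x (da w) =
      (\<Sum>e\<in>Basis. (a x \<bullet> e) *\<^sub>R dA e w + (da w \<bullet> e) *\<^sub>R A x e)" for w
    using dA_sum[of "a x" w] linear_sum_Basis[OF lin[OF assms(2)], of "da w"]
    by (simp only: sum.distrib)
  then show ?thesis
    using d by presburger
qed

lemma linear_der_linear_family:
  fixes A :: "'c::euclidean_space \<Rightarrow> 'a::euclidean_space \<Rightarrow> 'b::euclidean_space"
  assumes S: "open S" "x \<in> S" and lin: "\<And>x. x \<in> S \<Longrightarrow> linear (A x)"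
    and dA: "\<And>v. ((\<lambda>x. A x v) has_derivative der (\<lambda>x. A x v) x) (at x)"
  shows "linear (\<lambda>u. der (\<lambda>x. A x u) x v)"
proof -
  have *: "der (\<lambda>x. A x u) x v = (\<Sum>e\<in>Basis. (u \<bullet> e) *\<^sub>R der (\<lambda>x. A x e) x v)" for u
  proof -
    have "((\<lambda>y. \<Sum>e\<in>Basis. (u \<bullet> e) *\<^sub>R A y e) has_derivative
        (\<lambda>w. \<Sum>e\<in>Basis. (u \<bullet> e) *\<^sub>R der (\<lambda>x. A x e) x w)) (at x)"
      by (intro has_derivative_sum has_derivative_scaleR_right dA)
    then have "((\<lambda>y. A y u) has_derivative
        (\<lambda>w. \<Sum>e\<in>Basis. (u \<bullet> e) *\<^sub>R der (\<lambda>x. A x e) x w)) (at x)"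
      by (rule has_derivative_transform_within_open[OF _ S])
        (rule linear_sum_Basis[OF lin, symmetric])
    then show ?thesis by (simp add: der_eqI)
  qed
  show ?thesis
    by (subst *) (auto intro!: linearI simp: inner_add_left scaleR_add_left sum.distrib
        scaleR_sum_right)
qed

lemma linear_inverse_function:
  assumes f: "linear f" and fk: "\<And>v. f (k v) = v" and kf: "\<And>v. k (f v) = v"
  shows "linear k"
proof (rule linearI)
  show "k (u + v) = k u + k v" for u v
    by (metis fk kf linear_add[OF f])
  show "k (r *\<^sub>R u) = r *\<^sub>R k u" for r u
    by (metis fk kf linear_scale[OF f])
qed

text \<open>No regularity of L in x is assumed. The map (x, v) \<mapsto> (x, A x v) has the inverse
  (x, v) \<mapsto> (x, L x v), and the strong inverse function theorem, which does not ask for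
  continuity of the inverse, differentiates it.\<close>

lemma has_derivative_inverse_linear_family:
  fixes A :: "'c::euclidean_space \<Rightarrow> 'a::euclidean_space \<Rightarrow> 'a"
  assumes S: "open S" and lin: "\<And>x. x \<in> S \<Longrightarrow> linear (A x)"
    and dA: "\<And>x v. x \<in> S \<Longrightarrow> ((\<lambda>x. A x v) has_derivative der (\<lambda>x. A x v) x) (at x)"
    and AL: "\<And>x v. x \<in> S \<Longrightarrow> A x (L x v) = v" and LA: "\<And>x v. x \<in> S \<Longrightarrow> L x (A x v) = v"
    and x0: "x0 \<in> S" and linL: "linear (L x0)"
  shows "((\<lambda>x. L x b) has_derivative (\<lambda>w. - L x0 (der (\<lambda>x. A x (L x0 b)) x0 w))) (at x0)"
proof -
  define d where "d = der (\<lambda>x. A x (L x0 b)) x0"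
  define G where "G = (\<lambda>z. (fst z, A (fst z) (snd z)))"
  define K where "K = (\<lambda>z. (fst z, L (fst z) (snd z)))"
  define G' where "G' = (\<lambda>z. (fst z, d (fst z) + A x0 (snd z)))"
  \<comment> \<open>The right inverse of \<open>G'\<close>: the first component is kept, and the
    variation d of A is subtracted from the second before L is applied.\<close>
  define K' where "K' = (\<lambda>z. (fst z, L x0 (snd z - d (fst z))))"
  have Gder: "(G has_derivative (\<lambda>z. (fst z, der (\<lambda>x. A x (snd y)) (fst y) (fst z)
      + A (fst y) (snd z)))) (at y)" if "y \<in> S \<times> UNIV" for y
    unfolding G_def
  proof (rule has_derivative_Pair[OF has_derivative_fst[OF has_derivative_ident]])
    have y: "fst y \<in> S" using that by auto
    show "((\<lambda>x. A (fst x) (snd x)) has_derivative (\<lambda>x. der (\<lambda>x. A x (snd y)) (fst y) (fst x)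
       + A (fst y) (snd x))) (at y)"
    proof (rule has_derivative_linear_family_apply[where A = "\<lambda>z. A (fst z)" and S = "S \<times> UNIV"
          and a = snd and da = snd and dA = "\<lambda>v h. der (\<lambda>x. A x v) (fst y) (fst h)"])
      fix v
      show "((\<lambda>x. A (fst x) v) has_derivative (\<lambda>x. der (\<lambda>x. A x v) (fst y) (fst x))) (at y)"
        by (rule has_derivative_compose[OF has_derivative_fst[OF has_derivative_ident] dA[OF y]])
    qed (use that S lin in \<open>auto intro!: open_Times has_derivative_snd[OF has_derivative_ident]\<close>)
  qed
  have "(K has_derivative K') (at (G (x0, L x0 b)))"
  proof (rule has_derivative_inverse_strong[where f = G and S = "S \<times> UNIV" and f' = G'])
    show "continuous_on (S \<times> UNIV) G"
      by (rule has_derivative_continuous_on[OF has_derivative_at_withinI[OF Gder]])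
    show "(G has_derivative G') (at (x0, L x0 b))"
      using Gder[of "(x0, L x0 b)"] x0 by (simp add: G'_def d_def)
    show "G' \<circ> K' = id"
      using AL[OF x0] by (simp add: G'_def K'_def fun_eq_iff)
    show "K (G x) = x" if "x \<in> S \<times> UNIV" for x
      using that LA by (auto simp: K_def G_def)
  qed (use S x0 in \<open>auto simp: open_Times\<close>)
  then have K: "(K has_derivative K') (at (x0, b))"
    using AL[OF x0] by (simp add: G_def)
  have "((\<lambda>x. (x, b)) has_derivative (\<lambda>w. (w, 0))) (at x0)"
    by (intro has_derivative_Pair has_derivative_ident has_derivative_const)
  from has_derivative_snd[OF has_derivative_compose[OF this K]]
  show ?thesis
    by (simp add: K_def K'_def linear_neg[OF linL] d_def)
qed

text \<open>The derivative of L contains L itself but no derivative of L, so order k for all b gives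
  order k + 1: a bootstrap that starts from continuity.\<close>

lemma smooth_on_inverse_linear_family:
  fixes A :: "'c::euclidean_space \<Rightarrow> 'a::euclidean_space \<Rightarrow> 'a"
  assumes S: "open S" and lin: "\<And>x. x \<in> S \<Longrightarrow> linear (A x)"
    and sm: "\<And>v. smooth_on S (\<lambda>x. A x v)"
    and AL: "\<And>x v. x \<in> S \<Longrightarrow> A x (L x v) = v" and LA: "\<And>x v. x \<in> S \<Longrightarrow> L x (A x v) = v"
  shows "smooth_on S (\<lambda>x. L x b)"
proof -
  have linL: "linear (L x)" if x: "x \<in> S" for x
    by (rule linear_inverse_function[OF lin AL LA]) (rule x)+
  have dA: "((\<lambda>x. A x v) has_derivative der (\<lambda>x. A x v) x) (at x)" if "x \<in> S" for x v
    using smooth_on_has_der[OF sm that] .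
  have dL: "((\<lambda>x. L x b) has_derivative (\<lambda>w. - L x0 (der (\<lambda>x. A x (L x0 b)) x0 w))) (at x0)"
    if "x0 \<in> S" for x0 b
    by (rule has_derivative_inverse_linear_family[OF S lin dA AL LA that linL[OF that]])
  have "Ck_on k S (\<lambda>x. L x b)" for k b
  proof (induction k arbitrary: b)
    case 0
    show ?case
      using has_derivative_continuous_on[OF has_derivative_at_withinI[OF dL]] by simp
  next
    case (Suc k)
    show ?case
    proof (rule Ck_on_SucI[OF S dL])
      fix v
      have "Ck_on k S (\<lambda>x. der (\<lambda>y. A y (L x b)) x v)"
      proof (rule Ck_on_linear_apply[OF S _ _ Suc.IH, where L = "\<lambda>x u. der (\<lambda>y. A y u) x v"])
        show "linear (\<lambda>u. der (\<lambda>y. A y u) x v)" if "x \<in> S" for x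
          by (rule linear_der_linear_family[OF S that lin dA[OF that]])
        show "Ck_on k S (\<lambda>x. der (\<lambda>y. A y u) x v)" for u
          using smooth_on_der[OF sm] unfolding smooth_on_def ..
      qed
      from Ck_on_linear_apply[where L = L, OF S linL Suc.IH this]
      have "Ck_on k S (\<lambda>x. L x (der (\<lambda>y. A y (L x b)) x v))" .
      from Ck_on_compose[OF S open_UNIV _ this, of uminus]
      show "Ck_on k S (\<lambda>x. - L x (der (\<lambda>y. A y (L x b)) x v))"
        by (simp add: Ck_on_bounded_linear bounded_linear_minus bounded_linear_ident)
    qed
  qed
  then show ?thesis by (simp add: smooth_on_def)
qed

text \<open>The inverse function theorem gives k only as a differentiable map. Its derivative at y
  is the inverse of \<open>der f (k y)\<close>, a smooth family of inverses composed with k, so each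
  order of k yields the next.\<close>

lemma smooth_on_local_inverse:
  fixes f :: "'a::euclidean_space \<Rightarrow> 'a"
  assumes U: "open U" "x0 \<in> U" and f: "smooth_on U f" and inj: "inj (der f x0)"
  obtains U' V k where "open U'" "U' \<subseteq> U" "x0 \<in> U'" "open V" "f x0 \<in> V" "f ` U' = V" "k ` V = U'"
    "\<And>x. x \<in> U' \<Longrightarrow> k (f x) = x" "\<And>y. y \<in> V \<Longrightarrow> f (k y) = y" "smooth_on V k"
proof -
  define f' where "f' = (\<lambda>x. Blinfun (der f x))"
  have fd: "(f has_derivative der f x) (at x)" if "x \<in> U" for x
    by (rule smooth_on_has_der[OF f that])
  have f': "blinfun_apply (f' x) = der f x" if "x \<in> U" for x
    unfolding f'_def using has_derivative_bounded_linear[OF fd[OF that]]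
    by (rule bounded_linear_Blinfun_apply)
  have lin: "linear (der f x)" if "x \<in> U" for x
    using fd[OF that] by (rule has_derivative_linear)
  have cont: "continuous_on U f'"
  proof (rule continuous_on_blinfun_componentwise)
    fix v :: 'a
    show "continuous_on U (\<lambda>x. blinfun_apply (f' x) v)"
      by (rule continuous_on_eq[OF smooth_on_imp_continuous_on[OF smooth_on_der[OF f, of v]]])
        (simp add: f')
  qed
  obtain g0 where g0: "linear g0" "g0 \<circ> der f x0 = id"
    using linear_injective_left_inverse[OF lin[OF U(2)] inj] by blast
  have "Blinfun g0 o\<^sub>L f' x0 = id_blinfun"
  proof (rule blinfun_eqI)
    fix v
    have "blinfun_apply (Blinfun g0) = g0"
      using g0(1) by (simp add: bounded_linear_Blinfun_apply linear_conv_bounded_linear)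
    then show "blinfun_apply (Blinfun g0 o\<^sub>L f' x0) v = blinfun_apply id_blinfun v"
      using fun_cong[OF g0(2), of v] f'[OF U(2)] by simp
  qed
  from inverse_function_theorem[OF U(1) _ cont U(2) this, of f] fd f'
  obtain U' V k k' where *: "open U'" "U' \<subseteq> U" "x0 \<in> U'" "open V" "f x0 \<in> V"
    "homeomorphism U' V f k" "\<And>y. y \<in> V \<Longrightarrow> (k has_derivative (k' y)) (at y)"
    "\<And>y. y \<in> V \<Longrightarrow> k' y = inv (blinfun_apply (f' (k y)))"
    "\<And>y. y \<in> V \<Longrightarrow> bij (blinfun_apply (f' (k y)))"
    by metis
  have kV: "k ` V = U'" and fU: "f ` U' = V" and kf: "\<And>x. x \<in> U' \<Longrightarrow> k (f x) = x"
    and fk: "\<And>y. y \<in> V \<Longrightarrow> f (k y) = y" and contk: "continuous_on V k"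
    using *(6) by (auto simp: homeomorphism_def)
  have bij: "bij (der f x)" if "x \<in> U'" for x
  proof -
    from that have "x \<in> k ` V" using kV by simp
    then obtain y where "y \<in> V" "x = k y" by blast
    then show ?thesis using *(9)[of y] f'[of x] that *(2) by auto
  qed
  have smL: "smooth_on U' (\<lambda>x. inv (der f x) b)" for b
  proof (rule smooth_on_inverse_linear_family[OF *(1), where A = "der f"])
    show "linear (der f x)" if "x \<in> U'" for x using lin that *(2) by blast
    show "smooth_on U' (\<lambda>x. der f x v)" for v
      by (rule smooth_on_der[OF smooth_on_subset[OF f *(2)]])
  qed (use bij in \<open>auto simp: bij_is_inj surj_f_inv_f bij_is_surj\<close>)
  have "Ck_on j V k" for j
  proof (induction j)
    case 0
    then show ?case using contk by simp
  next
    case (Suc j)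
    show ?case
    proof (rule Ck_on_SucI[OF *(4)])
      show "(k has_derivative inv (der f (k y))) (at y)" if "y \<in> V" for y
      proof -
        have "k y \<in> U" using that kV *(2) by blast
        then show ?thesis using *(7,8)[OF that] f' by simp
      qed
      show "Ck_on j V (\<lambda>y. inv (der f (k y)) v)" for v
        by (rule Ck_on_compose[OF *(4,1) _ Suc, where g = "\<lambda>x. inv (der f x) v"])
          (use kV smL[of v] in \<open>auto simp: smooth_on_def\<close>)
    qed
  qed
  then have "smooth_on V k" by (simp add: smooth_on_def)
  then show ?thesis using that *(1-5) fU kV kf fk by blast
qed

section \<open>Symmetry of the second derivative\<close>

text \<open>The mean value theorem is applied twice: along a to the increment of f in direction b,
  then along b to the directional derivative \<open>der f y a\<close>.\<close>

lemma second_difference_mean_value: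
  fixes f :: "'a::euclidean_space \<Rightarrow> real"
  assumes sub: "cball x (h * (norm a + norm b)) \<subseteq> S" and h: "h > 0" and f: "smooth_on S f"
  obtains z where "dist x z \<le> h * (norm a + norm b)"
    "f (x + h *\<^sub>R a + h *\<^sub>R b) - f (x + h *\<^sub>R a) - f (x + h *\<^sub>R b) + f x
      = h * h * der (\<lambda>y. der f y a) z b"
proof -
  have near: "dist x (x + s *\<^sub>R a + t *\<^sub>R b) \<le> h * (norm a + norm b)"
    if "0 \<le> s" "s \<le> h" "0 \<le> t" "t \<le> h" for s t
  proof -
    have "norm (s *\<^sub>R a + t *\<^sub>R b) \<le> s * norm a + t * norm b"
      using that by (intro norm_triangle_le) simp
    also have "\<dots> \<le> h * norm a + h * norm b"
      using that by (intro add_mono mult_right_mono) auto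
    finally show ?thesis by (simp add: dist_norm algebra_simps norm_minus_commute)
  qed
  have inS: "x + s *\<^sub>R a + t *\<^sub>R b \<in> S" if "0 \<le> s" "s \<le> h" "0 \<le> t" "t \<le> h" for s t
    using near[OF that] sub by auto
  have line: "DERIV (\<lambda>s. k (c + s *\<^sub>R v)) s :> der k (c + s *\<^sub>R v) v"
    if "smooth_on S k" "c + s *\<^sub>R v \<in> S" for k :: "'a \<Rightarrow> real" and c v s
  proof -
    have k: "(k has_derivative der k (c + s *\<^sub>R v)) (at (c + s *\<^sub>R v))"
      by (rule smooth_on_has_der[OF that])
    have "((\<lambda>s. c + s *\<^sub>R v) has_derivative (\<lambda>r. r *\<^sub>R v)) (at s)"
      by (auto intro!: derivative_eq_intros)
    from has_derivative_compose[OF this k]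
    show ?thesis
      using linear_scale[OF has_derivative_linear[OF k]]
      by (simp add: has_field_derivative_def mult.commute[of _ "der k _ _"])
  qed
  define u where "u = (\<lambda>s. f (x + h *\<^sub>R b + s *\<^sub>R a) - f (x + s *\<^sub>R a))"
  have "\<exists>s. 0 < s \<and> s < h \<and> u h - u 0 =
      (h - 0) * (der f (x + h *\<^sub>R b + s *\<^sub>R a) a - der f (x + s *\<^sub>R a) a)"
  proof (rule MVT2[OF h])
    fix s assume s: "0 \<le> s" "s \<le> h"
    show "DERIV u s :> der f (x + h *\<^sub>R b + s *\<^sub>R a) a - der f (x + s *\<^sub>R a) a"
      unfolding u_def
      using inS[OF s, of h] inS[OF s, of 0] h
      by (intro DERIV_diff line[OF f]) (auto simp: add_ac)
  qed
  then obtain s where s: "0 < s" "s < h"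
    "u h - u 0 = h * (der f (x + h *\<^sub>R b + s *\<^sub>R a) a - der f (x + s *\<^sub>R a) a)" by auto
  have "\<exists>t. 0 < t \<and> t < h \<and> der f (x + s *\<^sub>R a + h *\<^sub>R b) a - der f (x + s *\<^sub>R a + 0 *\<^sub>R b) a =
      (h - 0) * der (\<lambda>y. der f y a) (x + s *\<^sub>R a + t *\<^sub>R b) b"
    by (rule MVT2[OF h]) (use inS s in \<open>auto intro!: line[OF smooth_on_der[OF f]]\<close>)
  then obtain t where t: "0 < t" "t < h" "der f (x + s *\<^sub>R a + h *\<^sub>R b) a - der f (x + s *\<^sub>R a) a =
      h * der (\<lambda>y. der f y a) (x + s *\<^sub>R a + t *\<^sub>R b) b" by auto
  show ?thesis
  proof (rule that)
    show "dist x (x + s *\<^sub>R a + t *\<^sub>R b) \<le> h * (norm a + norm b)"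
      using near s t by simp
    show "f (x + h *\<^sub>R a + h *\<^sub>R b) - f (x + h *\<^sub>R a) - f (x + h *\<^sub>R b) + f x
      = h * h * der (\<lambda>y. der f y a) (x + s *\<^sub>R a + t *\<^sub>R b) b"
      using s(3) t(3) by (simp add: u_def add_ac)
  qed
qed

text \<open>The second difference is symmetric in a and b, and it is h * h times a mixed derivative
  of either order at points near x; continuity of both mixed derivatives does the rest.\<close>

lemma der_der_commute_real:
  fixes f :: "'a::euclidean_space \<Rightarrow> real"
  assumes S: "open S" "x \<in> S" and f: "smooth_on S f"
  shows "der (\<lambda>y. der f y a) x b = der (\<lambda>y. der f y b) x a"
proof -
  let ?H = "\<lambda>a b z. der (\<lambda>y. der f y a) z b"
  have "\<bar>?H a b x - ?H b a x\<bar> \<le> e" if "e > 0" for e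
  proof -
    have c: "isCont (?H a b) x" "isCont (?H b a) x"
      using smooth_on_imp_continuous_on[OF smooth_on_der[OF smooth_on_der[OF f]]] S
      by (simp_all add: continuous_on_eq_continuous_at)
    have e2: "e / 2 > 0" using that by simp
    obtain d1 where d1: "d1 > 0" "\<And>z. dist z x < d1 \<Longrightarrow> \<bar>?H a b z - ?H a b x\<bar> < e / 2"
      using c(1) e2 unfolding continuous_at_eps_delta dist_real_def by blast
    obtain d2 where d2: "d2 > 0" "\<And>z. dist z x < d2 \<Longrightarrow> \<bar>?H b a z - ?H b a x\<bar> < e / 2"
      using c(2) e2 unfolding continuous_at_eps_delta dist_real_def by blast
    obtain d3 where d3: "d3 > 0" "cball x d3 \<subseteq> S"
      using S open_contains_cball by blast
    \<comment> \<open>Halving makes d strictly smaller than d1 and d2; the summand 1 in the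
      denominator of h keeps it positive when a and b are both 0.\<close>
    define d where "d = min d3 (min d1 d2) / 2"
    have d: "d > 0" "d < d1" "d < d2" "d \<le> d3" using d1 d2 d3 by (auto simp: d_def)
    define h where "h = d / (norm a + norm b + 1)"
    have n: "norm a + norm b + 1 > 0" by (smt (verit) norm_ge_zero)
    have h: "h > 0" unfolding h_def using d n by (intro divide_pos_pos)
    have "h * (norm a + norm b + 1) = d" using n by (simp add: h_def)
    then have hd: "h * (norm a + norm b) \<le> d" using h by (simp add: algebra_simps)
    have sub: "cball x (h * (norm a + norm b)) \<subseteq> S" using hd d d3 by force
    obtain z1 where z1: "dist x z1 \<le> h * (norm a + norm b)"
      "f (x + h *\<^sub>R a + h *\<^sub>R b) - f (x + h *\<^sub>R a) - f (x + h *\<^sub>R b) + f x = h * h * ?H a b z1"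
      using second_difference_mean_value[OF sub h f] by blast
    have sub': "cball x (h * (norm b + norm a)) \<subseteq> S" using sub by (simp add: add.commute)
    obtain z2 where z2: "dist x z2 \<le> h * (norm b + norm a)"
      "f (x + h *\<^sub>R b + h *\<^sub>R a) - f (x + h *\<^sub>R b) - f (x + h *\<^sub>R a) + f x = h * h * ?H b a z2"
      using second_difference_mean_value[OF sub' h f] by blast
    have "f (x + h *\<^sub>R b + h *\<^sub>R a) = f (x + h *\<^sub>R a + h *\<^sub>R b)"
      by (simp add: add_ac)
    then have "h * h * ?H a b z1 = h * h * ?H b a z2" using z1(2) z2(2) by linarith
    then have "?H a b z1 = ?H b a z2" using h by simp
    moreover have "\<bar>?H a b z1 - ?H a b x\<bar> < e / 2"
      using z1(1) hd d by (intro d1(2)) (simp add: dist_commute)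
    moreover have "\<bar>?H b a z2 - ?H b a x\<bar> < e / 2"
      using z2(1) hd d by (intro d2(2)) (simp add: dist_commute add.commute)
    ultimately show ?thesis by linarith
  qed
  then have "\<bar>?H a b x - ?H b a x\<bar> \<le> 0" by (rule field_le_epsilon) simp
  then show ?thesis by simp
qed

lemma der_der_commute:
  fixes f :: "'a::euclidean_space \<Rightarrow> 'b::euclidean_space"
  assumes S: "open S" "x \<in> S" and f: "smooth_on S f"
  shows "der (\<lambda>y. der f y a) x b = der (\<lambda>y. der f y b) x a"
proof (rule euclidean_eqI)
  fix e :: 'b assume "e \<in> Basis"
  let ?k = "\<lambda>y. f y \<bullet> e"
  have 1: "der ?k y v = der f y v \<bullet> e" if "y \<in> S" for y v
    using der_eqI[OF has_derivative_inner_left[OF smooth_on_has_der[OF f that]]] by metis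
  have 2: "der (\<lambda>y. der ?k y v) x w = der (\<lambda>y. der f y v) x w \<bullet> e" for v w
  proof -
    have "der (\<lambda>y. der ?k y v) x = der (\<lambda>y. der f y v \<bullet> e) x"
      by (rule der_cong_open[OF S 1])
    also have "\<dots> = (\<lambda>w. der (\<lambda>y. der f y v) x w \<bullet> e)"
      by (rule der_eqI[OF has_derivative_inner_left[OF smooth_on_has_der[OF smooth_on_der[OF f] S(2)]]])
    finally show ?thesis by (rule fun_cong)
  qed
  have "smooth_on S ?k"
    by (rule smooth_on_bounded_linear_compose[OF S(1) bounded_linear_inner_left f])
  from der_der_commute_real[OF S this, of a b] show
    "der (\<lambda>y. der f y a) x b \<bullet> e = der (\<lambda>y. der f y b) x a \<bullet> e"
    unfolding 2 .
qed

section \<open>Charts\<close>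

lemma chart_inv_left: "is_chart c \<Longrightarrow> p \<in> fst c \<Longrightarrow> chart_inv c (snd c p) = p"
  unfolding is_chart_def homeomorphism_def by blast

lemma chart_inv_right: "x \<in> snd c ` fst c \<Longrightarrow> snd c (chart_inv c x) = x"
  unfolding chart_inv_def by (rule f_inv_into_f)

lemma chart_inv_in: "x \<in> snd c ` fst c \<Longrightarrow> chart_inv c x \<in> fst c"
  unfolding chart_inv_def by (rule inv_into_into)

lemma open_chart_image:
  assumes "is_chart c" "open U"
  shows "open (snd c ` (fst c \<inter> U))"
proof -
  have "openin (top_of_set (snd c ` fst c)) (snd c ` (fst c \<inter> U))"
    using assms unfolding is_chart_def
    by (intro homeomorphism_imp_open_map[of _ _ _ "chart_inv c"]) (auto simp: openin_open)
  then show ?thesis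
    using assms unfolding is_chart_def by (metis openin_open_eq)
qed

lemma open_chart_dom: "is_chart c \<Longrightarrow> open (fst c)"
  unfolding is_chart_def by blast

text \<open>The tangent vector at \<open>p\<close> whose components in the chart \<open>c\<close> are given.\<close>

definition chart_frame ::
    "('a, 'e::euclidean_space) chart set \<Rightarrow> ('a, 'e) chart \<Rightarrow> 'a \<Rightarrow> 'e \<Rightarrow> 'e" where
  "chart_frame A c p v = der (snd (chart_at A p) \<circ> chart_inv c) (snd c p) v"

context
  fixes A :: "('a::{t2_space, second_countable_topology}, 'e::euclidean_space) chart set"
  assumes atlas: "smooth_atlas A"
begin

lemma atlas_chart: "c \<in> A \<Longrightarrow> is_chart c"
  using atlas unfolding smooth_atlas_def by blast

lemma chart_at: "chart_at A p \<in> A" "p \<in> fst (chart_at A p)"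
proof -
  have "\<exists>c. c \<in> A \<and> p \<in> fst c"
    using atlas unfolding smooth_atlas_def by blast
  from someI_ex[OF this] show "chart_at A p \<in> A" "p \<in> fst (chart_at A p)"
    unfolding chart_at_def by auto
qed

lemma smooth_on_transition:
  "c \<in> A \<Longrightarrow> d \<in> A \<Longrightarrow> smooth_on (snd c ` (fst c \<inter> fst d)) (snd d \<circ> chart_inv c)"
  using atlas unfolding smooth_atlas_def by blast

lemma has_der_transition:
  assumes "c \<in> A" "d \<in> A" "p \<in> fst c" "p \<in> fst d"
  shows "(snd d \<circ> chart_inv c has_derivative der (snd d \<circ> chart_inv c) (snd c p)) (at (snd c p))"
  by (rule smooth_on_has_der[OF smooth_on_transition[OF assms(1,2)]]) (use assms in auto)

lemma linear_der_transition:
  "c \<in> A \<Longrightarrow> d \<in> A \<Longrightarrow> p \<in> fst c \<Longrightarrow> p \<in> fst d \<Longrightarrow> linear (der (snd d \<circ> chart_inv c) (snd c p))"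
  by (rule has_derivative_linear[OF has_der_transition])

lemma has_der_change_chart:
  fixes F :: "'a \<Rightarrow> 'c::euclidean_space"
  assumes c: "c \<in> A" "p \<in> fst c" and d: "d \<in> A" "p \<in> fst d"
    and F: "(F \<circ> chart_inv d has_derivative F') (at (snd d p))"
  shows "(F \<circ> chart_inv c has_derivative (\<lambda>v. F' (der (snd d \<circ> chart_inv c) (snd c p) v))) (at
      (snd c p))"
proof -
  have "(snd d \<circ> chart_inv c) (snd c p) = snd d p"
    using c by (simp add: chart_inv_left atlas_chart)
  with F have "(F \<circ> chart_inv d has_derivative F') (at ((snd d \<circ> chart_inv c) (snd c p)))" by simp
  from has_derivative_compose[OF has_der_transition[OF c(1) d(1) c(2) d(2)] this]
  show ?thesis
  proof (rule has_derivative_transform_within_open)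
    show "open (snd c ` (fst c \<inter> fst d))"
      by (intro open_chart_image open_chart_dom atlas_chart c d)
    show "snd c p \<in> snd c ` (fst c \<inter> fst d)" using c d by blast
    show "(F \<circ> chart_inv d) ((snd d \<circ> chart_inv c) x) = (F \<circ> chart_inv c) x"
      if "x \<in> snd c ` (fst c \<inter> fst d)" for x
      using that c d by (auto simp: chart_inv_left atlas_chart)
  qed
qed

lemma der_transition_cocycle:
  assumes "c \<in> A" "p \<in> fst c" "d \<in> A" "p \<in> fst d" "e \<in> A" "p \<in> fst e"
  shows "der (snd e \<circ> chart_inv d) (snd d p) (der (snd d \<circ> chart_inv c) (snd c p) v)
    = der (snd e \<circ> chart_inv c) (snd c p) v"
  using der_eqI[OF has_der_change_chart[OF assms(1-4) has_der_transition[OF assms(3,5,4,6)]]]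
  by simp

lemma der_transition_self:
  assumes "c \<in> A" "p \<in> fst c"
  shows "der (snd c \<circ> chart_inv c) (snd c p) v = v"
proof -
  have "der (snd c \<circ> chart_inv c) (snd c p) = der id (snd c p)"
  proof (rule der_cong_open)
    show "open (snd c ` (fst c \<inter> UNIV))"
      by (intro open_chart_image atlas_chart assms open_UNIV)
    show "snd c p \<in> snd c ` (fst c \<inter> UNIV)" using assms by simp
    show "(snd c \<circ> chart_inv c) x = id x" if "x \<in> snd c ` (fst c \<inter> UNIV)" for x
      using that by (simp add: chart_inv_right)
  qed
  then show ?thesis by simp
qed

lemma linear_components: "c \<in> A \<Longrightarrow> p \<in> fst c \<Longrightarrow> linear (components A c p)"
  unfolding components_def using linear_der_transition[OF chart_at(1) _ chart_at(2)] by simp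

lemma linear_chart_frame: "c \<in> A \<Longrightarrow> p \<in> fst c \<Longrightarrow> linear (chart_frame A c p)"
  unfolding chart_frame_def using linear_der_transition[OF _ chart_at(1) _ chart_at(2)] by simp

lemma components_chart_frame_transition:
  "c \<in> A \<Longrightarrow> p \<in> fst c \<Longrightarrow> d \<in> A \<Longrightarrow> p \<in> fst d \<Longrightarrow>
    components A c p (chart_frame A d p v) = der (snd c \<circ> chart_inv d) (snd d p) v"
  unfolding components_def chart_frame_def by (intro der_transition_cocycle chart_at)

lemma components_chart_frame:
  "c \<in> A \<Longrightarrow> p \<in> fst c \<Longrightarrow> components A c p (chart_frame A c p v) = v"
  by (simp add: components_chart_frame_transition der_transition_self)

lemma chart_frame_components:
  assumes "c \<in> A" "p \<in> fst c"
  shows "chart_frame A c p (components A c p v) = v"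
  unfolding components_def chart_frame_def
  by (simp add: der_transition_cocycle[OF chart_at assms chart_at] der_transition_self[OF chart_at])

lemma components_chart_at: "components A (chart_at A p) p v = v"
  unfolding components_def by (rule der_transition_self[OF chart_at])

lemma chart_frame_chart_at: "chart_frame A (chart_at A p) p v = v"
  unfolding chart_frame_def by (rule der_transition_self[OF chart_at])

lemma dfun_chart:
  assumes "c \<in> A" "p \<in> fst c" "(f \<circ> chart_inv c has_derivative f') (at (snd c p))"
  shows "dfun A f p v = f' (components A c p v)"
  unfolding dfun_def components_def
  using der_eqI[OF has_der_change_chart[OF chart_at assms]] by simp

lemma smooth_funD:
  "smooth_fun A U f \<Longrightarrow> c \<in> A \<Longrightarrow> smooth_on (snd c ` (fst c \<inter> U)) (f \<circ> chart_inv c)"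
  unfolding smooth_fun_def by blast

lemma smooth_fun_cong:
  assumes "open U" "\<And>q. q \<in> U \<Longrightarrow> f q = k q" "smooth_fun A U f"
  shows "smooth_fun A U k"
  unfolding smooth_fun_def
proof
  fix c assume c: "c \<in> A"
  show "smooth_on (snd c ` (fst c \<inter> U)) (k \<circ> chart_inv c)"
    by (rule smooth_on_cong[OF open_chart_image[OF atlas_chart[OF c] assms(1)] _
          smooth_funD[OF assms(3) c]])
      (use assms(2) c in \<open>auto simp: chart_inv_left atlas_chart\<close>)
qed

lemma smooth_fun_const: "smooth_fun A U (\<lambda>_. r)"
  unfolding smooth_fun_def o_def by (simp add: smooth_on_const)

lemma smooth_fun_chart:
  assumes "open U" "d \<in> A" "U \<subseteq> fst d" "smooth_on (snd d ` U) r"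
  shows "smooth_fun A U (\<lambda>q. r (snd d q))"
  unfolding smooth_fun_def
proof
  fix c assume c: "c \<in> A"
  have o: "open (snd c ` (fst c \<inter> U))" "open (snd d ` U)"
    using open_chart_image[OF atlas_chart] assms c by (auto, metis Int_absorb1)
  have "smooth_on (snd c ` (fst c \<inter> U)) (\<lambda>x. r ((snd d \<circ> chart_inv c) x))"
  proof (rule smooth_on_compose[OF o, where f = "snd d \<circ> chart_inv c" and g = r])
    show "(snd d \<circ> chart_inv c) ` snd c ` (fst c \<inter> U) \<subseteq> snd d ` U"
      using c by (auto simp: chart_inv_left atlas_chart)
    show "smooth_on (snd c ` (fst c \<inter> U)) (snd d \<circ> chart_inv c)"
      by (rule smooth_on_subset[OF smooth_on_transition[OF c assms(2)]]) (use assms(3) in auto)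
  qed (rule assms)
  then show "smooth_on (snd c ` (fst c \<inter> U)) ((\<lambda>q. r (snd d q)) \<circ> chart_inv c)"
    by (simp add: o_def)
qed

lemma smooth_vfD:
  "smooth_vf A U X \<Longrightarrow> c \<in> A \<Longrightarrow>
    smooth_on (snd c ` (fst c \<inter> U)) (\<lambda>x. components A c (chart_inv c x) (X (chart_inv c x)))"
  unfolding smooth_vf_def by blast

lemma smooth_vfI:
  assumes U: "open U" and Y: "\<And>c. c \<in> A \<Longrightarrow> smooth_on (snd c ` (fst c \<inter> U)) (Y c)"
    and eq: "\<And>c q. c \<in> A \<Longrightarrow> q \<in> fst c \<Longrightarrow> q \<in> U \<Longrightarrow> Y c (snd c q) = components A c q (X q)"
  shows "smooth_vf A U X"
  unfolding smooth_vf_def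
proof
  fix c assume c: "c \<in> A"
  show "smooth_on (snd c ` (fst c \<inter> U)) (\<lambda>x. components A c (chart_inv c x) (X (chart_inv c x)))"
    by (rule smooth_on_cong[OF open_chart_image[OF atlas_chart[OF c] U] _ Y[OF c]])
      (use eq[OF c] in \<open>auto simp: chart_inv_left[OF atlas_chart[OF c]]\<close>)
qed

lemma smooth_vf_cong:
  assumes "open U" "\<And>q. q \<in> U \<Longrightarrow> X q = Y q" "smooth_vf A U X"
  shows "smooth_vf A U Y"
  by (rule smooth_vfI[OF assms(1) smooth_vfD[OF assms(3)]])
    (simp_all add: assms(2) chart_inv_left atlas_chart)

lemma smooth_vf_subset: "smooth_vf A U X \<Longrightarrow> V \<subseteq> U \<Longrightarrow> smooth_vf A V X"
  unfolding smooth_vf_def by (meson Int_mono image_mono order_refl smooth_on_subset)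

lemma smooth_vf_zero: "open U \<Longrightarrow> smooth_vf A U (\<lambda>_. 0)"
  by (rule smooth_vfI[where Y = "\<lambda>_ _. 0"])
    (simp_all add: smooth_on_const linear_0[OF linear_components])

lemma smooth_vf_add:
  assumes U: "open U" and X: "smooth_vf A U X" and Y: "smooth_vf A U Y"
  shows "smooth_vf A U (\<lambda>q. X q + Y q)"
proof (rule smooth_vfI[OF U])
  fix c assume c: "c \<in> A"
  show "smooth_on (snd c ` (fst c \<inter> U)) (\<lambda>x. components A c (chart_inv c x) (X (chart_inv c x)) +
      components A c (chart_inv c x) (Y (chart_inv c x)))"
    by (rule smooth_on_add[OF open_chart_image[OF atlas_chart[OF c] U] smooth_vfD[OF X c]
          smooth_vfD[OF Y c]])
qed (simp add: chart_inv_left atlas_chart linear_add[OF linear_components])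

lemma smooth_vf_scale:
  assumes U: "open U" and f: "smooth_fun A U f" and X: "smooth_vf A U X"
  shows "smooth_vf A U (\<lambda>q. f q *\<^sub>R X q)"
proof (rule smooth_vfI[OF U])
  fix c assume c: "c \<in> A"
  show "smooth_on (snd c ` (fst c \<inter> U)) (\<lambda>x. (f \<circ> chart_inv c) x *\<^sub>R
      components A c (chart_inv c x) (X (chart_inv c x)))"
    by (rule smooth_on_bilinear[OF bounded_bilinear_scaleR open_chart_image[OF atlas_chart[OF c] U]
          smooth_funD[OF f c] smooth_vfD[OF X c]])
qed (simp add: chart_inv_left atlas_chart linear_scale[OF linear_components])

lemma smooth_vf_sum:
  assumes "open U" "\<And>i. i \<in> I \<Longrightarrow> smooth_vf A U (X i)"
  shows "smooth_vf A U (\<lambda>q. \<Sum>i\<in>I. X i q)"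
  using assms(2)
  by (induction I rule: infinite_finite_induct)
    (simp_all add: smooth_vf_zero[OF assms(1)] smooth_vf_add[OF assms(1)])

text \<open>Smooth components in one chart suffice: in any other chart the components are the
  derivative of the transition map applied to them.\<close>

lemma smooth_vf_chart_frame:
  assumes U: "open U" "d \<in> A" "U \<subseteq> fst d" and Y: "smooth_on (snd d ` U) Y"
  shows "smooth_vf A U (\<lambda>q. chart_frame A d q (Y (snd d q)))"
proof (rule smooth_vfI[OF U(1)])
  fix c assume c: "c \<in> A"
  define D where "D = snd d ` (fst d \<inter> (fst c \<inter> U))"
  have o: "open (snd c ` (fst c \<inter> U))" "open D"
    unfolding D_def by (intro open_chart_image atlas_chart open_Int open_chart_dom c U)+
  have sub: "D \<subseteq> snd d ` (fst d \<inter> fst c)" "D \<subseteq> snd d ` U" unfolding D_def by auto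
  have t: "smooth_on D (\<lambda>y. der (snd c \<circ> chart_inv d) y (Y y))"
    by (rule smooth_on_der_apply[OF o(2) smooth_on_subset[OF smooth_on_transition[OF U(2) c] sub(1)]
          smooth_on_subset[OF Y sub(2)]])
  show "smooth_on (snd c ` (fst c \<inter> U))
      (\<lambda>x. (\<lambda>y. der (snd c \<circ> chart_inv d) y (Y y)) ((snd d \<circ> chart_inv c) x))"
  proof (rule smooth_on_compose[OF o _ _ t])
    show "(snd d \<circ> chart_inv c) ` snd c ` (fst c \<inter> U) \<subseteq> D"
      unfolding D_def using U(3) c by (auto simp: chart_inv_left atlas_chart)
    show "smooth_on (snd c ` (fst c \<inter> U)) (snd d \<circ> chart_inv c)"
      by (rule smooth_on_subset[OF smooth_on_transition[OF c U(2)]]) (use U(3) in auto)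
  qed
qed (use U in \<open>auto simp: chart_inv_left atlas_chart components_chart_frame_transition subset_iff\<close>)

end

section \<open>Differentials of maps in arbitrary charts\<close>

lemma smooth_map_chart:
  "smooth_map A B F \<Longrightarrow> c \<in> A \<Longrightarrow> d \<in> B \<Longrightarrow>
    smooth_on (snd c ` (fst c \<inter> F -` fst d)) (snd d \<circ> F \<circ> chart_inv c)"
  unfolding smooth_map_def by blast

text \<open>\<open>dmap\<close> is defined with the charts selected at p and F p; the chain rule on
  both sides shows that the coordinate expression in any other charts represents the same linear
  map.\<close>

lemma dmap_chart_frame:
  assumes A: "smooth_atlas A" and B: "smooth_atlas B"
    and c: "c \<in> A" "p \<in> fst c" and d: "d \<in> B" "F p \<in> fst d" and oF: "open (F -` fst d)"
    and F': "(snd d \<circ> F \<circ> chart_inv c has_derivative F') (at (snd c p))"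
  shows "dmap A B F p (chart_frame A c p v) = chart_frame B d (F p) (F' v)"
proof -
  let ?d' = "chart_at B (F p)" and ?c' = "chart_at A p"
  have p: "(snd d \<circ> F \<circ> chart_inv c) (snd c p) = snd d (F p)"
    using c by (simp add: chart_inv_left[OF atlas_chart[OF A]])
  have T: "(snd ?d' \<circ> chart_inv d has_derivative der (snd ?d' \<circ> chart_inv d) (snd d (F p)))
      (at ((snd d \<circ> F \<circ> chart_inv c) (snd c p)))"
    unfolding p by (rule has_der_transition[OF B d(1) chart_at(1)[OF B] d(2) chart_at(2)[OF B]])
  have "(snd ?d' \<circ> F \<circ> chart_inv c has_derivative
      (\<lambda>v. der (snd ?d' \<circ> chart_inv d) (snd d (F p)) (F' v)))
      (at (snd c p))"
  proof (rule has_derivative_transform_within_open[OF has_derivative_compose[OF F' T]])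
    show "open (snd c ` (fst c \<inter> F -` fst d))"
      by (rule open_chart_image[OF atlas_chart[OF A c(1)] oF])
    show "snd c p \<in> snd c ` (fst c \<inter> F -` fst d)" using c d by auto
    show "(snd ?d' \<circ> chart_inv d) ((snd d \<circ> F \<circ> chart_inv c) x) = (snd ?d' \<circ> F \<circ> chart_inv c) x"
      if "x \<in> snd c ` (fst c \<inter> F -` fst d)" for x
      using that by (auto simp: chart_inv_left[OF atlas_chart[OF A c(1)]]
          chart_inv_left[OF atlas_chart[OF B d(1)]])
  qed
  from has_der_change_chart[OF A chart_at[OF A, of p] c this, THEN der_eqI]
  have "dmap A B F p w = chart_frame B d (F p) (F' (components A c p w))" for w
    unfolding dmap_def chart_frame_def components_def by simp
  then show ?thesis
    by (simp add: components_chart_frame[OF A c])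
qed

section \<open>Connections in a chart\<close>

text \<open>The value 0 off the chart domain keeps it linear in v at every point, without a side
  condition.\<close>

definition coord_field ::
    "('a, 'e::euclidean_space) chart set \<Rightarrow> ('a, 'e) chart \<Rightarrow> 'e \<Rightarrow> 'a \<Rightarrow> 'e" where
  "coord_field A c v p = (if p \<in> fst c then chart_frame A c p v else 0)"

context
  fixes A :: "('a::{t2_space, second_countable_topology}, 'e::euclidean_space) chart set"
  assumes atlas: "smooth_atlas A"
begin

lemma smooth_vf_coord_field:
  assumes "c \<in> A"
  shows "smooth_vf A (fst c) (coord_field A c v)"
proof (rule smooth_vf_cong[OF atlas])
  show o: "open (fst c)" by (rule open_chart_dom[OF atlas_chart[OF atlas assms]])
  show "smooth_vf A (fst c) (\<lambda>q. chart_frame A c q v)"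
    by (rule smooth_vf_chart_frame[OF atlas o assms order_refl, where Y = "\<lambda>_. v"])
      (rule smooth_on_const)
qed (simp add: coord_field_def)

lemma linear_coord_field: "c \<in> A \<Longrightarrow> linear (\<lambda>v. coord_field A c v p)"
  unfolding coord_field_def using linear_chart_frame[OF atlas, of c p]
  by (auto intro: linearI simp: linear_add linear_scale)

lemma coord_field_chart_at: "coord_field A (chart_at A p) v p = v"
  by (simp add: coord_field_def chart_at[OF atlas] chart_frame_chart_at[OF atlas])

lemma coord_field_expansion:
  assumes "c \<in> A" "p \<in> fst c"
  shows "X p = (\<Sum>e\<in>Basis. (components A c p (X p) \<bullet> e) *\<^sub>R coord_field A c e p)"
proof -
  have "X p = coord_field A c (components A c p (X p)) p"
    using assms by (simp add: coord_field_def chart_frame_components[OF atlas])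
  also have "\<dots> = (\<Sum>e\<in>Basis. (components A c p (X p) \<bullet> e) *\<^sub>R coord_field A c e p)"
    by (rule linear_sum_Basis[OF linear_coord_field[OF assms(1)]])
  finally show ?thesis .
qed

lemma dfun_cong_open:
  assumes "open U" "p \<in> U" "\<And>q. q \<in> U \<Longrightarrow> f q = k q"
  shows "dfun A f p = dfun A k p"
  unfolding dfun_def
proof (rule der_cong_open)
  let ?c = "chart_at A p"
  have c: "is_chart ?c" by (rule atlas_chart[OF atlas chart_at(1)[OF atlas]])
  show "open (snd ?c ` (fst ?c \<inter> U))" by (rule open_chart_image[OF c assms(1)])
  show "snd ?c p \<in> snd ?c ` (fst ?c \<inter> U)" using assms chart_at[OF atlas] by blast
  show "(f \<circ> chart_inv ?c) x = (k \<circ> chart_inv ?c) x" if "x \<in> snd ?c ` (fst ?c \<inter> U)" for x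
    using that assms(3) c by (auto simp: chart_inv_left)
qed

lemma dfun_const: "dfun A (\<lambda>_. r) p v = 0"
  unfolding dfun_def o_def by simp

section \<open>Locality and additivity of a connection\<close>

context
  fixes nab
  assumes nab: "affine_connection A nab"
begin

lemma
  assumes "open U" "smooth_vf A U X" "smooth_vf A U Y"
  shows smooth_vf_nab: "smooth_vf A U (nab X Y)"
    and nab_add_left: "smooth_vf A U Z \<Longrightarrow> p \<in> U \<Longrightarrow> nab (\<lambda>q. X q + Z q) Y p = nab X Y p + nab Z Y p"
    and nab_add_right: "smooth_vf A U Z \<Longrightarrow> p \<in> U \<Longrightarrow> nab X (\<lambda>q. Y q + Z q) p = nab X Y p + nab X Z p"
    and nab_scale_left: "smooth_fun A U f \<Longrightarrow> p \<in> U \<Longrightarrow> nab (\<lambda>q. f q *\<^sub>R X q) Y p = f p *\<^sub>R nab X Y p"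
    and nab_scale_right: "smooth_fun A U f \<Longrightarrow> p \<in> U \<Longrightarrow>
      nab X (\<lambda>q. f q *\<^sub>R Y q) p = dfun A f p (X p) *\<^sub>R Y p + f p *\<^sub>R nab X Y p"
  using nab assms unfolding affine_connection_def by blast+

text \<open>Locality: a field that vanishes on \<open>U\<close> is its own product with the indicator function of the
  complement of \<open>U\<close>, which is smooth on \<open>U\<close>.\<close>

lemma
  assumes U: "open U" "p \<in> U" and sm: "smooth_vf A U Z" "smooth_vf A U Y"
    and Z: "\<And>q. q \<in> U \<Longrightarrow> Z q = 0"
  shows nab_zero_left: "nab Z Y p = 0" and nab_zero_right: "nab Y Z p = 0"
proof -
  define k where "k = (\<lambda>q. if q \<in> U then 0 else 1 :: real)"
  have k: "smooth_fun A U k"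
    by (rule smooth_fun_cong[OF atlas U(1) _ smooth_fun_const[OF atlas, of U 0]]) (simp add: k_def)
  have Zk: "(\<lambda>q. k q *\<^sub>R Z q) = Z" using Z by (auto simp: k_def)
  have "dfun A k p = dfun A (\<lambda>_. 0) p"
    by (rule dfun_cong_open[OF U]) (simp add: k_def)
  then have "dfun A k p v = 0" for v by (simp add: dfun_const)
  then show "nab Z Y p = 0" "nab Y Z p = 0"
    using nab_scale_left[OF U(1) sm k U(2)] nab_scale_right[OF U(1) sm(2,1) k U(2)] U(2)
    by (simp_all add: Zk, simp_all add: k_def)
qed

text \<open>The difference of X' and X vanishes on U, so it is smooth there and contributes nothing;
  X' may be arbitrary outside U.\<close>

lemma
  assumes U: "open U" "p \<in> U" and sm: "smooth_vf A U X" "smooth_vf A U Y"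
    and X: "\<And>q. q \<in> U \<Longrightarrow> X q = X' q"
  shows nab_cong_left: "nab X Y p = nab X' Y p" and nab_cong_right: "nab Y X p = nab Y X' p"
proof -
  have Z: "smooth_vf A U (\<lambda>q. X' q - X q)"
    by (rule smooth_vf_cong[OF atlas U(1) _ smooth_vf_zero[OF atlas U(1)]]) (simp add: X)
  have "nab (\<lambda>q. X' q - X q) Y p = 0" "nab Y (\<lambda>q. X' q - X q) p = 0"
    using X by (auto intro!: nab_zero_left[OF U Z sm(2)] nab_zero_right[OF U Z sm(2)])
  then show "nab X Y p = nab X' Y p" "nab Y X p = nab Y X' p"
    using nab_add_left[OF U(1) sm Z U(2)] nab_add_right[OF U(1) sm(2,1) Z U(2)] by simp_all
qed

lemma
  assumes U: "open U" "p \<in> U" and sm: "\<And>i. i \<in> I \<Longrightarrow> smooth_vf A U (X i)" "smooth_vf A U Y"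
  shows nab_sum_left: "nab (\<lambda>q. \<Sum>i\<in>I. X i q) Y p = (\<Sum>i\<in>I. nab (X i) Y p)"
    and nab_sum_right: "nab Y (\<lambda>q. \<Sum>i\<in>I. X i q) p = (\<Sum>i\<in>I. nab Y (X i) p)"
proof -
  note z = smooth_vf_zero[OF atlas U(1)]
  have "nab (\<lambda>q. \<Sum>i\<in>I. X i q) Y p = (\<Sum>i\<in>I. nab (X i) Y p) \<and>
      nab Y (\<lambda>q. \<Sum>i\<in>I. X i q) p = (\<Sum>i\<in>I. nab Y (X i) p)"
    using sm(1)
  proof (induction I rule: infinite_finite_induct)
    case (insert j I)
    have "smooth_vf A U (X j)" "smooth_vf A U (\<lambda>q. \<Sum>i\<in>I. X i q)"
      using insert.prems by (auto intro: smooth_vf_sum[OF atlas U(1)])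
    then show ?case
      using insert nab_add_left[OF U(1) _ sm(2) _ U(2)] nab_add_right[OF U(1) sm(2) _ _ U(2)]
      by simp
  qed (simp_all add: nab_zero_left[OF U z sm(2)] nab_zero_right[OF U z sm(2)])
  then show "nab (\<lambda>q. \<Sum>i\<in>I. X i q) Y p = (\<Sum>i\<in>I. nab (X i) Y p)"
    "nab Y (\<lambda>q. \<Sum>i\<in>I. X i q) p = (\<Sum>i\<in>I. nab Y (X i) p)" by auto
qed

text \<open>The Christoffel symbols at p in the chart selected at p, gathered into one vector-valued
  map. Chart and point are tied together, so this is not the local function of p that one chart
  would give.\<close>

definition christoffel :: "'a \<Rightarrow> 'e \<Rightarrow> 'e \<Rightarrow> 'e" where
  "christoffel p u v =
    nab (coord_field A (chart_at A p) u) (coord_field A (chart_at A p) v) p"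

lemma bilinear_christoffel: "bilinear (christoffel p)"
proof -
  let ?c = "chart_at A p" and ?X = "coord_field A (chart_at A p)"
  note c = chart_at[OF atlas, of p]
  note o = open_chart_dom[OF atlas_chart[OF atlas c(1)]]
  note s = smooth_vf_coord_field[OF c(1)]
  have add: "?X (u + v) = (\<lambda>q. ?X u q + ?X v q)" and scale: "?X (r *\<^sub>R u) = (\<lambda>q. r *\<^sub>R ?X u q)"
      for u v r
    using linear_add[OF linear_coord_field[OF c(1)]] linear_scale[OF linear_coord_field[OF c(1)]]
    by auto
  note k = smooth_fun_const[OF atlas, of "fst ?c"]
  show ?thesis
    unfolding bilinear_def christoffel_def
    by (auto intro!: linearI simp: add scale dfun_const nab_add_left[OF o s s s c(2)]
        nab_add_right[OF o s s s c(2)] nab_scale_left[OF o s s k c(2)]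
        nab_scale_right[OF o s s k c(2)])
qed

text \<open>Both fields are expanded in the coordinate frame near p. The Leibniz rule in Y produces
  the derivative of its components, and at p the coordinate fields of the selected chart are the
  constant vectors themselves.\<close>

lemma nab_christoffel:
  assumes U: "open U" "p \<in> U" and X: "smooth_vf A U X" and Y: "smooth_vf A U Y"
  defines "c \<equiv> chart_at A p"
  shows "nab X Y p = der (\<lambda>x. components A c (chart_inv c x) (Y (chart_inv c x))) (snd c p) (X p)
    + christoffel p (X p) (Y p)"
proof -
  have c: "c \<in> A" "p \<in> fst c" unfolding c_def by (rule chart_at[OF atlas])+
  define W where "W = fst c \<inter> U"
  have W: "open W" "p \<in> W" "W \<subseteq> fst c" "W \<subseteq> U"
    unfolding W_def using U c open_chart_dom[OF atlas_chart[OF atlas c(1)]] by auto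
  define hat where "hat = (\<lambda>Z x. components A c (chart_inv c x) (Z (chart_inv c x)))"
  \<comment> \<open>The e-component of Z, written through the coordinate map so that its smoothness
    follows from that of \<open>hat Z\<close>.\<close>
  define r where "r = (\<lambda>Z e q. hat Z (snd c q) \<bullet> e)"
  let ?E = "coord_field A c"
  have E: "smooth_vf A W (?E e)" for e
    by (rule smooth_vf_subset[OF atlas smooth_vf_coord_field[OF c(1)] W(3)])
  have oW: "open (snd c ` W)"
    unfolding W_def by (rule open_chart_image[OF atlas_chart[OF atlas c(1)] U(1)])
  have hat: "smooth_on (snd c ` W) (hat Z)" if "smooth_vf A U Z" for Z
    unfolding hat_def W_def by (rule smooth_vfD[OF atlas that c(1)])
  have r: "smooth_fun A W (r Z e)" if "smooth_vf A U Z" for Z e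
    unfolding r_def
    by (rule smooth_fun_chart[OF atlas W(1) c(1) W(3), where r = "\<lambda>x. hat Z x \<bullet> e"])
      (rule smooth_on_bounded_linear_compose[OF oW bounded_linear_inner_left hat[OF that]])
  have r_eq: "r Z e q = components A c q (Z q) \<bullet> e" if "q \<in> W" for Z e q
    using that W(3) by (auto simp: r_def hat_def chart_inv_left[OF atlas_chart[OF atlas c(1)]])
  have r_p: "r Z e p = Z p \<bullet> e" for Z e
    using r_eq[OF W(2)] components_chart_at[OF atlas] by (simp add: c_def)
  have expand: "Z q = (\<Sum>e\<in>Basis. r Z e q *\<^sub>R ?E e q)" if "q \<in> W" for Z q
    unfolding r_eq[OF that] by (rule coord_field_expansion) (use c that W in auto)
  have dr: "dfun A (r Y e) p v = der (hat Y) (snd c p) v \<bullet> e" for e v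
  proof -
    have "((\<lambda>x. hat Y x \<bullet> e) has_derivative (\<lambda>v. der (hat Y) (snd c p) v \<bullet> e)) (at (snd c p))"
      by (rule has_derivative_inner_left[OF smooth_on_has_der[OF hat[OF Y]]]) (use W in auto)
    then have "(r Y e \<circ> chart_inv c has_derivative (\<lambda>v. der (hat Y) (snd c p) v \<bullet> e)) (at (snd c p))"
      by (rule has_derivative_transform_within_open[OF _ oW])
        (use W in \<open>auto simp: r_def chart_inv_right chart_inv_left[OF atlas_chart[OF atlas c(1)]]
            subset_iff\<close>)
    from dfun_chart[OF atlas c this] show ?thesis
      using components_chart_at[OF atlas] by (simp add: c_def)
  qed
  have Ep: "?E e p = e" for e unfolding c_def by (rule coord_field_chart_at)
  have chr: "christoffel p e k = nab (?E e) (?E k) p" for e k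
    by (simp add: christoffel_def c_def)
  have XW: "smooth_vf A W X" and YW: "smooth_vf A W Y"
    using smooth_vf_subset[OF atlas _ W(4)] X Y by auto
  have rE: "smooth_vf A W (\<lambda>q. r Z e q *\<^sub>R ?E e q)" if "smooth_vf A U Z" for Z e
    by (rule smooth_vf_scale[OF atlas W(1) r[OF that] E])
  have 1: "nab (?E e) Y p = der (hat Y) (snd c p) e + christoffel p e (Y p)" for e
  proof -
    have "nab (?E e) Y p = nab (?E e) (\<lambda>q. \<Sum>k\<in>Basis. r Y k q *\<^sub>R ?E k q) p"
      by (rule nab_cong_right[OF W(1,2) YW E]) (rule expand)
    also have "\<dots> = (\<Sum>k\<in>Basis. nab (?E e) (\<lambda>q. r Y k q *\<^sub>R ?E k q) p)"
      by (rule nab_sum_right[OF W(1,2) rE[OF Y] E])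
    also have "\<dots> = (\<Sum>k\<in>Basis. (der (hat Y) (snd c p) e \<bullet> k) *\<^sub>R k + (Y p \<bullet> k) *\<^sub>R christoffel p e k)"
      by (simp add: nab_scale_right[OF W(1) E E r[OF Y] W(2)] dr Ep r_p chr)
    also have "\<dots> = der (hat Y) (snd c p) e + christoffel p e (Y p)"
      using linear_sum_Basis[of "christoffel p e" "Y p"] bilinear_christoffel[of p]
      by (simp add: sum.distrib euclidean_representation bilinear_def)
    finally show ?thesis .
  qed
  have "nab X Y p = nab (\<lambda>q. \<Sum>e\<in>Basis. r X e q *\<^sub>R ?E e q) Y p"
    by (rule nab_cong_left[OF W(1,2) XW YW]) (rule expand)
  also have "\<dots> = (\<Sum>e\<in>Basis. nab (\<lambda>q. r X e q *\<^sub>R ?E e q) Y p)"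
    by (rule nab_sum_left[OF W(1,2) rE[OF X] YW])
  also have "\<dots> = (\<Sum>e\<in>Basis. (X p \<bullet> e) *\<^sub>R der (hat Y) (snd c p) e) +
      (\<Sum>e\<in>Basis. (X p \<bullet> e) *\<^sub>R christoffel p e (Y p))"
    by (simp add: nab_scale_left[OF W(1) E YW r[OF X] W(2)] r_p 1 sum.distrib scaleR_add_right)
  also have "\<dots> = der (hat Y) (snd c p) (X p) + christoffel p (X p) (Y p)"
  proof -
    have "linear (der (hat Y) (snd c p))"
      by (rule has_derivative_linear[OF smooth_on_has_der[OF hat[OF Y]]]) (use W in auto)
    moreover have "linear (\<lambda>u. christoffel p u (Y p))"
      using bilinear_christoffel unfolding bilinear_def by blast
    ultimately show ?thesis by (simp only: linear_sum_Basis[of _ "X p", symmetric])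
  qed
  finally show ?thesis unfolding hat_def .
qed

end

end

section \<open>Cosymplectic manifolds at a point\<close>

lemma inner_productD:
  assumes "inner_product b"
  shows "bilinear b" "b u v = b v u" "u \<noteq> 0 \<Longrightarrow> b u u > 0" "b u u \<ge> 0" "b u u = 0 \<longleftrightarrow> u = 0"
proof -
  show 1: "b u v = b v u" for u v using assms unfolding inner_product_def by blast
  have l: "linear (b u)" for u using assms unfolding inner_product_def by blast
  have "(\<lambda>x. b x y) = b y" for y using 1 by blast
  then show "bilinear b" unfolding bilinear_def using l by auto
  show pos: "u \<noteq> 0 \<Longrightarrow> b u u > 0" for u using assms unfolding inner_product_def by blast
  have "b 0 0 = 0" using linear_0[OF l] .
  then show "b u u \<ge> 0" "b u u = 0 \<longleftrightarrow> u = 0" using pos[of u] by (cases "u = 0"; force)+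
qed

lemma bilinear_comp_linear:
  assumes t: "bilinear t" and E: "linear E"
  shows "bilinear (\<lambda>u v. t (E u) (E v))"
  unfolding bilinear_def
  by (intro conjI allI linearI) (simp_all add: linear_add[OF E] linear_scale[OF E]
      bilinear_ladd[OF t] bilinear_radd[OF t] bilinear_lmul[OF t] bilinear_rmul[OF t])

lemma inner_product_eqI:
  assumes "inner_product b" "\<And>w. b u w = b v w"
  shows "u = v"
proof -
  note bl = inner_productD(1)[OF assms(1)]
  have "b (u - v) (u - v) = b u (u - v) - b v (u - v)" by (rule bilinear_lsub[OF bl])
  also have "\<dots> = 0" using assms(2) by simp
  finally show ?thesis using inner_productD(5)[OF assms(1)] by simp
qed

context
  fixes A :: "('a::{t2_space, second_countable_topology}, 'e::euclidean_space) chart set"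
    and \<phi> \<xi> \<eta> g nab
  assumes cosymplectic: "cosymplectic_manifold A \<phi> \<xi> \<eta> g nab"
begin

lemma
  shows cs_atlas: "smooth_atlas A" and cs_inner: "inner_product (g p)"
    and cs_smooth_metric: "open U \<Longrightarrow> smooth_vf A U X \<Longrightarrow> smooth_vf A U Y \<Longrightarrow>
      smooth_fun A U (\<lambda>p. g p (X p) (Y p))"
    and cs_linear_phi: "linear (\<phi> p)"
    and cs_smooth_phi: "open U \<Longrightarrow> smooth_vf A U X \<Longrightarrow> smooth_vf A U (\<lambda>p. \<phi> p (X p))"
    and cs_smooth_xi: "smooth_vf A UNIV \<xi>" and cs_linear_eta: "linear (\<eta> p)"
    and cs_phi_phi: "\<phi> p (\<phi> p v) = - v + \<eta> p v *\<^sub>R \<xi> p" and cs_eta_xi: "\<eta> p (\<xi> p) = 1"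
    and cs_metric_phi: "g p (\<phi> p u) (\<phi> p v) = g p u v - \<eta> p u * \<eta> p v"
    and cs_affine: "affine_connection A nab" and cs_torsion: "torsion_free A nab"
    and cs_metric: "metric_connection A g nab"
    and cs_nab_phi: "open U \<Longrightarrow> smooth_vf A U X \<Longrightarrow> smooth_vf A U Y \<Longrightarrow> p \<in> U \<Longrightarrow>
      nab X (\<lambda>q. \<phi> q (Y q)) p = \<phi> p (nab X Y p)"
  using cosymplectic
  unfolding cosymplectic_manifold_def almost_contact_metric_manifold_def riemannian_manifold_def
    levi_civita_connection_def
  by (auto simp only: right_minus_eq)

text \<open>Torsion-freeness is tested on coordinate functions: they have constant derivative along
  every coordinate field, so the bracket term vanishes, and their differentials separate tangent
  vectors at p.\<close>

lemma christoffel_sym: "christoffel A nab p u v = christoffel A nab p v u"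
proof (rule euclidean_eqI)
  fix e :: 'e
  let ?c = "chart_at A p" and ?X = "coord_field A (chart_at A p)"
  note at = cs_atlas
  note c = chart_at[OF at, of p]
  have ch: "is_chart ?c" by (rule atlas_chart[OF at c(1)])
  note o = open_chart_dom[OF ch]
  note s = smooth_vf_coord_field[OF at c(1)]
  define f where "f = (\<lambda>q. snd ?c q \<bullet> e)"
  have "smooth_on (snd ?c ` fst ?c) (\<lambda>x. x \<bullet> e)"
    using open_chart_image[OF ch open_UNIV]
    by (intro smooth_on_bounded_linear bounded_linear_inner_left) simp
  then have f: "smooth_fun A (fst ?c) f"
    unfolding f_def by (rule smooth_fun_chart[OF at o c(1) order_refl, where r = "\<lambda>x. x \<bullet> e"])
  have df: "dfun A f q w = components A ?c q w \<bullet> e" if "q \<in> fst ?c" for q w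
  proof -
    have "((\<lambda>x. x \<bullet> e) has_derivative (\<lambda>v. v \<bullet> e)) (at (snd ?c q))"
      by (intro has_derivative_inner_left has_derivative_ident)
    then have "(f \<circ> chart_inv ?c has_derivative (\<lambda>v. v \<bullet> e)) (at (snd ?c q))"
      by (rule has_derivative_transform_within_open[OF _ open_chart_image[OF ch open_UNIV]])
        (use that in \<open>auto simp: f_def chart_inv_right chart_inv_left[OF ch]\<close>)
    from dfun_chart[OF at c(1) that this] show ?thesis .
  qed
  have "dfun A (\<lambda>q. dfun A f q (?X w q)) p = dfun A (\<lambda>_. w \<bullet> e) p" for w
    by (rule dfun_cong_open[OF at o c(2)])
      (simp add: df coord_field_def components_chart_frame[OF at c(1)])
  moreover have "dfun A f p (nab (?X u) (?X v) p - nab (?X v) (?X u) p) =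
      dfun A (\<lambda>q. dfun A f q (?X v q)) p (?X u p) - dfun A (\<lambda>q. dfun A f q (?X u q)) p (?X v p)"
    using cs_torsion[unfolded torsion_free_def] o s[of u] s[of v] f c(2) by blast
  ultimately have "dfun A f p (nab (?X u) (?X v) p - nab (?X v) (?X u) p) = 0"
    by (simp add: dfun_const[OF at])
  then show "christoffel A nab p u v \<bullet> e = christoffel A nab p v u \<bullet> e"
    by (simp add: df[OF c(2)] components_chart_at[OF at] christoffel_def[OF at cs_affine]
        inner_diff_left)
qed

text \<open>Metric compatibility speaks of \<open>dfun\<close> in one direction at a time; here it
  becomes a total derivative in the chart selected at p, with coordinate fields as
  directions.\<close>

lemma has_der_metric:
  assumes Y: "smooth_vf A U Y" and Z: "smooth_vf A U Z" and U: "open U" "p \<in> U"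
  defines "c \<equiv> chart_at A p"
  shows "((\<lambda>y. g (chart_inv c y) (Y (chart_inv c y)) (Z (chart_inv c y))) has_derivative
    (\<lambda>w. g p (nab (coord_field A c w) Y p) (Z p) + g p (Y p) (nab (coord_field A c w) Z p)))
    (at (snd c p))"
proof -
  note at = cs_atlas
  have c: "c \<in> A" "p \<in> fst c" unfolding c_def by (rule chart_at[OF at])+
  define W where "W = fst c \<inter> U"
  have W: "open W" "p \<in> W" "W \<subseteq> U" "W \<subseteq> fst c"
    unfolding W_def using U c open_chart_dom[OF atlas_chart[OF at c(1)]] by auto
  let ?f = "\<lambda>q. g q (Y q) (Z q)"
  note sm = smooth_vf_subset[OF at Y W(3)] smooth_vf_subset[OF at Z W(3)]
  have "(?f \<circ> chart_inv c has_derivative der (?f \<circ> chart_inv c) (snd c p)) (at (snd c p))"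
    by (rule smooth_on_has_der[OF smooth_funD[OF at cs_smooth_metric[OF W(1) sm] c(1)]])
      (use W c in auto)
  moreover have "der (?f \<circ> chart_inv c) (snd c p) = (\<lambda>w.
     g p (nab (coord_field A c w) Y p) (Z p) + g p (Y p) (nab (coord_field A c w) Z p))"
  proof
    fix w
    have "dfun A ?f p w = der (?f \<circ> chart_inv c) (snd c p) w"
      unfolding dfun_def c_def ..
    moreover have "smooth_vf A W (coord_field A c w)"
      by (rule smooth_vf_subset[OF at smooth_vf_coord_field[OF at c(1)] W(4)])
    moreover have "coord_field A c w p = w" unfolding c_def by (rule coord_field_chart_at[OF at])
    ultimately show "der (?f \<circ> chart_inv c) (snd c p) w =
        g p (nab (coord_field A c w) Y p) (Z p) + g p (Y p) (nab (coord_field A c w) Z p)"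
      using cs_metric W sm unfolding metric_connection_def by metis
  qed
  ultimately show ?thesis by (simp add: o_def)
qed

section \<open>Algebra of an almost contact metric structure\<close>

lemma phi_xi: "\<phi> p (\<xi> p) = 0"
proof -
  let ?r = "\<eta> p (\<phi> p (\<xi> p))"
  have xi: "\<xi> p \<noteq> 0" using cs_eta_xi[of p] linear_0[OF cs_linear_eta] by force
  have 0: "\<phi> p (\<phi> p (\<xi> p)) = 0" by (simp add: cs_phi_phi cs_eta_xi)
  \<comment> \<open>Reading this also as \<phi>^2 applied to \<phi> \<xi> gives \<phi> \<xi> = r
    \<xi>; then \<phi>^2 \<xi> = 0 forces r^2 = 0.\<close>
  have "\<phi> p (\<phi> p (\<phi> p (\<xi> p))) = 0" by (simp add: 0 linear_0[OF cs_linear_phi])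
  then have 1: "\<phi> p (\<xi> p) = ?r *\<^sub>R \<xi> p"
    using cs_phi_phi[of p "\<phi> p (\<xi> p)"] by (simp add: eq_neg_iff_add_eq_0)
  then have "\<phi> p (\<phi> p (\<xi> p)) = ?r *\<^sub>R \<phi> p (\<xi> p)"
    by (metis linear_scale[OF cs_linear_phi])
  then have "?r *\<^sub>R ?r *\<^sub>R \<xi> p = 0" using 0 1 by metis
  then have "?r = 0" using xi by simp
  then show ?thesis using 1 by simp
qed

text \<open>Comparing \<phi> applied to \<phi>^2 v with \<phi>^2 applied to \<phi> v, where \<phi>
  \<xi> = 0, leaves \<eta> (\<phi> v) \<xi> = 0.\<close>

lemma eta_phi: "\<eta> p (\<phi> p v) = 0"
proof -
  have "\<phi> p (\<phi> p (\<phi> p v)) = - \<phi> p v"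
    using cs_phi_phi[of p v] phi_xi[of p]
    by (simp add: linear_add[OF cs_linear_phi] linear_neg[OF cs_linear_phi]
        linear_scale[OF cs_linear_phi] linear_diff[OF cs_linear_phi])
  then have "\<eta> p (\<phi> p v) *\<^sub>R \<xi> p = 0" using cs_phi_phi[of p "\<phi> p v"] by simp
  moreover have "\<xi> p \<noteq> 0" using cs_eta_xi[of p] linear_0[OF cs_linear_eta] by force
  ultimately show ?thesis by simp
qed

lemma eta_eq: "\<eta> p v = g p v (\<xi> p)"
  using cs_metric_phi[of p v "\<xi> p"] bilinear_rzero[OF inner_productD(1)[OF cs_inner]]
  by (simp add: phi_xi cs_eta_xi)

text \<open>Applying \<phi> to both arguments changes nothing here because \<eta> vanishes on the
  image of \<phi>; expanding \<phi>^2 u then leaves only -g u (\<phi> v).\<close>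

lemma phi_skew: "g p (\<phi> p u) v = - g p u (\<phi> p v)"
proof -
  note bl = inner_productD(1)[OF cs_inner]
  have "g p (\<phi> p u) v = g p (\<phi> p (\<phi> p u)) (\<phi> p v)"
    by (simp add: cs_metric_phi eta_phi)
  also have "\<dots> = - g p u (\<phi> p v) + \<eta> p u * g p (\<xi> p) (\<phi> p v)"
    by (simp add: cs_phi_phi bilinear_ladd[OF bl] bilinear_lneg[OF bl] bilinear_lmul[OF bl]
        bilinear_lsub[OF bl])
  also have "g p (\<xi> p) (\<phi> p v) = 0"
    using eta_phi[of p v] eta_eq inner_productD(2)[OF cs_inner] by metis
  finally show ?thesis by simp
qed

text \<open>Since \<phi> \<xi> = 0 and \<phi> is parallel, the derivative of \<xi> lies in the
  kernel of \<phi>, hence is a multiple of \<xi>; the constant length of \<xi> makes the multiple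
  0.\<close>

lemma nab_xi:
  assumes U: "open U" "p \<in> U" and X: "smooth_vf A U X"
  shows "nab X \<xi> p = 0"
proof -
  have xi: "smooth_vf A U \<xi>" by (rule smooth_vf_subset[OF cs_atlas cs_smooth_xi]) simp
  note bl = inner_productD(1)[OF cs_inner]
  have "nab X (\<lambda>q. \<phi> q (\<xi> q)) p = \<phi> p (nab X \<xi> p)" by (rule cs_nab_phi[OF U(1) X xi U(2)])
  moreover have "nab X (\<lambda>q. \<phi> q (\<xi> q)) p = 0"
    by (rule nab_zero_right[OF cs_atlas cs_affine U cs_smooth_phi[OF U(1) xi] X]) (rule phi_xi)
  ultimately have "\<phi> p (\<phi> p (nab X \<xi> p)) = 0" by (simp add: linear_0[OF cs_linear_phi])
  then have 1: "nab X \<xi> p = \<eta> p (nab X \<xi> p) *\<^sub>R \<xi> p" by (simp add: cs_phi_phi)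
  have g1: "g q (\<xi> q) (\<xi> q) = 1" for q using cs_eta_xi[of q] eta_eq by simp
  have "dfun A (\<lambda>q. g q (\<xi> q) (\<xi> q)) p (X p) = g p (nab X \<xi> p) (\<xi> p) + g p (\<xi> p) (nab X \<xi> p)"
    using cs_metric U X xi unfolding metric_connection_def by blast
  then have "g p (nab X \<xi> p) (\<xi> p) + g p (\<xi> p) (nab X \<xi> p) = 0"
    by (simp add: g1 dfun_const[OF cs_atlas])
  then have "g p (nab X \<xi> p) (\<xi> p) = 0"
    using inner_productD(2)[OF cs_inner, of p "\<xi> p" "nab X \<xi> p"] by linarith
  then show ?thesis using 1 by (simp add: eta_eq)
qed

end

section \<open>Linear algebra with an inner product\<close>

text \<open>Unlike \<open>orthonormal_basis\<close> this asks neither for a spanning set nor for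
  finiteness, so it also describes bases of subspaces; finiteness is derived below.\<close>

definition orthonormal :: "('e::real_vector \<Rightarrow> 'e \<Rightarrow> real) \<Rightarrow> 'e set \<Rightarrow> bool" where
  "orthonormal b E \<longleftrightarrow> (\<forall>u\<in>E. \<forall>v\<in>E. b u v = (if u = v then 1 else 0))"

context
  fixes b :: "'e::euclidean_space \<Rightarrow> 'e \<Rightarrow> real"
  assumes b: "inner_product b"
begin

lemma inner_product_sum_left: "b (\<Sum>e\<in>E. k e *\<^sub>R f e) v = (\<Sum>e\<in>E. k e * b (f e) v)"
proof -
  have "linear (\<lambda>u. b u v)" using inner_productD(1)[OF b] unfolding bilinear_def by blast
  from linear_sum[OF this, of "\<lambda>e. k e *\<^sub>R f e" E] linear_scale[OF this] show ?thesis by simp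
qed

lemma orthonormal_independent:
  assumes "orthonormal b E"
  shows "independent E"
  unfolding dependent_explicit
proof clarify
  fix S k v assume S: "finite S" "S \<subseteq> E" "(\<Sum>v\<in>S. k v *\<^sub>R v) = 0" and v: "v \<in> S" "k v \<noteq> 0"
  have "b (\<Sum>u\<in>S. k u *\<^sub>R u) v = (\<Sum>u\<in>S. if u = v then k u else 0)"
    unfolding inner_product_sum_left
    by (rule sum.cong) (use S v assms in \<open>auto simp: orthonormal_def subset_iff\<close>)
  then have "k v = 0" using S v bilinear_lzero[OF inner_productD(1)[OF b]] by simp
  then show False using v by simp
qed

lemma orthonormal_finite: "orthonormal b E \<Longrightarrow> finite E"
  by (rule independent_imp_finite[OF orthonormal_independent])

lemma orthonormal_expansion:
  assumes "orthonormal b E" "v \<in> span E"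
  shows "v = (\<Sum>e\<in>E. b v e *\<^sub>R e)"
proof -
  note fin = orthonormal_finite[OF assms(1)]
  obtain k where k: "v = (\<Sum>e\<in>E. k e *\<^sub>R e)"
    using assms(2) span_finite[OF fin] by auto
  have "b v e = k e" if e: "e \<in> E" for e
  proof -
    have "b v e = (\<Sum>u\<in>E. if u = e then k u else 0)"
      unfolding k inner_product_sum_left
      by (rule sum.cong) (use e assms in \<open>auto simp: orthonormal_def\<close>)
    then show ?thesis using e fin by simp
  qed
  then show ?thesis using k by simp
qed

lemma orthonormal_parseval:
  assumes "orthonormal b E" "v \<in> span E"
  shows "b v w = (\<Sum>e\<in>E. b v e * b w e)"
proof -
  have "b v w = b (\<Sum>e\<in>E. b v e *\<^sub>R e) w"
    by (simp only: orthonormal_expansion[OF assms, symmetric])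
  also have "\<dots> = (\<Sum>e\<in>E. b v e * b e w)" by (rule inner_product_sum_left)
  also have "\<dots> = (\<Sum>e\<in>E. b v e * b w e)"
    by (intro sum.cong refl arg_cong2[where f = "(*)"] inner_productD(2)[OF b])
  finally show ?thesis .
qed

text \<open>In place of the Gram-Schmidt recursion, an orthonormal subset of W of greatest
  cardinality is taken: a vector of W outside its span, once its projection is removed and it is
  normalised, would enlarge it.\<close>

lemma exists_orthonormal_basis:
  assumes W: "subspace W"
  obtains E where "orthonormal b E" "E \<subseteq> W" "span E = W"
proof -
  define Q where "Q = (\<lambda>E. orthonormal b E \<and> E \<subseteq> W)"
  have Q0: "Q {}" by (simp add: Q_def orthonormal_def)
  have bd: "\<forall>E. Q E \<longrightarrow> card E < Suc DIM('e)"
    using independent_card_le[OF orthonormal_independent] by (simp add: Q_def less_Suc_eq_le)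
  obtain E where "Q E \<and> (\<forall>E'. Q E' \<longrightarrow> card E' \<le> card E)"
    using ex_has_greatest_nat[of Q, OF Q0 bd] by auto
  then have E: "Q E" "\<And>E'. Q E' \<Longrightarrow> card E' \<le> card E" by simp_all
  have on: "orthonormal b E" and EW: "E \<subseteq> W" using E(1) by (auto simp: Q_def)
  note fin = orthonormal_finite[OF on] and bl = inner_productD(1)[OF b]
  have "W \<subseteq> span E"
  proof
    fix w assume w: "w \<in> W"
    define u where "u = w - (\<Sum>e\<in>E. b w e *\<^sub>R e)"
    have uW: "u \<in> W"
      unfolding u_def using w EW by (intro subspace_diff[OF W] subspace_sum[OF W]
          subspace_scale[OF W]) auto
    have ue: "b u e = 0" if e: "e \<in> E" for e
    proof -
      have "b (\<Sum>u\<in>E. b w u *\<^sub>R u) e = (\<Sum>u\<in>E. if u = e then b w u else 0)"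
        unfolding inner_product_sum_left by (rule sum.cong) (use e on in \<open>auto simp: orthonormal_def\<close>)
      then show ?thesis unfolding u_def bilinear_lsub[OF bl] using e fin by simp
    qed
    have "u = 0"
    proof (rule ccontr)
      assume "u \<noteq> 0"
      then have pos: "b u u > 0" by (rule inner_productD(3)[OF b])
      define x where "x = (1 / sqrt (b u u)) *\<^sub>R u"
      have xx: "b x x = 1"
        unfolding x_def bilinear_lmul[OF bl] bilinear_rmul[OF bl] using pos by simp
      have xe: "b x e = 0" "b e x = 0" if "e \<in> E" for e
        using ue[OF that] inner_productD(2)[OF b, of e x]
        by (simp_all add: x_def bilinear_lmul[OF bl] bilinear_rmul[OF bl])
      have xW: "x \<in> W" unfolding x_def by (rule subspace_scale[OF W uW])
      have "x \<notin> E" using xe(1)[of x] xx by auto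
      moreover have "Q (insert x E)"
        using on EW xW xx xe \<open>x \<notin> E\<close> unfolding Q_def orthonormal_def by auto
      ultimately show False using E(2)[of "insert x E"] fin by simp
    qed
    then have "w = (\<Sum>e\<in>E. b w e *\<^sub>R e)" unfolding u_def by (simp only: right_minus_eq)
    moreover have "(\<Sum>e\<in>E. b w e *\<^sub>R e) \<in> span E" by (intro span_sum span_scale span_base)
    ultimately show "w \<in> span E" by metis
  qed
  then have "span E = W" using span_minimal[OF EW W] by blast
  then show ?thesis using that on EW by blast
qed

section \<open>Orthogonal projections\<close>

lemma orth_proj_eqI:
  assumes W: "subspace W" and w: "w \<in> W" "\<And>u. u \<in> W \<Longrightarrow> b (v - w) u = 0"
  shows "orth_proj b W v = w"
  unfolding orth_proj_def
proof (rule the_equality)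
  fix x assume x: "x \<in> W \<and> (\<forall>u\<in>W. b (v - x) u = 0)"
  note bl = inner_productD(1)[OF b]
  have "w - x \<in> W" using x w subspace_diff[OF W] by blast
  then have "b (v - x) (w - x) - b (v - w) (w - x) = 0" using x w(2) by simp
  then have "b (w - x) (w - x) = 0" by (simp add: bilinear_lsub[OF bl])
  then show "x = w" using inner_productD(5)[OF b] by simp
qed (use w in blast)

text \<open>The Fourier sum over an orthonormal basis of W is a witness, and
  \<open>orth_proj_eqI\<close> identifies it with the definite description.\<close>

lemma orth_proj:
  assumes W: "subspace W"
  shows "orth_proj b W v \<in> W" "u \<in> W \<Longrightarrow> b (v - orth_proj b W v) u = 0"
proof -
  note bl = inner_productD(1)[OF b]
  obtain E where E: "orthonormal b E" "E \<subseteq> W" "span E = W"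
    using exists_orthonormal_basis[OF W] .
  define w where "w = (\<Sum>e\<in>E. b v e *\<^sub>R e)"
  have wW: "w \<in> W" unfolding w_def using E(2) by (intro subspace_sum[OF W] subspace_scale[OF W]) auto
  have orth: "b (v - w) u = 0" if "u \<in> W" for u
  proof -
    have "b v u = b u v" by (rule inner_productD(2)[OF b])
    also have "\<dots> = (\<Sum>e\<in>E. b u e * b v e)"
      using orthonormal_parseval[OF E(1)] that E(3) by simp
    also have "\<dots> = b w u"
      unfolding w_def inner_product_sum_left
      by (rule sum.cong[OF refl]) (simp add: inner_productD(2)[OF b, of u] mult.commute)
    finally show ?thesis by (simp add: bilinear_lsub[OF bl])
  qed
  have "orth_proj b W v = w" by (rule orth_proj_eqI[OF W wW orth])
  then show "orth_proj b W v \<in> W" "u \<in> W \<Longrightarrow> b (v - orth_proj b W v) u = 0"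
    using wW orth by auto
qed

lemma linear_orth_proj:
  assumes W: "subspace W"
  shows "linear (orth_proj b W)"
proof -
  note bl = inner_productD(1)[OF b] and pr = orth_proj[OF W]
  show ?thesis
  proof (rule linearI)
    fix u v r
    show "orth_proj b W (u + v) = orth_proj b W u + orth_proj b W v"
    proof (rule orth_proj_eqI[OF W])
      show "b (u + v - (orth_proj b W u + orth_proj b W v)) x = 0" if "x \<in> W" for x
      proof -
        have "u + v - (orth_proj b W u + orth_proj b W v)
          = (u - orth_proj b W u) + (v - orth_proj b W v)" by simp
        then show ?thesis using pr(2)[OF that] by (simp only: bilinear_ladd[OF bl])
      qed
    qed (intro subspace_add[OF W] pr)
    show "orth_proj b W (r *\<^sub>R u) = r *\<^sub>R orth_proj b W u"
    proof (rule orth_proj_eqI[OF W])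
      show "b (r *\<^sub>R u - r *\<^sub>R orth_proj b W u) x = 0" if "x \<in> W" for x
        using pr(2)[OF that, of u]
        by (simp only: scaleR_diff_right[symmetric] bilinear_lmul[OF bl] scaleR_zero_right)
    qed (intro subspace_scale[OF W] pr)
  qed
qed

lemma orthonormal_spans:
  assumes "orthonormal b E" "card E = DIM('e)"
  shows "span E = UNIV"
proof -
  have "dim E = DIM('e)"
    using dim_eq_card_independent[OF orthonormal_independent[OF assms(1)]] assms(2) by simp
  then show ?thesis by (simp only: dim_eq_full)
qed

lemma orthonormal_Un:
  assumes E: "orthonormal b E" and F: "orthonormal b F"
    and EF: "\<And>u v. u \<in> E \<Longrightarrow> v \<in> F \<Longrightarrow> b u v = 0"
  shows "orthonormal b (E \<union> F)" "E \<inter> F = {}"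
proof -
  have FE: "b v u = 0" if "u \<in> E" "v \<in> F" for u v
    using EF[OF that] inner_productD(2)[OF b, of v u] by simp
  show disj: "E \<inter> F = {}"
  proof (rule ccontr)
    assume "E \<inter> F \<noteq> {}"
    then obtain u where "u \<in> E" "u \<in> F" by blast
    then show False using EF[of u u] E by (auto simp: orthonormal_def)
  qed
  show "orthonormal b (E \<union> F)"
    unfolding orthonormal_def
  proof (intro ballI)
    fix u v assume "u \<in> E \<union> F" "v \<in> E \<union> F"
    then show "b u v = (if u = v then 1 else 0)"
      using E F EF[of u v] FE[of v u] disj unfolding orthonormal_def by (elim UnE) auto
  qed
qed

lemma orthonormal_image:
  assumes "\<And>u v. u \<in> E \<Longrightarrow> v \<in> E \<Longrightarrow> b (k u) (k v) = (if u = v then 1 else 0)"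
  shows "orthonormal b (k ` E)" "inj_on k E"
proof -
  show inj: "inj_on k E"
  proof (rule inj_onI, rule ccontr)
    fix u v assume "u \<in> E" "v \<in> E" "k u = k v" "u \<noteq> v"
    then show False using assms[of u v] assms[of u u] by simp
  qed
  show "orthonormal b (k ` E)"
    unfolding orthonormal_def using assms inj_onD[OF inj] by auto
qed

lemma orthonormal_card: "orthonormal b E \<Longrightarrow> card E = dim (span E)"
  using dim_eq_card_independent[OF orthonormal_independent] by simp

text \<open>Expanding the vectors of E in F leaves the sums of \<open>b u w * b u x\<close> over u,
  which Parseval in E evaluates to \<open>b w x\<close>, a Kronecker delta. It serves to replace the
  arbitrary basis in the norm of h by an adapted one.\<close>

lemma trace_orthonormal:
  fixes q :: "'e \<Rightarrow> 'e \<Rightarrow> real"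
  assumes E: "orthonormal b E" and F: "orthonormal b F" and eq: "span E = span F"
    and q: "bilinear q"
  shows "(\<Sum>u\<in>E. q u u) = (\<Sum>u\<in>F. q u u)"
proof -
  have lin: "linear (q u)" "linear (\<lambda>u. q u v)" for u v using q unfolding bilinear_def by auto
  have "q u u = (\<Sum>w\<in>F. \<Sum>x\<in>F. b u w * b u x * q w x)" if "u \<in> E" for u
  proof -
    have u: "u = (\<Sum>w\<in>F. b u w *\<^sub>R w)"
      by (rule orthonormal_expansion[OF F]) (simp add: span_base[OF that] eq[symmetric])
    have "q u u = q (\<Sum>w\<in>F. b u w *\<^sub>R w) (\<Sum>x\<in>F. b u x *\<^sub>R x)"
      by (simp only: u[symmetric])
    also have "\<dots> = (\<Sum>w\<in>F. b u w * q w (\<Sum>x\<in>F. b u x *\<^sub>R x))"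
      by (simp add: linear_sum[OF lin(2)] linear_scale[OF lin(2)])
    also have "\<dots> = (\<Sum>w\<in>F. \<Sum>x\<in>F. b u w * b u x * q w x)"
      by (simp add: linear_sum[OF lin(1)] linear_scale[OF lin(1)] sum_distrib_left mult.assoc)
    finally show ?thesis .
  qed
  then have "(\<Sum>u\<in>E. q u u) = (\<Sum>u\<in>E. \<Sum>w\<in>F. \<Sum>x\<in>F. b u w * b u x * q w x)" by simp
  also have "\<dots> = (\<Sum>w\<in>F. \<Sum>u\<in>E. \<Sum>x\<in>F. b u w * b u x * q w x)" by (rule sum.swap)
  also have "\<dots> = (\<Sum>w\<in>F. \<Sum>x\<in>F. \<Sum>u\<in>E. b u w * b u x * q w x)"
    by (rule sum.cong[OF refl], rule sum.swap)
  also have "\<dots> = (\<Sum>w\<in>F. \<Sum>x\<in>F. b w x * q w x)"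
  proof (intro sum.cong refl)
    fix w x assume w: "w \<in> F" "x \<in> F"
    have "b w x = (\<Sum>u\<in>E. b w u * b x u)"
      by (rule orthonormal_parseval[OF E]) (simp add: eq span_base w)
    then have "b w x * q w x = (\<Sum>u\<in>E. b w u * b x u * q w x)"
      by (simp only: sum_distrib_right)
    also have "\<dots> = (\<Sum>u\<in>E. b u w * b u x * q w x)"
      by (intro sum.cong refl arg_cong2[where f = "(*)"] inner_productD(2)[OF b])
    finally show "(\<Sum>u\<in>E. b u w * b u x * q w x) = b w x * q w x" ..
  qed
  also have "\<dots> = (\<Sum>w\<in>F. \<Sum>x\<in>F. if x = w then q w w else 0)"
    using F by (intro sum.cong) (auto simp: orthonormal_def)
  also have "\<dots> = (\<Sum>w\<in>F. q w w)" using orthonormal_finite[OF F] by simp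
  finally show ?thesis .
qed

end

section \<open>The second fundamental form at a point\<close>

text \<open>The linear algebra at a point \<open>p\<close>; \<open>P\<close> is the differential of the inclusion.\<close>

locale semi_slant_fibre =
  fixes g :: "'e::euclidean_space \<Rightarrow> 'e \<Rightarrow> real" and \<phi> :: "'e \<Rightarrow> 'e" and \<xi> :: 'e
    and P :: "'d::euclidean_space \<Rightarrow> 'e" and D1 D2 :: "'d set" and \<theta> :: real and m1 m2 :: nat
  assumes g: "inner_product g" and lin_phi: "linear \<phi>" and phi_xi: "\<phi> \<xi> = 0"
    and skew: "\<And>u v. g (\<phi> u) v = - g u (\<phi> v)"
    and phi_metric: "\<And>u v. g (\<phi> u) (\<phi> v) = g u v - g u \<xi> * g v \<xi>"
    and lin_P: "linear P" and inj_P: "inj P" and sub1: "subspace D1"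
    and D2_eq: "D2 = {v. \<forall>u\<in>D1. g (P u) (P v) = 0}"
    and phi_D1: "\<phi> ` P ` D1 \<subseteq> P ` D1"
    and angle: "\<And>v. v \<in> D2 \<Longrightarrow> v \<noteq> 0 \<Longrightarrow> angle_to_subspace g (\<phi> (P v)) (P ` D2) = \<theta>"
    and theta: "0 < \<theta>" "\<theta> < pi / 2" and xi_tangent: "\<xi> \<in> range P"
    and dims: "DIM('e) = 2 * m1 + 4 * m2 + 1" "dim D1 = 2 * m1 + 1" "dim D2 = 2 * m2"
begin

definition gP :: "'d \<Rightarrow> 'd \<Rightarrow> real" where
  "gP u v = g (P u) (P v)"

lemmas bil = inner_productD(1)[OF g]
lemmas g_sym = inner_productD(2)[OF g]
lemmas g_lin = bilinear_ladd[OF bil] bilinear_lmul[OF bil] bilinear_lneg[OF bil]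
  bilinear_lsub[OF bil] bilinear_radd[OF bil] bilinear_rmul[OF bil] bilinear_rneg[OF bil]
  bilinear_rsub[OF bil] bilinear_lzero[OF bil] bilinear_rzero[OF bil]
lemmas P_lin = linear_add[OF lin_P] linear_scale[OF lin_P] linear_diff[OF lin_P] linear_0[OF lin_P]

lemma gP: "inner_product gP"
  unfolding inner_product_def gP_def
proof (intro conjI allI impI)
  show "linear (\<lambda>v. g (P u) (P v))" for u by (rule linearI) (simp_all add: P_lin g_lin)
  show "g (P u) (P v) = g (P v) (P u)" for u v by (rule g_sym)
  show "g (P u) (P u) > 0" if "u \<noteq> 0" for u
  proof (rule inner_productD(3)[OF g])
    show "P u \<noteq> 0" using that linear_injective_0[OF lin_P] inj_P by blast
  qed
qed

lemma sub2: "subspace D2"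
  unfolding D2_eq by (rule subspaceI) (auto simp: P_lin g_lin)

lemma D1_D2: "a \<in> D1 \<Longrightarrow> z \<in> D2 \<Longrightarrow> g (P a) (P z) = 0"
  "a \<in> D1 \<Longrightarrow> z \<in> D2 \<Longrightarrow> g (P z) (P a) = 0"
  using g_sym[of "P z" "P a"] by (simp_all add: D2_eq)

lemma decompose:
  obtains a z where "a \<in> D1" "z \<in> D2" "u = a + z"
proof
  show "orth_proj gP D1 u \<in> D1" by (rule orth_proj[OF gP sub1])
  show "u - orth_proj gP D1 u \<in> D2"
    unfolding D2_eq gP_def[symmetric]
    using orth_proj(2)[OF gP sub1] by (auto simp: inner_productD(2)[OF gP, of _ "u - orth_proj gP
        D1 u"])
qed simp

lemma sub_range: "subspace (range P)" and sub_PD2: "subspace (P ` D2)"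
  using linear_subspace_image[OF lin_P] sub2 subspace_UNIV by auto

lemma phi_D1': "a \<in> D1 \<Longrightarrow> \<exists>a'\<in>D1. \<phi> (P a) = P a'"
  using phi_D1 by blast

text \<open>Skewness moves \<phi> to the argument in D1, which \<phi> preserves.\<close>

lemma phi_D2_D1:
  assumes "z \<in> D2" "a \<in> D1"
  shows "g (\<phi> (P z)) (P a) = 0"
proof -
  obtain a' where "a' \<in> D1" "\<phi> (P a) = P a'" using phi_D1'[OF assms(2)] by blast
  then show ?thesis using skew[of "P z" "P a"] D1_D2(2)[OF _ assms(1)] by simp
qed

text \<open>If \<xi> had a nonzero D2 component s2, then \<phi> \<xi> = 0 would put \<phi> s2 into
  D1; its projection to D2 would vanish and the slant angle would be pi / 2.\<close>

lemma xi_D1: obtains s where "s \<in> D1" "\<xi> = P s"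
proof -
  obtain s where s: "\<xi> = P s" using xi_tangent by blast
  obtain s1 s2 where s12: "s1 \<in> D1" "s2 \<in> D2" "s = s1 + s2" by (rule decompose)
  have "s2 = 0"
  proof (rule ccontr)
    assume "s2 \<noteq> 0"
    have "\<phi> (P s1) + \<phi> (P s2) = 0"
      using phi_xi s s12 by (simp add: P_lin linear_add[OF lin_phi])
    then have 1: "\<phi> (P s2) = - \<phi> (P s1)" by (simp add: eq_neg_iff_add_eq_0 add.commute)
    obtain a where a: "a \<in> D1" "\<phi> (P s1) = P a" using phi_D1'[OF s12(1)] by blast
    have "orth_proj g (P ` D2) (\<phi> (P s2)) = 0"
    proof (rule orth_proj_eqI[OF g sub_PD2])
      show "0 \<in> P ` D2" using subspace_0[OF sub_PD2] .
      show "g (\<phi> (P s2) - 0) u = 0" if "u \<in> P ` D2" for u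
        using that a by (auto simp: 1 g_lin D1_D2)
    qed
    \<comment> \<open>This includes the case \<phi> (P s2) = 0: the quotient 0 / 0 is 0 by
      convention, so \<open>arccos\<close> still gives pi / 2.\<close>
    then have "angle_to_subspace g (\<phi> (P s2)) (P ` D2) = pi / 2"
      unfolding angle_to_subspace_def by (simp add: g_lin)
    then show False using angle[OF s12(2) \<open>s2 \<noteq> 0\<close>] theta by simp
  qed
  then show ?thesis using that s s12 by simp
qed

section \<open>Tangential and normal parts of \<phi> on D2\<close>

definition T :: "'d \<Rightarrow> 'd" where
  "T z = (SOME t. t \<in> D2 \<and> P t = orth_proj g (P ` D2) (\<phi> (P z)))"

definition N :: "'d \<Rightarrow> 'e" where
  "N z = \<phi> (P z) - P (T z)"

text \<open>The projection lies in the image of D2, so a preimage exists; as P is injective, the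
  choice in \<open>T\<close> is the only one.\<close>

lemma T: "T z \<in> D2" "P (T z) = orth_proj g (P ` D2) (\<phi> (P z))"
proof -
  have "\<exists>t. t \<in> D2 \<and> P t = orth_proj g (P ` D2) (\<phi> (P z))"
    using orth_proj(1)[OF g sub_PD2, of "\<phi> (P z)"] by (metis imageE)
  from someI_ex[OF this] show "T z \<in> D2" "P (T z) = orth_proj g (P ` D2) (\<phi> (P z))"
    unfolding T_def by auto
qed

lemma phi_decompose: "\<phi> (P z) = P (T z) + N z"
  by (simp add: N_def)

lemma N_normal:
  assumes "z \<in> D2"
  shows "g (N z) (P u) = 0"
proof -
  obtain a w where u: "a \<in> D1" "w \<in> D2" "u = a + w" by (rule decompose)
  have "g (N z) (P w) = 0"
    unfolding N_def T(2) by (rule orth_proj(2)[OF g sub_PD2]) (use u in blast)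
  moreover have "g (N z) (P a) = 0"
    unfolding N_def using phi_D2_D1[OF assms u(1)] D1_D2(2)[OF u(1) T(1)] by (simp add: g_lin)
  ultimately show ?thesis by (simp add: u P_lin g_lin)
qed

text \<open>\<open>T\<close> is a choice, so additivity is read off after applying P, where it is
  that of the projection; polarisation needs no more.\<close>

lemma T_scale_add:
  shows "P (T (u + v)) = P (T u) + P (T v)"
  unfolding T(2) P_lin linear_add[OF lin_phi] linear_add[OF linear_orth_proj[OF g sub_PD2]] ..

lemma g_D2_xi:
  assumes "z \<in> D2"
  shows "g (P z) \<xi> = 0"
proof -
  obtain s where "s \<in> D1" "\<xi> = P s" by (rule xi_D1)
  then show ?thesis using D1_D2(2)[OF _ assms] by simp
qed

lemma g_phi_D2: "z \<in> D2 \<Longrightarrow> g (\<phi> (P z)) (\<phi> (P w)) = g (P z) (P w)"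
  by (simp add: phi_metric g_D2_xi)

lemma g_T_self:
  assumes "z \<in> D2"
  shows "g (P (T z)) (P (T z)) = (cos \<theta>)\<^sup>2 * g (P z) (P z)"
proof (cases "z = 0")
  case True
  then show ?thesis
    unfolding T(2) by (simp add: P_lin linear_0[OF lin_phi] linear_0[OF linear_orth_proj[OF g
        sub_PD2]] g_lin)
next
  case False
  let ?r = "sqrt (g (P (T z)) (P (T z))) / sqrt (g (P z) (P z))"
  have pos: "g (P z) (P z) > 0" using inner_productD(3)[OF gP False] by (simp add: gP_def)
  have "arccos ?r = \<theta>"
    using angle[OF assms False] unfolding angle_to_subspace_def Let_def T(2)[symmetric]
    by (simp add: g_phi_D2[OF assms])
  \<comment> \<open>The bounds are needed to invert \<open>arccos\<close>; the upper one is
    Pythagoras for the orthogonal parts P (T z) and N z of \<phi> (P z).\<close>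
  moreover have r: "0 \<le> ?r" "?r \<le> 1"
  proof -
    show "0 \<le> ?r" using inner_productD(4)[OF g] by simp
    have "g (P z) (P z) = g (\<phi> (P z)) (\<phi> (P z))" by (simp add: g_phi_D2[OF assms])
    also have "\<dots> = g (P (T z)) (P (T z)) + g (N z) (N z)"
      unfolding phi_decompose using N_normal[OF assms, of "T z"] g_sym[of "P (T z)" "N z"]
      by (simp add: g_lin)
    finally have "g (P (T z)) (P (T z)) \<le> g (P z) (P z)"
      using inner_productD(4)[OF g, of "N z"] by linarith
    then show "?r \<le> 1" using pos by (simp add: real_sqrt_le_iff)
  qed
  ultimately have "cos \<theta> = ?r" using cos_arccos[of ?r] by auto
  then have "(cos \<theta>)\<^sup>2 = g (P (T z)) (P (T z)) / g (P z) (P z)"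
    using pos inner_productD(4)[OF g, of "P (T z)"] by (simp add: power_divide)
  then show ?thesis using pos by simp
qed

text \<open>Polarisation of the preceding identity at z + w.\<close>

lemma g_T:
  assumes z: "z \<in> D2" and w: "w \<in> D2"
  shows "g (P (T z)) (P (T w)) = (cos \<theta>)\<^sup>2 * g (P z) (P w)"
proof -
  have "g (P (T (z + w))) (P (T (z + w))) = (cos \<theta>)\<^sup>2 * g (P (z + w)) (P (z + w))"
    by (rule g_T_self[OF subspace_add[OF sub2 z w]])
  then show ?thesis
    using g_T_self[OF z] g_T_self[OF w] g_sym[of "P (T w)" "P (T z)"] g_sym[of "P w" "P z"]
    by (simp add: T_scale_add P_lin(1) g_lin(1,5) algebra_simps)
qed

text \<open>On D2 the map \<phi> is an isometry, so the normal parts account for what the tangential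
  parts leave: 1 - cos^2 = sin^2.\<close>

lemma g_N:
  assumes z: "z \<in> D2" and w: "w \<in> D2"
  shows "g (N z) (N w) = (sin \<theta>)\<^sup>2 * g (P z) (P w)"
proof -
  have "g (P z) (P w) = g (P (T z)) (P (T w)) + g (N z) (N w)"
    using g_phi_D2[OF z, of w] N_normal[OF z, of "T w"] N_normal[OF w, of "T z"]
      g_sym[of "P (T z)" "N w"]
    unfolding phi_decompose by (simp add: g_lin(1,5))
  then show ?thesis
    using g_T[OF z w] by (simp add: sin_squared_eq algebra_simps)
qed

lemma sin_pos: "sin \<theta> > 0"
  using theta by (intro sin_gt_zero) auto

text \<open>The hypothesis on the dimension of the ambient space says that the normal space is
  \<open>N ` D2\<close>.\<close>

lemma normal_parseval:
  assumes E: "orthonormal gP E" "E \<subseteq> D2" "span E = D2" and x: "\<And>w. g x (P w) = 0"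
  shows "g x x = (\<Sum>e\<in>E. (g x (N e))\<^sup>2) / (sin \<theta>)\<^sup>2"
proof -
  obtain F where F: "orthonormal gP F" "F \<subseteq> D1" "span F = D1"
    using exists_orthonormal_basis[OF gP sub1] .
  \<comment> \<open>N e has length sin \<theta> for a unit vector e of D2; properness makes this
    positive, so the vectors can be normalised.\<close>
  define M where "M = (\<lambda>e. (1 / sin \<theta>) *\<^sub>R N e)"
  define X where "X = P ` (F \<union> E)"
  have "\<And>u v. u \<in> F \<Longrightarrow> v \<in> E \<Longrightarrow> gP u v = 0"
    unfolding gP_def using F(2) E(2) by (intro D1_D2(1)) auto
  then have FE: "orthonormal gP (F \<union> E)" "F \<inter> E = {}"
    using orthonormal_Un[OF gP F(1) E(1)] by blast+
  have PP: "g (P u) (P v) = (if u = v then 1 else 0)" if "u \<in> F \<union> E" "v \<in> F \<union> E" for u v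
    using FE(1) that unfolding orthonormal_def gP_def by blast
  have X: "orthonormal g X" "inj_on P (F \<union> E)"
    unfolding X_def by (rule orthonormal_image[OF g], rule PP; assumption)+
  have MM: "g (M u) (M v) = (if u = v then 1 else 0)" if "u \<in> E" "v \<in> E" for u v
  proof -
    have "u \<in> D2" "v \<in> D2" using that E(2) by auto
    then have "g (N u) (N v) = (sin \<theta>)\<^sup>2 * gP u v" by (simp add: g_N gP_def)
    moreover have "gP u v = (if u = v then 1 else 0)"
      using E(1) that unfolding orthonormal_def by blast
    ultimately show ?thesis using sin_pos by (simp add: M_def g_lin power2_eq_square)
  qed
  have M: "orthonormal g (M ` E)" "inj_on M E"
    by (rule orthonormal_image[OF g], rule MM; assumption)+
  have XM0: "g u v = 0" if "u \<in> X" "v \<in> M ` E" for u v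
    using that N_normal E(2) g_sym[of u v] by (auto simp: X_def M_def g_lin subset_iff)
  have XM: "orthonormal g (X \<union> M ` E)" "X \<inter> M ` E = {}"
    by (rule orthonormal_Un[OF g X(1) M(1)], rule XM0; assumption)+
  have fin: "finite E" "finite F" using orthonormal_finite[OF gP] E F by auto
  \<comment> \<open>The count is (2 m1 + 1) + 2 m2 + 2 m2, the dimension of the ambient space, so
    these vectors exhaust it.\<close>
  have "card (X \<union> M ` E) = card F + card E + card E"
    using XM(2) FE(2) fin unfolding X_def by (simp add: card_Un_disjoint card_image X(2) M(2))
  also have "\<dots> = DIM('e)"
    using orthonormal_card[OF gP E(1)] orthonormal_card[OF gP F(1)] E F dims by simp
  finally have "span (X \<union> M ` E) = UNIV" by (rule orthonormal_spans[OF g XM(1)])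
  then have "g x x = (\<Sum>u\<in>X \<union> M ` E. g x u * g x u)"
    by (intro orthonormal_parseval[OF g XM(1)]) simp
  also have "\<dots> = (\<Sum>u\<in>X. g x u * g x u) + (\<Sum>u\<in>M ` E. g x u * g x u)"
    by (rule sum.union_disjoint) (use XM(2) fin X_def in auto)
  also have "(\<Sum>u\<in>X. g x u * g x u) = 0" unfolding X_def by (rule sum.neutral) (use x in auto)
  also have "(\<Sum>u\<in>M ` E. g x u * g x u) = (\<Sum>e\<in>E. (g x (N e))\<^sup>2 / (sin \<theta>)\<^sup>2)"
    unfolding sum.reindex[OF M(2)] o_def by (simp add: M_def g_lin power2_eq_square)
  finally show ?thesis by (simp add: sum_divide_distrib)
qed

lemma normal_eqI:
  assumes "\<And>w. g x (P w) = 0" "\<And>z. z \<in> D2 \<Longrightarrow> g x (N z) = 0"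
  shows "x = 0"
proof -
  obtain E where E: "orthonormal gP E" "E \<subseteq> D2" "span E = D2"
    using exists_orthonormal_basis[OF gP sub2] .
  have "g x x = 0"
    unfolding normal_parseval[OF E assms(1)] using assms(2) E(2) by (simp add: subset_iff)
  then show ?thesis using inner_productD(5)[OF g] by simp
qed

end

text \<open>\<open>l\<close> is the differential of \<open>ln f\<close>, and \<open>G u v\<close> is the ambient covariant derivative along \<open>u\<close>
  of the coordinate field that extends \<open>v\<close>. The equations \<open>G_D1_D1\<close> to \<open>G_D2_D1\<close> are the Koszul
  formula for a warped product; the last two use that \<open>\<phi>\<close> and \<open>\<xi>\<close> are parallel.\<close>

locale semi_slant_point = semi_slant_fibre g \<phi> \<xi> P D1 D2 \<theta> m1 m2
  for g \<phi> \<xi> and P :: "'d::euclidean_space \<Rightarrow> 'e::euclidean_space" and D1 D2 \<theta> m1 m2 +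
  fixes G :: "'d \<Rightarrow> 'd \<Rightarrow> 'e" and l :: "'d \<Rightarrow> real"
  assumes bil_G: "bilinear G" and sym_G: "\<And>u v. G u v = G v u"
    and l_D2: "\<And>v. v \<in> D2 \<Longrightarrow> l v = 0"
    and G_D1_D1: "\<And>a a' z. a \<in> D1 \<Longrightarrow> a' \<in> D1 \<Longrightarrow> z \<in> D2 \<Longrightarrow> g (G a a') (P z) = 0"
    and G_D1_D2: "\<And>a a' z. a \<in> D1 \<Longrightarrow> a' \<in> D1 \<Longrightarrow> z \<in> D2 \<Longrightarrow> g (G a z) (P a') = 0"
    and G_D2_D2: "\<And>a z w. a \<in> D1 \<Longrightarrow> z \<in> D2 \<Longrightarrow> w \<in> D2 \<Longrightarrow>
      g (G z w) (P a) = - l a * g (P z) (P w)"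
    and G_D2_D1: "\<And>a z w. a \<in> D1 \<Longrightarrow> z \<in> D2 \<Longrightarrow> w \<in> D2 \<Longrightarrow>
      g (G z a) (P w) = l a * g (P z) (P w)"
    and G_phi: "\<And>a z u. a \<in> D1 \<Longrightarrow> z \<in> D2 \<Longrightarrow> g (G u a) (\<phi> (P z)) = g (\<phi> (P a)) (G u z)"
    and G_xi: "\<And>z u. z \<in> D2 \<Longrightarrow> g \<xi> (G u z) = 0"
begin

definition h :: "'d \<Rightarrow> 'd \<Rightarrow> 'e" where
  "h u v = G u v - orth_proj g (range P) (G u v)"

lemma h_normal: "g (h u v) (P w) = 0"
  unfolding h_def by (rule orth_proj(2)[OF g sub_range]) simp

lemma h_N:
  assumes "z \<in> D2"
  shows "g (h u v) (N z) = g (G u v) (\<phi> (P z)) - g (G u v) (P (T z))"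
proof -
  obtain t where t: "orth_proj g (range P) (G u v) = P t"
    using orth_proj(1)[OF g sub_range] by blast
  have "g (h u v) (N z) = g (G u v) (N z) - g (P t) (N z)" by (simp add: h_def t g_lin)
  also have "g (P t) (N z) = 0" using N_normal[OF assms, of t] g_sym[of "P t" "N z"] by simp
  finally show ?thesis by (simp add: N_def g_lin)
qed

lemma bilinear_h: "bilinear h"
proof -
  have l: "linear (G u)" "linear (\<lambda>u. G u v)" for u v
    using bil_G unfolding bilinear_def by auto
  note p = linear_orth_proj[OF g sub_range]
  show ?thesis
    unfolding bilinear_def h_def
    by (auto intro!: linearI simp: linear_add[OF l(1)] linear_scale[OF l(1)] linear_add[OF l(2)]
        linear_scale[OF l(2)] linear_add[OF p] linear_scale[OF p] scaleR_diff_right)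
qed

lemma h_sym: "h u v = h v u"
  by (simp add: h_def sym_G[of u v])

text \<open>Parallelism of \<phi> exchanges \<phi> z for \<phi> b, which is in D1 again, and the
  Koszul identities say that D1 is totally geodesic within the submanifold.\<close>

lemma h_D1_D1:
  assumes a: "a \<in> D1" "b \<in> D1"
  shows "h a b = 0"
proof (rule normal_eqI[OF h_normal])
  fix z assume z: "z \<in> D2"
  obtain b' where b': "b' \<in> D1" "\<phi> (P b) = P b'" using phi_D1'[OF a(2)] by blast
  have "g (G a b) (\<phi> (P z)) = g (P b') (G a z)" using G_phi[OF a(2) z] b' by simp
  also have "\<dots> = 0" using G_D1_D2[OF a(1) b'(1) z] g_sym[of "P b'" "G a z"] by simp
  finally show "g (h a b) (N z) = 0"
    using h_N[OF z] G_D1_D1[OF a T(1)] by simp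
qed

lemma h_D2_D1:
  assumes a: "a \<in> D1" "a' \<in> D1" "\<phi> (P a) = P a'" and z: "z \<in> D2"
  shows "g (h z a) (h z a) = ((l a')\<^sup>2 + (cos \<theta>)\<^sup>2 * (l a)\<^sup>2) / (sin \<theta>)\<^sup>2 * gP z z"
proof -
  obtain E where E: "orthonormal gP E" "E \<subseteq> D2" "span E = D2"
    using exists_orthonormal_basis[OF gP sub2] .
  \<comment> \<open>The pairing of \<open>h z a\<close> with N w is linear in w on D2; y is the
    vector of D2 that represents it, so the square norm of \<open>h z a\<close> is that of y divided
    by sin^2 \<theta>.\<close>
  define y where "y = l a *\<^sub>R T z - l a' *\<^sub>R z"
  have y: "y \<in> D2"
    unfolding y_def by (intro subspace_diff[OF sub2] subspace_scale[OF sub2] T z)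
  have "g (h z a) (N w) = gP y w" if w: "w \<in> D2" for w
  proof -
    \<comment> \<open>T is skew on D2, being the compression of the skew map \<phi>.\<close>
    have "g (P z) (P (T w)) = g (P z) (\<phi> (P w))"
      using N_normal[OF w, of z] g_sym[of "P z" "N w"] by (simp add: phi_decompose[of w] g_lin)
    also have "\<dots> = - g (\<phi> (P z)) (P w)" by (simp add: skew)
    also have "\<dots> = - g (P (T z)) (P w)"
      using N_normal[OF z, of w] by (simp add: phi_decompose[of z] g_lin)
    finally have 1: "g (P z) (P (T w)) = - g (P (T z)) (P w)" .
    have "g (G z a) (\<phi> (P w)) = g (P a') (G z w)" using G_phi[OF a(1) w] a(3) by simp
    also have "\<dots> = - l a' * g (P z) (P w)"
      using G_D2_D2[OF a(2) z w] g_sym[of "P a'" "G z w"] by simp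
    finally show ?thesis
      using h_N[OF w] G_D2_D1[OF a(1) z T(1)] 1 by (simp add: y_def gP_def P_lin g_lin)
  qed
  then have "(\<Sum>e\<in>E. (g (h z a) (N e))\<^sup>2) = (\<Sum>e\<in>E. gP y e * gP y e)"
    using E(2) by (intro sum.cong) (auto simp: power2_eq_square)
  also have "\<dots> = gP y y"
    using orthonormal_parseval[OF gP E(1), of y y] y E(3) by simp
  also have "\<dots> = ((l a')\<^sup>2 + (cos \<theta>)\<^sup>2 * (l a)\<^sup>2) * gP z z"
  proof -
    have "g (P (T z)) (P z) = g (\<phi> (P z)) (P z)"
      using N_normal[OF z, of z] by (simp add: phi_decompose[of z] g_lin)
    moreover have "g (\<phi> (P z)) (P z) = 0" using skew[of "P z" "P z"] g_sym[of "P z" "\<phi> (P z)"] by simp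
    ultimately have "g (P (T z)) (P z) = 0" "g (P z) (P (T z)) = 0" using g_sym[of "P z" "P (T
        z)"] by simp_all
    then show ?thesis
      using g_T[OF z z] by (simp add: y_def gP_def P_lin g_lin power2_eq_square algebra_simps)
  qed
  finally show ?thesis by (simp add: normal_parseval[OF E h_normal])
qed

text \<open>For changing the basis by \<open>trace_orthonormal\<close> in one slot of h at a time,
  the other slot being frozen.\<close>

lemma bilinear_h_inner: "bilinear (\<lambda>v w. g (h u v) (h u w))" "bilinear (\<lambda>u w. g (h u v) (h w v))"
proof -
  have l: "linear (h u)" "linear (\<lambda>u. h u v)" for u v
    using bilinear_h unfolding bilinear_def by auto
  show "bilinear (\<lambda>v w. g (h u v) (h u w))" "bilinear (\<lambda>u w. g (h u v) (h w v))"
    unfolding bilinear_def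
    by (auto intro!: linearI simp: linear_add[OF l(1)] linear_scale[OF l(1)] linear_add[OF l(2)]
        linear_scale[OF l(2)] g_lin)
qed

text \<open>For z in D2 the \<xi>-component of G z z is 0, as \<xi> is parallel, and -l s |z|^2 by
  the Koszul formula; m2 \<noteq> 0 provides a nonzero z.\<close>

lemma l_reeb:
  assumes "s \<in> D1" "\<xi> = P s" "m2 \<noteq> 0"
  shows "l s = 0"
proof -
  have "\<not> D2 \<subseteq> {0}" using assms(3) dims(3) by (simp flip: dim_eq_0)
  then obtain z where z: "z \<in> D2" "z \<noteq> 0" by auto
  then have "gP z z > 0" by (intro inner_productD(3)[OF gP])
  moreover have "l s * gP z z = 0"
    using G_D2_D2[OF assms(1) z(1) z(1)] G_xi[OF z(1), of z] g_sym[of \<xi> "G z z"] assms(2)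
    by (simp add: gP_def)
  ultimately show ?thesis by simp
qed

lemma norm2_h:
  assumes E: "orthonormal gP E" "span E = UNIV" and grad: "\<And>w. g (P v) (P w) = l w"
  obtains R where "(\<Sum>u\<in>E. \<Sum>w\<in>E. g (h u w) (h u w)) =
      4 * real m2 * ((1 / sin \<theta>)\<^sup>2 + (cot \<theta>)\<^sup>2) * g (\<phi> (P v)) (\<phi> (P v)) + R"
    and "R \<ge> 0" and "R = 0 \<longleftrightarrow> (\<forall>z\<in>D2. \<forall>w\<in>D2. h z w = 0)"
proof -
  obtain E1 where E1: "orthonormal gP E1" "E1 \<subseteq> D1" "span E1 = D1"
    using exists_orthonormal_basis[OF gP sub1] .
  obtain E2 where E2: "orthonormal gP E2" "E2 \<subseteq> D2" "span E2 = D2"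
    using exists_orthonormal_basis[OF gP sub2] .
  have "\<And>a z. a \<in> E1 \<Longrightarrow> z \<in> E2 \<Longrightarrow> gP a z = 0"
    unfolding gP_def using E1(2) E2(2) by (intro D1_D2(1)) auto
  then have on: "orthonormal gP (E1 \<union> E2)" "E1 \<inter> E2 = {}"
    using orthonormal_Un[OF gP E1(1) E2(1)] by blast+
  have fin: "finite E1" "finite E2" using orthonormal_finite[OF gP] E1 E2 by auto
  have span: "span (E1 \<union> E2) = UNIV"
  proof (intro equalityI subsetI UNIV_I)
    fix u
    obtain a z where "a \<in> D1" "z \<in> D2" "u = a + z" by (rule decompose)
    then show "u \<in> span (E1 \<union> E2)"
      using span_mono[of E1 "E1 \<union> E2"] span_mono[of E2 "E1 \<union> E2"] E1(3) E2(3)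
      by (auto intro!: span_add)
  qed
  define q where "q = (\<lambda>u w. g (h u w) (h u w))"
  have q_sym: "q u w = q w u" for u w by (simp add: q_def h_sym[of u w])
  have "(\<Sum>u\<in>E. \<Sum>w\<in>E. q u w) = (\<Sum>u\<in>E. \<Sum>w\<in>E1 \<union> E2. q u w)"
    unfolding q_def
    by (rule sum.cong[OF refl], rule trace_orthonormal[OF gP E(1) on(1) _ bilinear_h_inner(1)])
      (simp add: E span)
  also have "\<dots> = (\<Sum>w\<in>E1 \<union> E2. \<Sum>u\<in>E. q u w)" by (rule sum.swap)
  also have "\<dots> = (\<Sum>w\<in>E1 \<union> E2. \<Sum>u\<in>E1 \<union> E2. q u w)"
    unfolding q_def
    by (rule sum.cong[OF refl], rule trace_orthonormal[OF gP E(1) on(1) _ bilinear_h_inner(2)])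
      (simp add: E span)
  also have "\<dots> = (\<Sum>w\<in>E1. \<Sum>u\<in>E1. q u w) + (\<Sum>w\<in>E1. \<Sum>u\<in>E2. q u w) +
      ((\<Sum>w\<in>E2. \<Sum>u\<in>E1. q u w) + (\<Sum>w\<in>E2. \<Sum>u\<in>E2. q u w))"
    by (simp only: sum.union_disjoint[OF fin on(2)] sum.distrib)
  also have "(\<Sum>w\<in>E1. \<Sum>u\<in>E1. q u w) = 0"
    by (intro sum.neutral ballI)
      (use E1(2) in \<open>simp add: q_def h_D1_D1 g_lin subset_iff\<close>)
  also have "(\<Sum>w\<in>E2. \<Sum>u\<in>E1. q u w) = (\<Sum>w\<in>E1. \<Sum>u\<in>E2. q u w)"
    by (subst sum.swap) (simp only: q_sym)
  finally have total: "(\<Sum>u\<in>E. \<Sum>w\<in>E. q u w) =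
      2 * (\<Sum>w\<in>E1. \<Sum>u\<in>E2. q u w) + (\<Sum>w\<in>E2. \<Sum>u\<in>E2. q u w)" by simp

  \<comment> \<open>l vanishes on D2, so its gradient v has no D2 component.\<close>
  have v1: "v \<in> D1"
  proof -
    obtain a z where az: "a \<in> D1" "z \<in> D2" "v = a + z" by (rule decompose)
    have "gP z z = g (P v) (P z) - g (P a) (P z)" by (simp add: az gP_def P_lin g_lin)
    also have "\<dots> = 0" using grad l_D2 az D1_D2(1) by simp
    finally have "z = 0" using inner_productD(5)[OF gP] by simp
    then show ?thesis using az by simp
  qed
  obtain v' where v': "v' \<in> D1" "\<phi> (P v) = P v'" using phi_D1'[OF v1] by blast
  have q1: "q u w = ((gP v' w)\<^sup>2 + (cos \<theta>)\<^sup>2 * (gP v w)\<^sup>2) / (sin \<theta>)\<^sup>2"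
    if w: "w \<in> E1" and u: "u \<in> E2" for u w
  proof -
    have "w \<in> D1" "u \<in> D2" using w u E1(2) E2(2) by auto
    moreover from phi_D1'[OF this(1)] obtain w' where w': "w' \<in> D1" "\<phi> (P w) = P w'" by blast
    \<comment> \<open>With w' = \<phi> w and v' = \<phi> v this is skewness: l (\<phi> w) = g v
      (\<phi> w) = -g (\<phi> v) w.\<close>
    moreover have "l w' = - gP v' w"
      using grad[of w'] w' v' skew[of "P v" "P w"] by (simp add: gP_def)
    moreover have "gP u u = 1" using E2(1) u by (auto simp: orthonormal_def)
    ultimately show ?thesis using h_D2_D1[of w w' u] grad[of w] by (simp add: q_def gP_def)
  qed
  \<comment> \<open>The value of q does not depend on u, so E2 contributes the factor 2 m2; the
    coefficient 2 in \<open>total\<close> makes it 4 m2.\<close>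
  have "card E2 = 2 * m2" using orthonormal_card[OF gP E2(1)] E2(3) dims by simp
  then have "(\<Sum>w\<in>E1. \<Sum>u\<in>E2. q u w) = (\<Sum>w\<in>E1. 2 * real m2 *
      (((gP v' w)\<^sup>2 + (cos \<theta>)\<^sup>2 * (gP v w)\<^sup>2) / (sin \<theta>)\<^sup>2))"
    by (simp add: q1)
  also have "\<dots> = 2 * real m2 * (((\<Sum>w\<in>E1. (gP v' w)\<^sup>2) +
      (cos \<theta>)\<^sup>2 * (\<Sum>w\<in>E1. (gP v w)\<^sup>2)) / (sin \<theta>)\<^sup>2)"
    by (simp add: sum.distrib sum_distrib_left sum_divide_distrib add_divide_distrib distrib_left)
  also have "(\<Sum>w\<in>E1. (gP v' w)\<^sup>2) = gP v' v'"
    using orthonormal_parseval[OF gP E1(1), of v' v'] v'(1) E1(3) by (simp add: power2_eq_square)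
  also have "(\<Sum>w\<in>E1. (gP v w)\<^sup>2) = gP v v"
    using orthonormal_parseval[OF gP E1(1), of v v] v1 E1(3) by (simp add: power2_eq_square)
  finally have mixed: "(\<Sum>w\<in>E1. \<Sum>u\<in>E2. q u w) =
      2 * real m2 * ((gP v' v' + (cos \<theta>)\<^sup>2 * gP v v) / (sin \<theta>)\<^sup>2)" .
  \<comment> \<open>As v is orthogonal to \<xi>, \<phi> preserves its length; the factor m2 includes
    the case m2 = 0, where \<open>l_reeb\<close> says nothing.\<close>
  have "real m2 * gP v v = real m2 * gP v' v'"
  proof (cases "m2 = 0")
    case False
    obtain s where s: "s \<in> D1" "\<xi> = P s" by (rule xi_D1)
    have "g (P v) \<xi> = 0" using grad[of s] s l_reeb[OF s False] by simp
    then show ?thesis using phi_metric[of "P v" "P v"] v' by (simp add: gP_def)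
  qed simp
  then have "m2 = 0 \<or> gP v v = gP v' v'" by simp
  then have "(\<Sum>w\<in>E1. \<Sum>u\<in>E2. q u w) =
      2 * real m2 * ((1 / sin \<theta>)\<^sup>2 + (cot \<theta>)\<^sup>2) * gP v' v'"
    unfolding mixed
    by (auto simp: cot_def power_divide add_divide_distrib distrib_left distrib_right)
  then have eq: "(\<Sum>u\<in>E. \<Sum>w\<in>E. g (h u w) (h u w)) =
      4 * real m2 * ((1 / sin \<theta>)\<^sup>2 + (cot \<theta>)\<^sup>2) * g (\<phi> (P v)) (\<phi> (P v)) +
      (\<Sum>w\<in>E2. \<Sum>u\<in>E2. q u w)"
    using total by (simp add: q_def gP_def v')
  have q0: "q u w \<ge> 0" for u w unfolding q_def by (rule inner_productD(4)[OF g])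
  have iff: "(\<Sum>w\<in>E2. \<Sum>u\<in>E2. q u w) = 0 \<longleftrightarrow> (\<forall>z\<in>D2. \<forall>w\<in>D2. h z w = 0)"
  proof
    assume "(\<Sum>w\<in>E2. \<Sum>u\<in>E2. q u w) = 0"
    then have "q u w = 0" if "u \<in> E2" "w \<in> E2" for u w
      using that fin q0 by (simp add: sum_nonneg_eq_0_iff sum_nonneg)
    then have h0: "h u w = 0" if "u \<in> E2" "w \<in> E2" for u w
      using that inner_productD(5)[OF g] by (simp add: q_def)
    have "h z w = 0" if "z \<in> span E2" "w \<in> span E2" for z w
      by (rule bilinear_eq[OF bilinear_h, of "\<lambda>_ _. 0" "span E2" E2 "span E2" E2, simplified])
        (use that h0 in \<open>auto simp: bilinear_def linear_zero\<close>)
    then show "\<forall>z\<in>D2. \<forall>w\<in>D2. h z w = 0" using E2(3) by simp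
  next
    assume "\<forall>z\<in>D2. \<forall>w\<in>D2. h z w = 0"
    then show "(\<Sum>w\<in>E2. \<Sum>u\<in>E2. q u w) = 0"
      using E2(2) by (intro sum.neutral ballI) (auto simp: q_def subset_iff g_lin(9))
  qed
  show ?thesis
    by (rule that[OF eq _ iff]) (intro sum_nonneg q0)
qed

end

section \<open>Submanifolds in coordinates\<close>

definition coord_incl ::
    "('m, 'd::euclidean_space) chart set \<Rightarrow> ('a, 'e::euclidean_space) chart set \<Rightarrow>
     ('m \<Rightarrow> 'a) \<Rightarrow> 'm \<Rightarrow> 'd \<Rightarrow> 'e" where
  "coord_incl AM A i p = snd (chart_at A (i p)) \<circ> i \<circ> chart_inv (chart_at AM p)"

text \<open>The ambient covariant derivative, along the coordinate field with components \<open>u\<close>, of the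
  coordinate field with components \<open>v\<close>, in the selected charts at \<open>p\<close> and \<open>i p\<close>.\<close>

definition coord_cov ::
    "('m, 'd::euclidean_space) chart set \<Rightarrow>
     ('a::{t2_space, second_countable_topology}, 'e::euclidean_space) chart set \<Rightarrow>
     ('m \<Rightarrow> 'a) \<Rightarrow> (('a \<Rightarrow> 'e) \<Rightarrow> ('a \<Rightarrow> 'e) \<Rightarrow> 'a \<Rightarrow> 'e) \<Rightarrow> 'm \<Rightarrow> 'd \<Rightarrow> 'd \<Rightarrow> 'e" where
  "coord_cov AM A i nab p u v =
    der (\<lambda>x. der (coord_incl AM A i p) x v) (snd (chart_at AM p) p) u +
    christoffel A nab (i p) (dmap AM A i p u) (dmap AM A i p v)"

text \<open>A product rule for a form whose base point moves as well: the rule for linear families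
  is used once per slot, and dB enters by the chain rule along F.\<close>

lemma has_derivative_bilinear_family:
  fixes B :: "'e::euclidean_space \<Rightarrow> 'e \<Rightarrow> 'e \<Rightarrow> real" and F :: "'d::euclidean_space \<Rightarrow> 'e"
  assumes W: "open W" "x0 \<in> W" and B: "\<And>x. x \<in> W \<Longrightarrow> bilinear (B (F x))"
    and dB: "\<And>u v. ((\<lambda>y. B y u v) has_derivative dB u v) (at (F x0))"
    and F: "(F has_derivative F') (at x0)"
    and k: "(k has_derivative k') (at x0)" and l: "(l has_derivative l') (at x0)"
  shows "((\<lambda>x. B (F x) (k x) (l x)) has_derivative (\<lambda>h. dB (k x0) (l x0) (F' h)
    + B (F x0) (k' h) (l x0) + B (F x0) (k x0) (l' h))) (at x0)"
proof -
  have lin: "linear (B (F x) u)" "linear (\<lambda>u. B (F x) u v)" if "x \<in> W" for x u v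
    using B[OF that] unfolding bilinear_def by auto
  have 1: "((\<lambda>x. B (F x) u v) has_derivative (\<lambda>h. dB u v (F' h))) (at x0)" for u v
    by (rule has_derivative_compose[OF F dB])
  have 2: "((\<lambda>x. B (F x) u (l x)) has_derivative
      (\<lambda>h. dB u (l x0) (F' h) + B (F x0) u (l' h))) (at x0)" for u
    by (rule has_derivative_linear_family_apply[OF W, where A = "\<lambda>x. B (F x) u"
          and dA = "\<lambda>v h. dB u v (F' h)", OF lin(1) 1 l])
  have "((\<lambda>x. B (F x) (k x) (l x)) has_derivative
      (\<lambda>h. (dB (k x0) (l x0) (F' h) + B (F x0) (k x0) (l' h)) + B (F x0) (k' h) (l x0))) (at x0)"
    by (rule has_derivative_linear_family_apply[OF W, where A = "\<lambda>x u. B (F x) u (l x)"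
          and dA = "\<lambda>u h. dB u (l x0) (F' h) + B (F x0) u (l' h)", OF lin(2) 2 k])
  then show ?thesis by (simp add: add_ac)
qed

text \<open>The image under the differential of \<open>i\<close> of the coordinate field \<open>u\<close> of the selected chart at \<open>p\<close>,
  at the point with coordinates \<open>x\<close>.\<close>

abbreviation push_frame where
  "push_frame AM A i p x u \<equiv> dmap AM A i (chart_inv (chart_at AM p) x)
    (chart_frame AM (chart_at AM p) (chart_inv (chart_at AM p) x) u)"

context
  fixes AM :: "('m::{t2_space, second_countable_topology}, 'd::euclidean_space) chart set"
    and A :: "('a::{t2_space, second_countable_topology}, 'e::euclidean_space) chart set"
    and i :: "'m \<Rightarrow> 'a"
  assumes sub: "submanifold AM A i" and at: "smooth_atlas A"
begin

lemma sub_atlas: "smooth_atlas AM" and sub_smooth: "smooth_map AM A i"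
  and inj_dmap: "inj (dmap AM A i p)"
  using sub unfolding submanifold_def by auto

lemma dmap_coord_incl: "dmap AM A i p = der (coord_incl AM A i p) (snd (chart_at AM p) p)"
  unfolding dmap_def coord_incl_def ..

definition coord_dom :: "'m \<Rightarrow> 'd set" where
  "coord_dom p = snd (chart_at AM p) ` (fst (chart_at AM p) \<inter> i -` fst (chart_at A (i p)))"

lemma open_vimage_incl: "open V \<Longrightarrow> open (i -` V)"
  using sub_smooth open_vimage unfolding smooth_map_def by blast

lemma coord_dom: "open (coord_dom p)" "snd (chart_at AM p) p \<in> coord_dom p"
  unfolding coord_dom_def
  using open_chart_image[OF atlas_chart[OF sub_atlas chart_at(1)[OF sub_atlas]]
      open_vimage_incl[OF open_chart_dom[OF atlas_chart[OF at chart_at(1)[OF at]]]]]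
    chart_at(2)[OF sub_atlas] chart_at(2)[OF at] by auto

lemma smooth_coord_incl: "smooth_on (coord_dom p) (coord_incl AM A i p)"
  unfolding coord_dom_def coord_incl_def
  by (rule smooth_map_chart[OF sub_smooth chart_at(1)[OF sub_atlas] chart_at(1)[OF at]])

lemma coord_domD:
  assumes "x \<in> coord_dom p"
  defines "q \<equiv> chart_inv (chart_at AM p) x"
  shows "q \<in> fst (chart_at AM p)" "i q \<in> fst (chart_at A (i p))" "snd (chart_at AM p) q = x"
    "coord_incl AM A i p x = snd (chart_at A (i p)) (i q)"
    "chart_inv (chart_at A (i p)) (coord_incl AM A i p x) = i q"
  using assms(1) unfolding q_def coord_dom_def coord_incl_def
  by (auto simp: chart_inv_left[OF atlas_chart[OF sub_atlas chart_at(1)[OF sub_atlas]]]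
      chart_inv_left[OF atlas_chart[OF at chart_at(1)[OF at]]])

lemma chart_at_inv: "chart_inv (chart_at AM p) (snd (chart_at AM p) p) = p"
  by (rule chart_inv_left[OF atlas_chart[OF sub_atlas chart_at(1)[OF sub_atlas]] chart_at(2)[OF
      sub_atlas]])

text \<open>Writes the pushed frame in the coordinate fields of a single ambient chart, with
  components that are smooth in x; this is what makes it differentiable near p.\<close>

lemma push_frame_coord:
  assumes "x \<in> coord_dom p"
  shows "push_frame AM A i p x v = coord_field A (chart_at A (i p))
    (der (coord_incl AM A i p) x v) (i (chart_inv (chart_at AM p) x))"
proof -
  note q = coord_domD[OF assms] and d = chart_at(1)[OF at, of "i p"]
  have "(coord_incl AM A i p has_derivative der (coord_incl AM A i p) x)
      (at (snd (chart_at AM p) (chart_inv (chart_at AM p) x)))"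
    unfolding q(3) by (rule smooth_on_has_der[OF smooth_coord_incl assms])
  from dmap_chart_frame[OF sub_atlas at chart_at(1)[OF sub_atlas] q(1) d q(2)
      open_vimage_incl[OF open_chart_dom[OF atlas_chart[OF at d]]] this[unfolded coord_incl_def]]
  show ?thesis using q(2) by (simp add: coord_field_def coord_incl_def)
qed

lemma linear_dmap: "linear (dmap AM A i p)"
  unfolding dmap_coord_incl
  by (rule has_derivative_linear[OF smooth_on_has_der[OF smooth_coord_incl coord_dom(2)]])

lemma has_der_der_coord_incl:
  "((\<lambda>x. der (coord_incl AM A i p) x v) has_derivative
     der (\<lambda>x. der (coord_incl AM A i p) x v) (snd (chart_at AM p) p)) (at (snd (chart_at AM p) p))"
  by (rule smooth_on_has_der[OF smooth_on_der[OF smooth_coord_incl] coord_dom(2)])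

lemma linear_der_coord_incl: "x \<in> coord_dom p \<Longrightarrow> linear (der (coord_incl AM A i p) x)"
  by (rule has_derivative_linear[OF smooth_on_has_der[OF smooth_coord_incl]])

lemma bilinear_coord_cov:
  assumes "affine_connection A nab"
  shows "bilinear (coord_cov AM A i nab p)"
proof -
  let ?F = "coord_incl AM A i p" and ?x = "snd (chart_at AM p) p"
  have 1: "linear (\<lambda>u. der (\<lambda>x. der ?F x v) ?x u)" for v
    by (rule has_derivative_linear[OF has_der_der_coord_incl])
  have 2: "linear (\<lambda>v. der (\<lambda>x. der ?F x v) ?x u)" for u
    by (rule linear_der_linear_family[where A = "der ?F", OF coord_dom linear_der_coord_incl
          has_der_der_coord_incl])
  have "bilinear (christoffel A nab (i p))" by (rule bilinear_christoffel[OF at assms])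
  then have 3: "linear (christoffel A nab (i p) w)" "linear (\<lambda>w. christoffel A nab (i p) w v)" for w v
    unfolding bilinear_def by auto
  note l = linear_add[OF 1] linear_add[OF 2] linear_add[OF 3(1)] linear_add[OF 3(2)]
    linear_add[OF linear_dmap] linear_scale[OF 1] linear_scale[OF 2] linear_scale[OF 3(1)]
    linear_scale[OF 3(2)] linear_scale[OF linear_dmap]
  show ?thesis
    unfolding bilinear_def coord_cov_def
    by (intro conjI allI linearI) (simp_all only: l scaleR_add_right add_ac)
qed

text \<open>The assumption \<open>dt\<close> says, in coordinates, that the tensor field \<open>t\<close> is parallel at \<open>i p\<close>.\<close>

lemma has_der_pullback:
  fixes t :: "'a \<Rightarrow> 'e \<Rightarrow> 'e \<Rightarrow> real" and p :: 'm
  assumes bil: "\<And>q. bilinear (t q)"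
  defines "d \<equiv> chart_at A (i p)"
  assumes dt: "\<And>u v. ((\<lambda>y. t (chart_inv d y) (coord_field A d u (chart_inv d y))
      (coord_field A d v (chart_inv d y))) has_derivative
      (\<lambda>w. t (i p) (christoffel A nab (i p) w u) v + t (i p) u (christoffel A nab (i p) w v)))
      (at (snd d (i p)))"
  shows "((\<lambda>x. t (i (chart_inv (chart_at AM p) x)) (push_frame AM A i p x u) (push_frame AM A i p x v))
    has_derivative (\<lambda>w. t (i p) (coord_cov AM A i nab p w u) (dmap AM A i p v) +
      t (i p) (dmap AM A i p u) (coord_cov AM A i nab p w v))) (at (snd (chart_at AM p) p))"
proof -
  let ?F = "coord_incl AM A i p" and ?x = "snd (chart_at AM p) p"
  let ?B = "\<lambda>y u v. t (chart_inv d y) (coord_field A d u (chart_inv d y))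
    (coord_field A d v (chart_inv d y))"
  note x0 = coord_domD[OF coord_dom(2)]
  have Fx: "?F ?x = snd d (i p)" using x0(4) by (simp add: chart_at_inv d_def)
  have inv: "chart_inv d (?F ?x) = i p" using x0(5) by (simp add: chart_at_inv d_def)
  have E: "coord_field A d u (i p) = u" for u
    unfolding d_def by (rule coord_field_chart_at[OF at])
  have lE: "linear (\<lambda>u. coord_field A d u q)" for q
    unfolding d_def by (rule linear_coord_field[OF at chart_at(1)[OF at]])
  \<comment> \<open>The first two terms come from the moving base point and carry the Christoffel
    symbols, the last two from the moving components; pairwise they form
    \<open>coord_cov\<close>.\<close>
  have "((\<lambda>x. ?B (?F x) (der ?F x u) (der ?F x v)) has_derivative
      (\<lambda>w. (t (i p) (christoffel A nab (i p) (der ?F ?x w) (der ?F ?x u)) (der ?F ?x v) +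
            t (i p) (der ?F ?x u) (christoffel A nab (i p) (der ?F ?x w) (der ?F ?x v))) +
        ?B (?F ?x) (der (\<lambda>x. der ?F x u) ?x w) (der ?F ?x v) +
        ?B (?F ?x) (der ?F ?x u) (der (\<lambda>x. der ?F x v) ?x w))) (at ?x)"
  proof (rule has_derivative_bilinear_family[where B = ?B and F = ?F, OF coord_dom _ _ _
        has_der_der_coord_incl has_der_der_coord_incl])
    show "bilinear (?B (?F x))" for x
      by (rule bilinear_comp_linear[OF bil lE])
    show "(?F has_derivative der ?F ?x) (at ?x)"
      by (rule smooth_on_has_der[OF smooth_coord_incl coord_dom(2)])
    show "((\<lambda>y. ?B y u v) has_derivative (\<lambda>w. t (i p) (christoffel A nab (i p) w u) v +
        t (i p) u (christoffel A nab (i p) w v))) (at (?F ?x))" for u v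
      using dt[of u v] by (simp add: Fx)
  qed
  then have "((\<lambda>x. ?B (?F x) (der ?F x u) (der ?F x v)) has_derivative
    (\<lambda>w. t (i p) (coord_cov AM A i nab p w u) (dmap AM A i p v) +
         t (i p) (dmap AM A i p u) (coord_cov AM A i nab p w v))) (at ?x)"
    by (simp add: inv E coord_cov_def bilinear_ladd[OF bil] bilinear_radd[OF bil]
        dmap_coord_incl add_ac)
  then show ?thesis
    by (rule has_derivative_transform_within_open[OF _ coord_dom])
      (simp add: push_frame_coord coord_domD(5) d_def)
qed

text \<open>The pairing of two pushed coordinate fields is constantly 0 on the chart, so its
  derivative at p is 0. This is how parallelism of \<phi> and \<xi> turns into identities for
  \<open>coord_cov\<close>.\<close>

lemma parallel_vanishing:
  fixes t :: "'a \<Rightarrow> 'e \<Rightarrow> 'e \<Rightarrow> real" and p :: 'm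
  assumes "\<And>q. bilinear (t q)"
  defines "d \<equiv> chart_at A (i p)" and "c \<equiv> chart_at AM p"
  assumes "\<And>u v. ((\<lambda>y. t (chart_inv d y) (coord_field A d u (chart_inv d y))
      (coord_field A d v (chart_inv d y))) has_derivative
      (\<lambda>w. t (i p) (christoffel A nab (i p) w u) v + t (i p) u (christoffel A nab (i p) w v)))
      (at (snd d (i p)))"
    and zero: "\<And>q. q \<in> fst c \<Longrightarrow>
      t (i q) (dmap AM A i q (chart_frame AM c q u)) (dmap AM A i q (chart_frame AM c q v)) = 0"
  shows "t (i p) (coord_cov AM A i nab p w u) (dmap AM A i p v) +
    t (i p) (dmap AM A i p u) (coord_cov AM A i nab p w v) = 0"
proof -
  have "((\<lambda>x. 0) has_derivative (\<lambda>w. t (i p) (coord_cov AM A i nab p w u) (dmap AM A i p v) +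
      t (i p) (dmap AM A i p u) (coord_cov AM A i nab p w v))) (at (snd (chart_at AM p) p))"
    by (rule has_derivative_transform_within_open[OF has_der_pullback[OF assms(1,4)[unfolded d_def]]
          coord_dom zero[unfolded c_def]]) (rule coord_domD(1))
  from has_derivative_unique[OF this has_derivative_const] show ?thesis by (rule fun_cong)
qed

section \<open>The second fundamental form in coordinates\<close>

lemma coord_field_at: "coord_field AM (chart_at AM p) u p = u"
  by (rule coord_field_chart_at[OF sub_atlas])

text \<open>On the submanifold the ambient components of Y' are \<open>der F x (Yh x)\<close>.
  Differentiating them in two ways shows that any extension differentiates to
  \<open>coord_cov\<close> plus a tangent vector, the pushed derivative of the components of
  Y.\<close>

lemma nab_tangent_fields:
  assumes conn: "affine_connection A nab" and U: "open U" "p \<in> U" and V: "open V" "i ` U \<subseteq> V"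
    and Y: "smooth_vf AM U Y" and X': "smooth_vf A V X'" and Y': "smooth_vf A V Y'"
    and ext: "\<And>q. q \<in> U \<Longrightarrow> X' (i q) = dmap AM A i q (X q) \<and> Y' (i q) = dmap AM A i q (Y q)"
  obtains t where "nab X' Y' (i p) = coord_cov AM A i nab p (X p) (Y p) + dmap AM A i p t"
proof -
  define c where "c = chart_at AM p"
  define d where "d = chart_at A (i p)"
  define F where "F = coord_incl AM A i p"
  define x0 where "x0 = snd c p"
  have c: "c \<in> AM" "p \<in> fst c" unfolding c_def by (rule chart_at[OF sub_atlas])+
  have d: "d \<in> A" "i p \<in> fst d" unfolding d_def by (rule chart_at[OF at])+
  note ch = atlas_chart[OF sub_atlas c(1)] and dh = atlas_chart[OF at d(1)]
  note dom = coord_dom[of p, folded c_def, folded x0_def]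
  note domD = coord_domD[of _ p, folded c_def d_def F_def]
  define Yh where "Yh = (\<lambda>x. components AM c (chart_inv c x) (Y (chart_inv c x)))"
  define Zh where "Zh = (\<lambda>y. components A d (chart_inv d y) (Y' (chart_inv d y)))"
  define W where "W = coord_dom p \<inter> snd c ` (fst c \<inter> U)"
  have W: "open W" "x0 \<in> W" "W \<subseteq> coord_dom p"
    unfolding W_def using dom open_chart_image[OF ch U(1)] c U(2) by (auto simp: x0_def)
  have ip: "i p \<in> V" using U V by blast
  have inv0: "chart_inv c x0 = p" unfolding x0_def by (rule chart_inv_left[OF ch c(2)])
  have F0: "F x0 = snd d (i p)" using domD(4)[OF dom(2)] by (simp add: inv0)
  have dYh: "(Yh has_derivative der Yh x0) (at x0)"
    unfolding Yh_def x0_def by (rule smooth_on_has_der[OF smooth_vfD[OF sub_atlas Y c(1)]])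
      (use c U in auto)
  have dZh: "(Zh has_derivative der Zh (F x0)) (at (F x0))"
    unfolding Zh_def F0 by (rule smooth_on_has_der[OF smooth_vfD[OF at Y' d(1)]])
      (use d ip in auto)
  have dF: "(F has_derivative der F x0) (at x0)"
    unfolding F_def by (rule smooth_on_has_der[OF smooth_coord_incl dom(2)])
  have ZF: "Zh (F x) = der F x (Yh x)" if x: "x \<in> W" for x
  proof -
    have xd: "x \<in> coord_dom p" using x W(3) by blast
    note q = domD[OF xd]
    have qU: "chart_inv c x \<in> U"
      using x unfolding W_def by (auto simp: chart_inv_left[OF ch])
    have "Zh (F x) = components A d (i (chart_inv c x)) (Y' (i (chart_inv c x)))"
      by (simp add: Zh_def q(5))
    also have "Y' (i (chart_inv c x)) = dmap AM A i (chart_inv c x)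
        (chart_frame AM c (chart_inv c x) (Yh x))"
      using ext[OF qU] by (simp add: Yh_def chart_frame_components[OF sub_atlas c(1) q(1)])
    also have "\<dots> = chart_frame A d (i (chart_inv c x)) (der F x (Yh x))"
      using push_frame_coord[OF xd, folded c_def d_def F_def] q(2) by (simp add: coord_field_def)
    also have "components A d (i (chart_inv c x)) \<dots> = der F x (Yh x)"
      by (rule components_chart_frame[OF at d(1) q(2)])
    finally show ?thesis .
  qed
  have d1: "((\<lambda>x. der F x (Yh x)) has_derivative
      (\<lambda>w. der (\<lambda>x. der F x (Yh x0)) x0 w + der F x0 (der Yh x0 w))) (at x0)"
    unfolding F_def x0_def c_def
    by (rule has_derivative_linear_family_apply[OF coord_dom linear_der_coord_incl
          has_der_der_coord_incl dYh[unfolded x0_def c_def]])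
  \<comment> \<open>The same function as in \<open>d1\<close>, now read as the ambient components
    along F; they are controlled only in directions tangent to the submanifold.\<close>
  have d2: "((\<lambda>x. der F x (Yh x)) has_derivative (\<lambda>w. der Zh (F x0) (der F x0 w))) (at x0)"
    by (rule has_derivative_transform_within_open[OF has_derivative_compose[OF dF dZh] W(1,2) ZF])
  have eq: "der Zh (F x0) (der F x0 w) =
      der (\<lambda>x. der F x (Yh x0)) x0 w + der F x0 (der Yh x0 w)" for w
    by (rule fun_cong[OF has_derivative_unique[OF d2 d1]])
  have "Yh x0 = components AM c p (Y p)" by (simp add: Yh_def inv0)
  then have Yp: "Yh x0 = Y p" by (simp add: c_def components_chart_at[OF sub_atlas])
  have "nab X' Y' (i p) = der Zh (F x0) (X' (i p)) + christoffel A nab (i p) (X' (i p)) (Y' (i p))"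
    using nab_christoffel[OF at conn V(1) ip X' Y'] unfolding F0 Zh_def d_def .
  also have "\<dots> = coord_cov AM A i nab p (X p) (Y p) + dmap AM A i p (der Yh x0 (X p))"
    using ext[OF U(2)] eq[of "X p"] Yp
    by (simp add: coord_cov_def dmap_coord_incl flip: F_def c_def x0_def)
  finally show ?thesis by (rule that)
qed

text \<open>An immersion has a smooth local left inverse k \<circ> r in coordinates: r is a linear
  left inverse of the differential, and k inverts r \<circ> F near x0. Agreement is asked only at
  points of U, so parts of the submanifold that return close to i p do no harm.\<close>

lemma exists_ambient_extension:
  obtains U V E where "open U" "p \<in> U" "open V" "i ` U \<subseteq> V"
    "\<And>u. smooth_vf AM U (coord_field AM (chart_at AM p) u)" "\<And>u. smooth_vf A V (E u)"
    "\<And>u q. q \<in> U \<Longrightarrow> E u (i q) = dmap AM A i q (coord_field AM (chart_at AM p) u q)"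
proof -
  define c where "c = chart_at AM p"
  define d where "d = chart_at A (i p)"
  define F where "F = coord_incl AM A i p"
  define x0 where "x0 = snd c p"
  have c: "c \<in> AM" "p \<in> fst c" unfolding c_def by (rule chart_at[OF sub_atlas])+
  have d: "d \<in> A" "i p \<in> fst d" unfolding d_def by (rule chart_at[OF at])+
  note ch = atlas_chart[OF sub_atlas c(1)] and dh = atlas_chart[OF at d(1)]
  note dom = coord_dom[of p, folded c_def, folded x0_def]
  note domD = coord_domD[of _ p, folded c_def d_def F_def]
  have smF: "smooth_on (coord_dom p) F" unfolding F_def by (rule smooth_coord_incl)
  have "inj (der F x0)"
    using inj_dmap[of p] unfolding dmap_coord_incl F_def x0_def c_def .
  moreover have linF: "linear (der F x0)"
    unfolding F_def by (rule linear_der_coord_incl[OF dom(2)])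
  ultimately obtain r where r: "linear r" "r \<circ> der F x0 = id"
    using linear_injective_left_inverse by blast
  have br: "bounded_linear r" using r(1) by (simp add: linear_conv_bounded_linear)
  define H where "H = (\<lambda>x. r (F x))"
  have smH: "smooth_on (coord_dom p) H"
    unfolding H_def by (rule smooth_on_bounded_linear_compose[OF dom(1) br smF])
  have "(H has_derivative (\<lambda>v. r (der F x0 v))) (at x0)"
    unfolding H_def
    by (rule bounded_linear.has_derivative[OF br smooth_on_has_der[OF smF dom(2)]])
  then have "der H x0 = id" using r(2) by (simp add: der_eqI o_def)
  then have "inj (der H x0)" by simp
  from smooth_on_local_inverse[OF dom smH this]
  obtain U' V' k where k: "open U'" "U' \<subseteq> coord_dom p" "x0 \<in> U'" "open V'" "H x0 \<in> V'" "H ` U' = V'"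
    "k ` V' = U'" "\<And>x. x \<in> U' \<Longrightarrow> k (H x) = x" "\<And>y. y \<in> V' \<Longrightarrow> H (k y) = y" "smooth_on V' k"
    by blast
  define U where "U = fst c \<inter> snd c -` U'"
  define V where "V = fst d \<inter> snd d -` (r -` V')"
  have cont: "continuous_on (fst c) (snd c)" "continuous_on (fst d) (snd d)"
    using ch dh unfolding is_chart_def homeomorphism_def by auto
  have orV: "open (r -` V')"
    by (rule open_vimage[OF k(4)]) (rule linear_continuous_on[OF br])
  have U: "open U" "p \<in> U"
    unfolding U_def using continuous_open_preimage[OF cont(1) open_chart_dom[OF ch] k(1)] c k(3)
    by (auto simp: x0_def)
  have V: "open V"
    unfolding V_def by (rule continuous_open_preimage[OF cont(2) open_chart_dom[OF dh] orV])
  have q: "snd c q \<in> coord_dom p" "chart_inv c (snd c q) = q" "r (snd d (i q)) = H (snd c q)"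
    "snd c q \<in> U'" "i q \<in> fst d" if "q \<in> U" for q
  proof -
    show "snd c q \<in> coord_dom p" "snd c q \<in> U'" using that k(2) unfolding U_def by auto
    show inv: "chart_inv c (snd c q) = q" using that unfolding U_def by (simp add:
        chart_inv_left[OF ch])
    show "r (snd d (i q)) = H (snd c q)" "i q \<in> fst d"
      using domD(2,4)[OF \<open>snd c q \<in> coord_dom p\<close>] inv by (simp_all add: H_def)
  qed
  have sub: "i ` U \<subseteq> V"
    using q k(6) unfolding V_def by auto
  \<comment> \<open>The parameter k (r y) spreads the pushed field over ambient coordinates y; on
    the image of U it is the coordinate of the point itself.\<close>
  define E where "E = (\<lambda>u n. chart_frame A d n (der F (k (r (snd d n))) u))"
  have oV: "open (snd d ` V)"
    using open_chart_image[OF dh V] unfolding V_def by (simp add: Int_absorb1)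
  have smE: "smooth_vf A V (E u)" for u
    unfolding E_def
  proof (rule smooth_vf_chart_frame[OF at V d(1), where Y = "\<lambda>y. der F (k (r y)) u"])
    show "V \<subseteq> fst d" unfolding V_def by blast
    have "smooth_on (snd d ` V) (\<lambda>y. k (r y))"
      by (rule smooth_on_compose[OF oV k(4) _ smooth_on_bounded_linear[OF oV br] k(10)])
        (auto simp: V_def)
    then show "smooth_on (snd d ` V) (\<lambda>y. der F (k (r y)) u)"
      by (rule smooth_on_compose[OF oV k(1), where g = "\<lambda>x. der F x u", rotated])
        (use k(7) smooth_on_der[OF smooth_on_subset[OF smF k(2)]] in \<open>auto simp: V_def\<close>)
  qed
  have ext: "E u (i q) = dmap AM A i q (coord_field AM c u q)" if "q \<in> U" for u q
  proof -
    have "q \<in> fst c" using that unfolding U_def by blast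
    then show ?thesis
      using push_frame_coord[OF q(1)[OF that], folded c_def d_def F_def] q[OF that] k(8)
      by (simp add: E_def coord_field_def)
  qed
  have "smooth_vf AM U (coord_field AM c u)" for u
    by (rule smooth_vf_subset[OF sub_atlas smooth_vf_coord_field[OF sub_atlas c(1)]])
      (auto simp: U_def)
  then show ?thesis by (rule that[of U V E, folded c_def, OF U V sub _ smE ext])
qed

text \<open>The definite description is well defined: the extensions just built provide a value, and
  every admissible choice differs from \<open>coord_cov\<close> by a tangent vector, which the
  projection removes.\<close>

lemma second_fundamental_form_eq:
  assumes conn: "affine_connection A nab" and g: "inner_product (g (i p))"
  shows "second_fundamental_form AM A i g nab p u v = coord_cov AM A i nab p u v -
    orth_proj (g (i p)) (range (dmap AM A i p)) (coord_cov AM A i nab p u v)"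
proof -
  let ?pr = "orth_proj (g (i p)) (range (dmap AM A i p))"
  have R: "subspace (range (dmap AM A i p))"
    by (rule linear_subspace_image[OF linear_dmap subspace_UNIV])
  have pr: "w + dmap AM A i p t - ?pr (w + dmap AM A i p t) = w - ?pr w" for w t
  proof -
    have "?pr (dmap AM A i p t) = dmap AM A i p t"
      by (rule orth_proj_eqI[OF g R])
        (auto simp: bilinear_lzero[OF inner_productD(1)[OF g]])
    then show ?thesis by (simp add: linear_add[OF linear_orth_proj[OF g R]])
  qed
  obtain U V E where E: "open U" "p \<in> U" "open V" "i ` U \<subseteq> V"
    "\<And>u. smooth_vf AM U (coord_field AM (chart_at AM p) u)" "\<And>u. smooth_vf A V (E u)"
    "\<And>u q. q \<in> U \<Longrightarrow> E u (i q) = dmap AM A i q (coord_field AM (chart_at AM p) u q)"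
    using exists_ambient_extension[of p] by blast
  let ?X = "coord_field AM (chart_at AM p)"
  let ?Q = "\<lambda>w. \<exists>U V X Y X' Y'. open U \<and> p \<in> U \<and> open V \<and> i ` U \<subseteq> V \<and>
      smooth_vf AM U X \<and> smooth_vf AM U Y \<and> smooth_vf A V X' \<and> smooth_vf A V Y' \<and>
      (\<forall>q\<in>U. X' (i q) = dmap AM A i q (X q) \<and> Y' (i q) = dmap AM A i q (Y q)) \<and>
      X p = u \<and> Y p = v \<and> w = nab X' Y' (i p) - ?pr (nab X' Y' (i p))"
  show ?thesis
    unfolding second_fundamental_form_def
  proof (rule the_equality)
    obtain t where "nab (E u) (E v) (i p) = coord_cov AM A i nab p (?X u p) (?X v p) + dmap AM A i p t"
      by (rule nab_tangent_fields[OF conn E(1-4) E(5)[of v] E(6)[of u] E(6)[of v], of "?X u"])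
        (use E(7) in auto)
    then have "coord_cov AM A i nab p u v - ?pr (coord_cov AM A i nab p u v) =
        nab (E u) (E v) (i p) - ?pr (nab (E u) (E v) (i p))"
      by (simp only: pr coord_field_at)
    then show "?Q (coord_cov AM A i nab p u v - ?pr (coord_cov AM A i nab p u v))"
      using E by (intro exI[of _ U] exI[of _ V] exI[of _ "?X u"] exI[of _ "?X v"] exI[of _ "E u"]
          exI[of _ "E v"] conjI ballI) (simp_all add: coord_field_at)
  next
    fix w
    assume "?Q w"
    then obtain U V X Y X' Y' where *: "open U" "p \<in> U" "open V" "i ` U \<subseteq> V" "smooth_vf AM U Y"
        "smooth_vf A V X'" "smooth_vf A V Y'"
        "\<And>q. q \<in> U \<Longrightarrow> X' (i q) = dmap AM A i q (X q) \<and> Y' (i q) = dmap AM A i q (Y q)"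
        "X p = u" "Y p = v" "w = nab X' Y' (i p) - ?pr (nab X' Y' (i p))"
      by (elim exE conjE) blast
    obtain t where "nab X' Y' (i p) = coord_cov AM A i nab p (X p) (Y p) + dmap AM A i p t"
      by (rule nab_tangent_fields[OF conn *(1-7), of X]) (use *(8) in auto)
    then show "w = coord_cov AM A i nab p u v - ?pr (coord_cov AM A i nab p u v)"
      using *(9-11) by (simp only: pr)
  qed
qed

end

section \<open>Products of manifolds\<close>

lemma chart_frame_eq_0:
  assumes "smooth_atlas A" "c \<in> A" "p \<in> fst c"
  shows "chart_frame A c p u = 0 \<longleftrightarrow> u = 0"
proof
  assume "chart_frame A c p u = 0"
  then show "u = 0"
    using components_chart_frame[OF assms, of u] linear_0[OF linear_components[OF assms]] by simp
qed (simp add: linear_0[OF linear_chart_frame[OF assms]])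

lemma chart_inv_prod:
  assumes "is_chart c1" "is_chart c2" "x \<in> snd c1 ` fst c1 \<times> snd c2 ` fst c2"
  shows "chart_inv (fst c1 \<times> fst c2, map_prod (snd c1) (snd c2)) x
    = (chart_inv c1 (fst x), chart_inv c2 (snd x))"
proof -
  obtain q1 q2 where q: "q1 \<in> fst c1" "q2 \<in> fst c2" "x = (snd c1 q1, snd c2 q2)"
    using assms(3) by (elim SigmaE imageE) blast
  have inj: "inj_on (snd c1) (fst c1)" "inj_on (snd c2) (fst c2)"
    by (rule inj_on_inverseI, rule chart_inv_left, rule assms, assumption)+
  have "inv_into (fst c1 \<times> fst c2) (map_prod (snd c1) (snd c2)) x = (q1, q2)"
  proof (rule inv_into_f_eq)
    show "inj_on (map_prod (snd c1) (snd c2)) (fst c1 \<times> fst c2)" using inj by (rule map_prod_inj_on)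
  qed (use q in auto)
  then show ?thesis
    using q by (simp add: chart_inv_def[of "(_, _)"] chart_inv_left[OF assms(1)] chart_inv_left[OF
        assms(2)])
qed

context
  fixes AB :: "('b::{t2_space, second_countable_topology}, 'eb::euclidean_space) chart set"
    and AF :: "('f::{t2_space, second_countable_topology}, 'ef::euclidean_space) chart set"
  assumes atB: "smooth_atlas AB" and atF: "smooth_atlas AF"
    and atM: "smooth_atlas (prod_atlas AB AF)"
begin

lemma prod_atlasE:
  assumes "c \<in> prod_atlas AB AF"
  obtains c1 c2 where "c1 \<in> AB" "c2 \<in> AF" "c = (fst c1 \<times> fst c2, map_prod (snd c1) (snd c2))"
  using assms unfolding prod_atlas_def by blast

lemma prod_chart:
  assumes "c1 \<in> AB" "c2 \<in> AF" "c = (fst c1 \<times> fst c2, map_prod (snd c1) (snd c2))" "q \<in> fst c"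
  shows "fst q \<in> fst c1" "snd q \<in> fst c2" "snd c q = (snd c1 (fst q), snd c2 (snd q))"
  using assms by (auto simp: map_prod_def split: prod.splits)

context
  fixes c1 c2 c
  assumes c12: "c1 \<in> AB" "c2 \<in> AF" and c_def: "c = (fst c1 \<times> fst c2, map_prod (snd c1) (snd c2))"
begin

lemma prod_chart_in: "c \<in> prod_atlas AB AF"
  using c12 c_def unfolding prod_atlas_def by blast

lemma prod_chart_inv:
  assumes "x \<in> snd c ` fst c"
  shows "chart_inv c x = (chart_inv c1 (fst x), chart_inv c2 (snd x))"
  unfolding c_def
  by (rule chart_inv_prod[OF atlas_chart[OF atB c12(1)] atlas_chart[OF atF c12(2)]])
    (use assms c_def in auto)

text \<open>In product charts the projections are the linear maps \<open>fst\<close> and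
  \<open>snd\<close>, hence their own derivatives.\<close>

lemma
  assumes q: "q \<in> fst c"
  shows dmap_fst: "dmap (prod_atlas AB AF) AB fst q (chart_frame (prod_atlas AB AF) c q v)
      = chart_frame AB c1 (fst q) (fst v)"
    and dmap_snd: "dmap (prod_atlas AB AF) AF snd q (chart_frame (prod_atlas AB AF) c q v)
      = chart_frame AF c2 (snd q) (snd v)"
proof -
  note qc = prod_chart[OF c12 c_def q]
  have o: "open (snd c ` fst c)" "snd c q \<in> snd c ` fst c"
    using open_chart_image[OF atlas_chart[OF atM prod_chart_in] open_UNIV] q by auto
  have "(snd c1 \<circ> fst \<circ> chart_inv c has_derivative fst) (at (snd c q))"
    by (rule has_derivative_transform_within_open[OF
          bounded_linear_imp_has_derivative[OF bounded_linear_fst] o])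
      (auto simp: c_def prod_chart_inv[unfolded c_def] chart_inv_right)
  moreover have "(snd c2 \<circ> snd \<circ> chart_inv c has_derivative snd) (at (snd c q))"
    by (rule has_derivative_transform_within_open[OF
          bounded_linear_imp_has_derivative[OF bounded_linear_snd] o])
      (auto simp: c_def prod_chart_inv[unfolded c_def] chart_inv_right)
  moreover have "open (fst -` fst c1 :: ('b \<times> 'f) set)" "open (snd -` fst c2 :: ('b \<times> 'f) set)"
    using open_chart_dom[OF atlas_chart[OF atB c12(1)]] open_chart_dom[OF atlas_chart[OF atF c12(2)]]
    by (auto intro: open_vimage_fst open_vimage_snd)
  ultimately show "dmap (prod_atlas AB AF) AB fst q (chart_frame (prod_atlas AB AF) c q v)
      = chart_frame AB c1 (fst q) (fst v)"
    "dmap (prod_atlas AB AF) AF snd q (chart_frame (prod_atlas AB AF) c q v)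
      = chart_frame AF c2 (snd q) (snd v)"
    using dmap_chart_frame[where F = fst, OF atM atB prod_chart_in q c12(1) qc(1)]
      dmap_chart_frame[where F = snd, OF atM atF prod_chart_in q c12(2) qc(2)] by simp_all
qed

text \<open>In a product chart both distributions are constant coordinate subspaces, so a coordinate
  field lying in one of them at a point stays in it over the whole chart.\<close>

lemma
  assumes q: "q \<in> fst c"
  shows chart_frame_TB: "chart_frame (prod_atlas AB AF) c q v \<in> TB AB AF q \<longleftrightarrow> snd v = 0"
    and chart_frame_TF: "chart_frame (prod_atlas AB AF) c q v \<in> TF AB AF q \<longleftrightarrow> fst v = 0"
proof -
  note qc = prod_chart[OF c12 c_def q]
  show "chart_frame (prod_atlas AB AF) c q v \<in> TB AB AF q \<longleftrightarrow> snd v = 0"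
    "chart_frame (prod_atlas AB AF) c q v \<in> TF AB AF q \<longleftrightarrow> fst v = 0"
    unfolding TB_def TF_def
    by (simp_all add: dmap_fst[OF q] dmap_snd[OF q] chart_frame_eq_0[OF atB c12(1) qc(1)]
        chart_frame_eq_0[OF atF c12(2) qc(2)])
qed

text \<open>The metric coefficients separate: the B block depends on the first coordinates only, the
  F block on the second ones up to the factor f^2, and mixed coefficients are absent.\<close>

lemma warped_metric_frame:
  assumes q: "q \<in> fst c"
  shows "warped_metric AB AF gB gF f q (chart_frame (prod_atlas AB AF) c q u)
      (chart_frame (prod_atlas AB AF) c q v) =
    gB (fst q) (coord_field AB c1 (fst u) (fst q)) (coord_field AB c1 (fst v) (fst q)) +
    (f (fst q))\<^sup>2 * gF (snd q) (coord_field AF c2 (snd u) (snd q)) (coord_field AF c2 (snd v) (snd q))"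
  unfolding warped_metric_def
  using prod_chart[OF c12 c_def q] by (simp add: dmap_fst[OF q] dmap_snd[OF q] coord_field_def)

end

end

lemma riemannian_has_der:
  assumes "riemannian_manifold A g" "c \<in> A" "p \<in> fst c"
  shows "((\<lambda>y. g (chart_inv c y) (coord_field A c u (chart_inv c y)) (coord_field A c v (chart_inv
      c y)))
    has_derivative der (\<lambda>y. g (chart_inv c y) (coord_field A c u (chart_inv c y))
      (coord_field A c v (chart_inv c y))) (snd c p)) (at (snd c p))"
proof -
  have at: "smooth_atlas A" using assms(1) unfolding riemannian_manifold_def by blast
  note s = smooth_vf_coord_field[OF at assms(2)]
  have "smooth_fun A (fst c) (\<lambda>q. g q (coord_field A c u q) (coord_field A c v q))"
    using assms(1) s open_chart_dom[OF atlas_chart[OF at assms(2)]]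
    unfolding riemannian_manifold_def by blast
  from smooth_on_has_der[OF smooth_funD[OF at this assms(2)]] show ?thesis
    using assms(3) by (simp add: o_def)
qed

section \<open>Normal sections\<close>

lemma smooth_on_bilinear_family:
  fixes B :: "'c::euclidean_space \<Rightarrow> 'a::euclidean_space \<Rightarrow> 'b::euclidean_space \<Rightarrow> real"
  assumes W: "open W" and bil: "\<And>x. x \<in> W \<Longrightarrow> bilinear (B x)"
    and sm: "\<And>u v. smooth_on W (\<lambda>x. B x u v)" and k: "smooth_on W k" and l: "smooth_on W l"
  shows "smooth_on W (\<lambda>x. B x (k x) (l x))"
proof -
  have lin: "linear (B x u)" "linear (\<lambda>u. B x u v)" if "x \<in> W" for x u v
    using bil[OF that] unfolding bilinear_def by auto
  have *: "smooth_on W (\<lambda>x. B x u (l x))" for u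
    by (rule smooth_on_linear_apply[where L = "\<lambda>x. B x u", OF W lin(1) sm l])
  show ?thesis
    by (rule smooth_on_linear_apply[where L = "\<lambda>x u. B x u (l x)", OF W lin(2) * k])
qed

lemma smooth_on_scaleR_sum_Basis:
  assumes "open W" "\<And>e. smooth_on W (\<lambda>x. r x e)"
  shows "smooth_on W (\<lambda>x. \<Sum>e\<in>Basis. r x e *\<^sub>R (e :: 'a::euclidean_space))"
  by (rule smooth_on_sum[OF assms(1)])
    (rule smooth_on_bounded_linear_compose[OF assms(1) bounded_linear_scaleR_left assms(2)])

text \<open>The field with constant components v is corrected by its tangential part. The Gram
  matrix that determines this part is invertible because i is an immersion, and its inverse is
  smooth in x; at p the correction is 0 because v is normal.\<close>

lemma exists_normal_section:
  fixes AM :: "('m::{t2_space, second_countable_topology}, 'd::euclidean_space) chart set"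
    and A :: "('a::{t2_space, second_countable_topology}, 'e::euclidean_space) chart set"
  assumes sub: "submanifold AM A i" and riem: "riemannian_manifold A g"
    and v: "v \<in> normal_fibre AM A i g p"
  obtains U V where "open U" "p \<in> U" "U \<subseteq> fst (chart_at AM p)" "smooth_vf_along AM A i U V"
    "\<And>q. q \<in> U \<Longrightarrow> V q \<in> normal_fibre AM A i g q" "V p = v"
proof -
  have at: "smooth_atlas A" and inn: "inner_product (g q)" for q
    using riem unfolding riemannian_manifold_def by auto
  note atM = sub_atlas[OF sub at]
  define c where "c = chart_at AM p"
  define d where "d = chart_at A (i p)"
  define F where "F = coord_incl AM A i p"
  define W where "W = coord_dom AM A i p"
  define x0 where "x0 = snd c p"
  have c: "c \<in> AM" "p \<in> fst c" unfolding c_def by (rule chart_at[OF atM])+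
  have d: "d \<in> A" "i p \<in> fst d" unfolding d_def by (rule chart_at[OF at])+
  note ch = atlas_chart[OF atM c(1)] and dh = atlas_chart[OF at d(1)]
  note dom = coord_dom[OF sub at, of p, folded W_def c_def, folded x0_def]
  note domD = coord_domD[OF sub at, of _ p, folded W_def c_def d_def F_def]
  have W_eq: "W = snd c ` (fst c \<inter> i -` fst d)"
    unfolding W_def coord_dom_def[OF sub at] c_def d_def ..
  have smF: "smooth_on W F" unfolding W_def F_def by (rule smooth_coord_incl[OF sub at])
  have linF: "linear (der F x)" if "x \<in> W" for x
    using linear_der_coord_incl[OF sub at] that unfolding W_def F_def .
  have lE: "linear (\<lambda>u. coord_field A d u q)" for q by (rule linear_coord_field[OF at d(1)])
  define B where "B = (\<lambda>x u v. g (chart_inv d (F x)) (coord_field A d u (chart_inv d (F x)))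
    (coord_field A d v (chart_inv d (F x))))"
  have bilB: "bilinear (B x)" for x
    unfolding B_def by (rule bilinear_comp_linear[OF inner_productD(1)[OF inn] lE])
  have linB: "linear (B x u)" "linear (\<lambda>u. B x u v)" for x u v
    using bilB unfolding bilinear_def by auto
  have smB: "smooth_on W (\<lambda>x. B x u w)" for u w
  proof -
    have "smooth_fun A (fst d) (\<lambda>q. g q (coord_field A d u q) (coord_field A d w q))"
      using riem smooth_vf_coord_field[OF at d(1)] open_chart_dom[OF dh]
      unfolding riemannian_manifold_def by blast
    from smooth_funD[OF at this d(1)]
    have *: "smooth_on (snd d ` fst d) ((\<lambda>q. g q (coord_field A d u q) (coord_field A d w q)) \<circ>
        chart_inv d)"
      by simp
    have "open (snd d ` fst d)" using open_chart_image[OF dh open_UNIV] by simp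
    moreover have "F ` W \<subseteq> snd d ` fst d" using domD(2,4) by auto
    ultimately show ?thesis
      using smooth_on_compose[OF dom(1) _ _ smF *] by (simp add: B_def o_def)
  qed
  \<comment> \<open>J x is the Gram matrix of the pushed frame as a linear map, and b x lists the
    products of v with the frame; \<open>J x s = b x\<close> says that v minus the tangent vector
    with components s is normal.\<close>
  define J where "J = (\<lambda>x u. \<Sum>e\<in>Basis. B x (der F x u) (der F x e) *\<^sub>R e)"
  define b where "b = (\<lambda>x. \<Sum>e\<in>Basis. B x v (der F x e) *\<^sub>R e)"
  have smdF: "smooth_on W (\<lambda>x. der F x u)" for u by (rule smooth_on_der[OF smF])
  have smJ: "smooth_on W (\<lambda>x. J x u)" for u
    unfolding J_def by (rule smooth_on_scaleR_sum_Basis[OF dom(1)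
          smooth_on_bilinear_family[OF dom(1) bilB smB smdF smdF]])
  have smb: "smooth_on W b"
    unfolding b_def by (rule smooth_on_scaleR_sum_Basis[OF dom(1)
          smooth_on_bilinear_family[OF dom(1) bilB smB smooth_on_const smdF]])
  have linJ: "linear (J x)" if "x \<in> W" for x
    unfolding J_def
    by (rule linearI) (simp_all add: linear_add[OF linF[OF that]] linear_scale[OF linF[OF that]]
        linear_add[OF linB(2)] linear_scale[OF linB(2)] scaleR_add_left sum.distrib scaleR_sum_right)
  have Bdot: "B x w (der F x t) = (\<Sum>e\<in>Basis. B x w (der F x e) *\<^sub>R e) \<bullet> t" if "x \<in> W" for x w t
  proof -
    have "linear (\<lambda>t. B x w (der F x t))"
      by (rule linearI) (simp_all add: linear_add[OF linF[OF that]] linear_scale[OF linF[OF that]]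
          linear_add[OF linB(1)] linear_scale[OF linB(1)])
    from linear_sum_Basis[OF this, of t] show ?thesis
      by (simp add: inner_sum_left inner_commute[of t] mult.commute)
  qed
  have frame: "coord_field A d (der F x u) (i (chart_inv c x)) =
      dmap AM A i (chart_inv c x) (chart_frame AM c (chart_inv c x) u)" if "x \<in> W" for x u
    using push_frame_coord[OF sub at, of x p u] that unfolding c_def d_def F_def W_def by simp
  have bijJ: "bij (J x)" if x: "x \<in> W" for x
  proof -
    have "u = 0" if "J x u = 0" for u
    proof -
      have "J x u \<bullet> u = B x (der F x u) (der F x u)"
        unfolding J_def by (rule Bdot[OF x, symmetric])
      then have "coord_field A d (der F x u) (i (chart_inv c x)) = 0"
        using that inner_productD(5)[OF inn] domD(5)[OF x] by (simp add: B_def)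
      then have "dmap AM A i (chart_inv c x) (chart_frame AM c (chart_inv c x) u) = 0"
        by (simp add: frame[OF x])
      then have "chart_frame AM c (chart_inv c x) u = 0"
        using iffD1[OF linear_injective_0[OF linear_dmap[OF sub at]] inj_dmap[OF sub at]] by blast
      then show ?thesis by (simp add: chart_frame_eq_0[OF atM c(1) domD(1)[OF x]])
    qed
    then have "inj (J x)" by (simp add: linear_injective_0[OF linJ[OF x]])
    then show ?thesis
      using linear_injective_imp_surjective[OF linJ[OF x]] by (simp add: bij_def)
  qed
  have smL: "smooth_on W (\<lambda>x. inv (J x) w)" for w
    by (rule smooth_on_inverse_linear_family[OF dom(1) linJ smJ])
      (simp_all add: bijJ bij_is_inj bij_is_surj surj_f_inv_f)
  have linL: "linear (inv (J x))" if "x \<in> W" for x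
    by (rule linear_inverse_function[OF linJ[OF that]])
      (simp_all add: bijJ[OF that] bij_is_inj bij_is_surj surj_f_inv_f)
  define s where "s = (\<lambda>x. inv (J x) (b x))"
  have sms: "smooth_on W s"
    unfolding s_def by (rule smooth_on_linear_apply[where L = "\<lambda>x. inv (J x)", OF dom(1) linL smL smb])
  have Js: "J x (s x) = b x" if "x \<in> W" for x
    unfolding s_def by (rule surj_f_inv_f[OF bij_is_surj[OF bijJ[OF that]]])
  define Vh where "Vh = (\<lambda>x. v + - der F x (s x))"
  have smV: "smooth_on W Vh"
    unfolding Vh_def
    by (rule smooth_on_add[OF dom(1) smooth_on_const smooth_on_bounded_linear_compose[OF dom(1)
          bounded_linear_minus[OF bounded_linear_ident] smooth_on_der_apply[OF dom(1) smF sms]]])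
  define U where "U = fst c \<inter> i -` fst d"
  define V where "V = (\<lambda>q. coord_field A d (Vh (snd c q)) (i q))"
  have U: "open U" "p \<in> U" "U \<subseteq> fst (chart_at AM p)"
    unfolding U_def using open_chart_dom[OF ch] open_vimage_incl[OF sub at open_chart_dom[OF dh]] c d
    by (auto simp: c_def)
  have UW: "snd c q \<in> W" "chart_inv c (snd c q) = q" if "q \<in> U" for q
    using that unfolding U_def W_eq by (auto simp: chart_inv_left[OF ch])
  have normal: "V q \<in> normal_fibre AM A i g q" if q: "q \<in> U" for q
    unfolding normal_fibre_def
  proof (intro CollectI allI)
    fix u
    let ?x = "snd c q" and ?t = "components AM c q u"
    note xW = UW(1)[OF q] and iq = UW(2)[OF q]
    have qc: "q \<in> fst c" using q unfolding U_def by blast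
    have inv: "chart_inv d (F ?x) = i q" using domD(5)[OF xW] iq by simp
    have "B ?x (Vh ?x) (der F ?x ?t) = B ?x v (der F ?x ?t) - B ?x (der F ?x (s ?x)) (der F ?x ?t)"
      by (simp add: Vh_def linear_diff[OF linB(2)])
    also have "\<dots> = b ?x \<bullet> ?t - J ?x (s ?x) \<bullet> ?t"
      by (simp only: b_def J_def Bdot[OF xW, of v ?t] Bdot[OF xW, of "der F ?x (s ?x)" ?t])
    also have "\<dots> = 0" by (simp add: Js[OF xW])
    finally have "g (i q) (V q) (coord_field A d (der F ?x ?t) (i q)) = 0"
      by (simp add: B_def inv V_def)
    then show "g (i q) (V q) (dmap AM A i q u) = 0"
      using frame[OF xW, of ?t] iq chart_frame_components[OF atM c(1) qc, of u] by simp
  qed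
  have inv0: "chart_inv c x0 = p" unfolding x0_def by (rule chart_inv_left[OF ch c(2)])
  have Vp: "V p = v"
  proof -
    have "B x0 v (der F x0 e) = 0" for e
    proof -
      have "B x0 v (der F x0 e) = g (i p) v (coord_field A d (der F x0 e) (i p))"
        using domD(5)[OF dom(2)] coord_field_chart_at[OF at, of "i p" v]
        by (simp add: B_def inv0 d_def)
      also have "\<dots> = 0"
        using frame[OF dom(2), of e] v inv0 unfolding normal_fibre_def by simp
      finally show ?thesis .
    qed
    then have "b x0 = 0" by (simp add: b_def)
    then have "s x0 = 0" unfolding s_def by (simp add: linear_0[OF linL[OF dom(2)]])
    then have "Vh x0 = v" by (simp add: Vh_def linear_0[OF linF[OF dom(2)]])
    then show ?thesis
      unfolding V_def x0_def[symmetric] d_def by (simp add: coord_field_chart_at[OF at])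
  qed
  have "smooth_vf_along AM A i U V"
    unfolding smooth_vf_along_def
  proof (intro ballI)
    \<comment> \<open>Arbitrary charts c' and d' are reduced to the selected ones by the transition
      from c' to c on the source and the derivative of the transition from d to d' on the
      target.\<close>
    fix c' d' assume c': "c' \<in> AM" and d': "d' \<in> A"
    define S where "S = snd c' ` (fst c' \<inter> U \<inter> i -` fst d')"
    define W2 where "W2 = snd c ` (fst c \<inter> i -` (fst d \<inter> fst d'))"
    note od = open_vimage_incl[OF sub at open_Int[OF open_chart_dom[OF dh] open_chart_dom[OF
        atlas_chart[OF at d']]]]
    have o: "open S" "open W2" "open (snd d ` (fst d \<inter> fst d'))"
      unfolding S_def W2_def Int_assoc
      by (intro open_chart_image[OF atlas_chart[OF atM c']] open_chart_image[OF ch od]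
          open_chart_image[OF dh] open_Int U(1) open_chart_dom[OF atlas_chart[OF at d']]
          open_vimage_incl[OF sub at])+
    have W2: "W2 \<subseteq> W" unfolding W2_def W_eq by auto
    have F2: "F ` W2 \<subseteq> snd d ` (fst d \<inter> fst d')"
    proof
      fix y assume "y \<in> F ` W2"
      then obtain q where q: "q \<in> fst c" "i q \<in> fst d" "i q \<in> fst d'" "y = F (snd c q)"
        unfolding W2_def by blast
      then have "snd c q \<in> W" unfolding W_eq by blast
      from domD(4)[OF this] q show "y \<in> snd d ` (fst d \<inter> fst d')"
        by (simp add: chart_inv_left[OF ch])
    qed
    define K where "K = (\<lambda>y. der (snd d' \<circ> chart_inv d) (F y) (Vh y))"
    have "smooth_on W2 (\<lambda>y. der (snd d' \<circ> chart_inv d) (F y) w)" for w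
      by (rule smooth_on_compose[where g = "\<lambda>z. der (snd d' \<circ> chart_inv d) z w", OF o(2,3) F2
            smooth_on_subset[OF smF W2] smooth_on_der[OF smooth_on_transition[OF at d(1) d']]])
    moreover have "linear (der (snd d' \<circ> chart_inv d) (F y))" if "y \<in> W2" for y
      by (rule has_derivative_linear[OF smooth_on_has_der[OF smooth_on_transition[OF at d(1) d']]])
        (use that F2 in blast)
    ultimately have smK: "smooth_on W2 K"
      unfolding K_def
      by (rule smooth_on_linear_apply[where L = "\<lambda>y. der (snd d' \<circ> chart_inv d) (F y)", OF o(2)
          _ _ smooth_on_subset[OF smV W2], rotated])
    have "smooth_on S (\<lambda>x. K ((snd c \<circ> chart_inv c') x))"
    proof (rule smooth_on_compose[OF o(1,2) _ _ smK])
      show "(snd c \<circ> chart_inv c') ` S \<subseteq> W2"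
        unfolding S_def W2_def U_def using chart_inv_left[OF atlas_chart[OF atM c']] by auto
      show "smooth_on S (snd c \<circ> chart_inv c')"
        by (rule smooth_on_subset[OF smooth_on_transition[OF atM c' c(1)]])
          (auto simp: S_def U_def)
    qed
    then have "smooth_on S (\<lambda>x. components A d' (i (chart_inv c' x)) (V (chart_inv c' x)))"
    proof (rule smooth_on_cong[OF o(1), rotated])
      fix x assume "x \<in> S"
      then obtain q where q: "q \<in> fst c'" "q \<in> U" "i q \<in> fst d'" "x = snd c' q"
        unfolding S_def by blast
      have iq: "chart_inv c' x = q" using q by (simp add: chart_inv_left[OF atlas_chart[OF atM c']])
      have "i q \<in> fst d" using q(2) unfolding U_def by blast
      moreover have "F (snd c q) = snd d (i q)" using domD(4)[OF UW(1)[OF q(2)]] UW(2)[OF q(2)] by simp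
      ultimately show "K ((snd c \<circ> chart_inv c') x) =
          components A d' (i (chart_inv c' x)) (V (chart_inv c' x))"
        using q(3) by (simp add: iq K_def V_def coord_field_def
            components_chart_frame_transition[OF at d' _ d(1)])
    qed
    then show "smooth_on (snd c' ` (fst c' \<inter> U \<inter> i -` fst d'))
        (\<lambda>x. components A d' (i (chart_inv c' x)) (V (chart_inv c' x)))"
      unfolding S_def .
  qed
  then show ?thesis by (rule that[OF U _ normal Vp])
qed

section \<open>Warped product semi-slant submanifolds\<close>

text \<open>An orthonormal basis yields a representing vector, as in the Riesz theorem, and
  definiteness of the metric makes it the one that \<open>gradient\<close> describes.\<close>

lemma gradient_inner:
  assumes b: "inner_product (g p)" and l: "linear (dfun A f p)"
  shows "g p (gradient A g f p) w = dfun A f p w"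
proof -
  note bl = inner_productD(1)[OF b]
  obtain E where E: "orthonormal (g p) E" "span E = UNIV"
    using exists_orthonormal_basis[OF b subspace_UNIV] by metis
  define v where "v = (\<Sum>e\<in>E. dfun A f p e *\<^sub>R e)"
  have v: "g p v w = dfun A f p w" for w
  proof -
    have "w = (\<Sum>e\<in>E. g p w e *\<^sub>R e)" by (rule orthonormal_expansion[OF b E(1)]) (simp add: E)
    then have "dfun A f p w = dfun A f p (\<Sum>e\<in>E. g p w e *\<^sub>R e)" by (rule arg_cong)
    also have "\<dots> = (\<Sum>e\<in>E. dfun A f p e * g p e w)"
      by (simp add: linear_sum[OF l] linear_scale[OF l] inner_productD(2)[OF b, of w] mult.commute)
    also have "\<dots> = g p v w" unfolding v_def by (rule inner_product_sum_left[OF b, symmetric])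
    finally show ?thesis ..
  qed
  have "gradient A g f p = v"
    unfolding gradient_def
  proof (rule the_equality)
    show "u = v" if "\<forall>w. g p u w = dfun A f p w" for u
      by (rule inner_product_eqI[OF b]) (simp add: that v)
  qed (simp add: v)
  then show ?thesis by (simp add: v)
qed

locale warped_semi_slant =
  fixes AN :: "('n::{t2_space, second_countable_topology}, 'en::euclidean_space) chart set"
    and AB :: "('b::{t2_space, second_countable_topology}, 'eb::euclidean_space) chart set"
    and AF :: "('f::{t2_space, second_countable_topology}, 'ef::euclidean_space) chart set"
    and \<phi> \<xi> \<eta> g nab gB gF f and i :: "'b \<times> 'f \<Rightarrow> 'n" and \<theta> m1 m2
  assumes cs: "cosymplectic_manifold AN \<phi> \<xi> \<eta> g nab"
    and dim_N: "DIM('en) = 2 * (m1 + 2 * m2) + 1"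
    and rB: "riemannian_manifold AB gB" and rF: "riemannian_manifold AF gF"
    and f: "smooth_fun AB UNIV f" and f_pos: "\<forall>x. f x > 0"
    and slant: "pointwise_semi_slant (prod_atlas AB AF) AN i \<phi> g (TB AB AF) (TF AB AF) \<theta>"
    and proper: "\<forall>p. 0 < \<theta> p \<and> \<theta> p < pi / 2"
    and warped: "induced_metric (prod_atlas AB AF) AN i g = warped_metric AB AF gB gF f"
    and xi_tangent: "\<forall>p. \<xi> (i p) \<in> range (dmap (prod_atlas AB AF) AN i p)"
    and dims: "\<forall>p. dim (TB AB AF p) = 2 * m1 + 1" "\<forall>p. dim (TF AB AF p) = 2 * m2"
begin

abbreviation AM where "AM \<equiv> prod_atlas AB AF"

abbreviation ch where "ch \<equiv> chart_at AM"
abbreviation grad where "grad \<equiv> gradient AM (induced_metric AM AN i g) (\<lambda>p. ln (f (fst p)))"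
abbreviation P where "P \<equiv> dmap AM AN i"
abbreviation cov where "cov \<equiv> coord_cov AM AN i nab"
abbreviation D1 where "D1 \<equiv> TB AB AF"
abbreviation D2 where "D2 \<equiv> TF AB AF"

lemmas atN = cs_atlas[OF cs] and conn = cs_affine[OF cs] and inn = cs_inner[OF cs]
lemmas bil = inner_productD(1)[OF inn]

lemma sub: "submanifold AM AN i"
  using slant unfolding pointwise_semi_slant_def by blast

lemma atB: "smooth_atlas AB" and atF: "smooth_atlas AF"
  using rB rF unfolding riemannian_manifold_def by auto

lemmas atM = sub_atlas[OF sub atN] and lin_dmap = linear_dmap[OF sub atN]
  and inj = inj_dmap[OF sub atN]

lemma chart_at_prod:
  obtains c1 c2 where "c1 \<in> AB" "c2 \<in> AF"
    "ch p = (fst c1 \<times> fst c2, map_prod (snd c1) (snd c2))"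
  using prod_atlasE[OF atB atF atM chart_at(1)[OF atM]] by blast

lemma chart_frame_TB_TF:
  assumes "q \<in> fst (ch p)"
  shows "chart_frame AM (ch p) q v \<in> D1 q \<longleftrightarrow> snd v = 0"
    and "chart_frame AM (ch p) q v \<in> D2 q \<longleftrightarrow> fst v = 0"
proof -
  obtain c1 c2 where c: "c1 \<in> AB" "c2 \<in> AF"
    "ch p = (fst c1 \<times> fst c2, map_prod (snd c1) (snd c2))" by (rule chart_at_prod)
  show "chart_frame AM (ch p) q v \<in> D1 q \<longleftrightarrow> snd v = 0"
    "chart_frame AM (ch p) q v \<in> D2 q \<longleftrightarrow> fst v = 0"
    by (rule chart_frame_TB[OF atB atF atM c assms] chart_frame_TF[OF atB atF atM c assms])+
qed

text \<open>At p the frame of the chart selected there is the identity, and that chart is a product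
  of charts of the factors, even if not of the selected ones.\<close>

lemma TB_iff: "v \<in> D1 p \<longleftrightarrow> snd v = 0" and TF_iff: "v \<in> D2 p \<longleftrightarrow> fst v = 0"
  using chart_frame_TB_TF[OF chart_at(2)[OF atM], of p v]
  by (simp_all add: chart_frame_chart_at[OF atM])

lemma semi_slant_fibre_at:
  "semi_slant_fibre (g (i p)) (\<phi> (i p)) (\<xi> (i p)) (P p) (D1 p) (D2 p) (\<theta> p) m1 m2"
  unfolding semi_slant_fibre_def
proof (intro conjI allI impI)
  show "inner_product (g (i p))" by (rule inn)
  show "linear (\<phi> (i p))" by (rule cs_linear_phi[OF cs])
  show "\<phi> (i p) (\<xi> (i p)) = 0" by (rule phi_xi[OF cs])
  show "g (i p) (\<phi> (i p) u) v = - g (i p) u (\<phi> (i p) v)" for u v by (rule phi_skew[OF cs])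
  show "g (i p) (\<phi> (i p) u) (\<phi> (i p) v) = g (i p) u v - g (i p) u (\<xi> (i p)) * g (i p) v (\<xi> (i p))"
      for u v
    by (simp add: cs_metric_phi[OF cs] eta_eq[OF cs])
  show "linear (P p)" by (rule lin_dmap)
  show "inj (P p)" by (rule inj)
  show "subspace (D1 p)" by (rule subspaceI) (simp_all add: TB_iff)
  show "D2 p = {v. \<forall>u\<in>D1 p. g (i p) (P p u) (P p v) = 0}"
    and "\<phi> (i p) ` P p ` D1 p \<subseteq> P p ` D1 p"
    using slant unfolding pointwise_semi_slant_def induced_metric_def by blast+
  show "angle_to_subspace (g (i p)) (\<phi> (i p) (P p v)) (P p ` D2 p) = \<theta> p"
    if "v \<in> D2 p" "v \<noteq> 0" for v
    using slant that unfolding pointwise_semi_slant_def by blast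
  show "0 < \<theta> p" "\<theta> p < pi / 2" using spec[OF proper, of p] by simp_all
  show "\<xi> (i p) \<in> range (P p)" using xi_tangent ..
  show "DIM('en) = 2 * m1 + 4 * m2 + 1" using dim_N by simp
  show "dim (D1 p) = 2 * m1 + 1" "dim (D2 p) = 2 * m2"
    using spec[OF dims(1), of p] spec[OF dims(2), of p] by simp_all
qed

lemma eta_TF: "z \<in> D2 p \<Longrightarrow> \<eta> (i p) (P p z) = 0"
  using semi_slant_fibre.g_D2_xi[OF semi_slant_fibre_at] by (simp add: eta_eq[OF cs])

lemma phi_TB_TF:
  "a \<in> D1 p \<Longrightarrow> z \<in> D2 p \<Longrightarrow> g (i p) (\<phi> (i p) (P p a)) (P p z) = 0"
  using semi_slant_fibre.phi_D1'[OF semi_slant_fibre_at]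
    semi_slant_fibre.D1_D2(1)[OF semi_slant_fibre_at] by metis

lemma dim_open_chart: "open (snd (ch p) ` fst (ch p))"
  "snd (ch p) p \<in> snd (ch p) ` fst (ch p)"
  using open_chart_image[OF atlas_chart[OF atM chart_at(1)[OF atM, of p]] open_UNIV]
    chart_at(2)[OF atM] by auto

section \<open>Derivatives of parallel tensors along the submanifold\<close>

lemma has_der_coord_metric:
  assumes Y: "smooth_vf AN (fst (chart_at AN q)) Y" and nY: "\<And>w. nab (coord_field AN (chart_at AN
      q) w) Y q = Y' w"
  shows "((\<lambda>y. g (chart_inv (chart_at AN q) y) (Y (chart_inv (chart_at AN q) y))
      (coord_field AN (chart_at AN q) v (chart_inv (chart_at AN q) y))) has_derivative
    (\<lambda>w. g q (Y' w) v + g q (Y q) (christoffel AN nab q w v))) (at (snd (chart_at AN q) q))"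
proof -
  note c = chart_at[OF atN, of q]
  from has_der_metric[OF cs Y smooth_vf_coord_field[OF atN c(1)]
      open_chart_dom[OF atlas_chart[OF atN c(1)]] c(2), of v]
  show ?thesis
    by (simp add: nY coord_field_chart_at[OF atN] flip: christoffel_def[OF atN conn])
qed

lemma nab_coord_field:
  "nab (coord_field AN (chart_at AN q) w) (coord_field AN (chart_at AN q) u) q = christoffel AN
      nab q w u"
  by (simp add: christoffel_def[OF atN conn])

text \<open>The Christoffel symbols of the first kind of the induced metric.\<close>

definition K :: "'b \<times> 'f \<Rightarrow> 'eb \<times> 'ef \<Rightarrow> 'eb \<times> 'ef \<Rightarrow> 'eb \<times> 'ef \<Rightarrow> real" where
  "K p w u v = g (i p) (cov p w u) (P p v)"

text \<open>\<open>has_der_pullback\<close> for t = g, where metric compatibility is the parallelism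
  required; writing the induced metric as the warped one makes the same function computable from f,
  gB and gF.\<close>

lemma pullback_metric:
  shows "((\<lambda>x. warped_metric AB AF gB gF f (chart_inv (ch p) x)
      (chart_frame AM (ch p) (chart_inv (ch p) x) u)
      (chart_frame AM (ch p) (chart_inv (ch p) x) v))
    has_derivative (\<lambda>w. K p w u v + K p w v u)) (at (snd (ch p) p))"
proof -
  have "((\<lambda>x. g (i (chart_inv (ch p) x))
      (push_frame AM AN i p x u) (push_frame AM AN i p x v))
    has_derivative (\<lambda>w. g (i p) (cov p w u) (P p v) +
      g (i p) (P p u) (cov p w v))) (at (snd (ch p) p))"
  proof (rule has_der_pullback[OF sub atN bil])
    show "((\<lambda>y. g (chart_inv (chart_at AN (i p)) y)
        (coord_field AN (chart_at AN (i p)) u (chart_inv (chart_at AN (i p)) y))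
        (coord_field AN (chart_at AN (i p)) v (chart_inv (chart_at AN (i p)) y))) has_derivative
      (\<lambda>w. g (i p) (christoffel AN nab (i p) w u) v + g (i p) u (christoffel AN nab (i p) w v)))
      (at (snd (chart_at AN (i p)) (i p)))" for u v
      using has_der_coord_metric[OF smooth_vf_coord_field[OF atN chart_at(1)[OF atN]]
          nab_coord_field, of "i p" u v]
      by (simp add: coord_field_chart_at[OF atN])
  qed
  moreover have "g (i q) (P q x) (P q y) = warped_metric AB AF gB gF f q x y" for q x y
    using fun_cong[OF fun_cong[OF fun_cong[OF warped, of q], of x], of y]
    by (simp only: induced_metric_def)
  moreover have "g (i p) (P p u) (cov p w v) = K p w v u" for w
    unfolding K_def by (rule inner_productD(2)[OF inn])
  ultimately show ?thesis by (simp only: K_def)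
qed

text \<open>The form g (\<phi> u) v is parallel and vanishes on D1 \<times> D2, as \<phi> preserves
  D1; coordinate fields stay in D1 and D2, so \<open>parallel_vanishing\<close> applies.\<close>

lemma phi_pullback:
  assumes a: "a \<in> D1 p" and z: "z \<in> D2 p"
  shows "g (i p) (cov p w a) (\<phi> (i p) (P p z)) =
    g (i p) (\<phi> (i p) (P p a)) (cov p w z)"
proof -
  define t where "t = (\<lambda>q u v. g q (\<phi> q u) v)"
  let ?c = "ch p"
  have "bilinear (t q)" for q
    unfolding bilinear_def t_def
    by (intro conjI allI linearI) (simp_all add: linear_add[OF cs_linear_phi[OF cs]]
        linear_scale[OF cs_linear_phi[OF cs]] bilinear_ladd[OF bil] bilinear_radd[OF bil]
        bilinear_lmul[OF bil] bilinear_rmul[OF bil])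
  then have "t (i p) (cov p w a) (P p z) + t (i p) (P p a) (cov p w z) = 0"
  proof (rule parallel_vanishing[OF sub atN])
    show "t (i q) (P q (chart_frame AM ?c q a)) (P q (chart_frame AM ?c q z)) = 0"
      if "q \<in> fst ?c" for q
      unfolding t_def
      by (rule phi_TB_TF; unfold chart_frame_TB_TF[OF that]) (use a z TB_iff TF_iff in blast)+
    let ?d = "chart_at AN (i p)"
    note dd = chart_at[OF atN, of "i p"]
    note o = open_chart_dom[OF atlas_chart[OF atN dd(1)]]
    note s = smooth_vf_coord_field[OF atN dd(1)]
    show "((\<lambda>y. t (chart_inv ?d y) (coord_field AN ?d u (chart_inv ?d y))
        (coord_field AN ?d v (chart_inv ?d y))) has_derivative
      (\<lambda>w. t (i p) (christoffel AN nab (i p) w u) v + t (i p) u (christoffel AN nab (i p) w v)))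
      (at (snd ?d (i p)))" for u v
      unfolding t_def
      using has_der_coord_metric[OF cs_smooth_phi[OF cs o s[of u]], where v = v
            and Y' = "\<lambda>w. \<phi> (i p) (christoffel AN nab (i p) w u)"]
        cs_nab_phi[OF cs o s s dd(2)] nab_coord_field
      by (simp add: coord_field_chart_at[OF atN])
  qed
  then show ?thesis by (simp add: t_def phi_skew[OF cs, of _ "cov p w a"])
qed

lemma xi_pullback:
  assumes z: "z \<in> D2 p"
  shows "g (i p) (\<xi> (i p)) (cov p w z) = 0"
proof -
  \<comment> \<open>\<open>parallel_vanishing\<close> takes bilinear forms, so \<eta> \<otimes>
    \<eta> stands for the parallel 1-form \<eta>. With s the components of \<xi> at p, one term dies
    by \<eta> (P z) = 0 and the other has the factor \<eta> \<xi> = 1.\<close>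
  define t where "t = (\<lambda>q u v. \<eta> q u * \<eta> q v)"
  let ?c = "ch p"
  obtain s where s: "\<xi> (i p) = P p s" using xi_tangent by blast
  have "bilinear (t q)" for q
    unfolding bilinear_def t_def
    by (intro conjI allI linearI) (simp_all add: linear_add[OF cs_linear_eta[OF cs]]
        linear_scale[OF cs_linear_eta[OF cs]] algebra_simps)
  then have "t (i p) (cov p w s) (P p z) + t (i p) (P p s) (cov p w z) = 0"
  proof (rule parallel_vanishing[OF sub atN])
    show "t (i q) (P q (chart_frame AM ?c q s)) (P q (chart_frame AM ?c q z)) = 0"
      if "q \<in> fst ?c" for q
    proof -
      have "\<eta> (i q) (P q (chart_frame AM ?c q z)) = 0"
        by (rule eta_TF; unfold chart_frame_TB_TF[OF that]) (use z TF_iff in blast)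
      then show ?thesis by (simp add: t_def)
    qed
    let ?d = "chart_at AN (i p)"
    note dd = chart_at[OF atN, of "i p"]
    note o = open_chart_dom[OF atlas_chart[OF atN dd(1)]]
    note s = smooth_vf_coord_field[OF atN dd(1)]
    have xi: "smooth_vf AN (fst ?d) \<xi>" by (rule smooth_vf_subset[OF atN cs_smooth_xi[OF cs]]) simp
    have e: "((\<lambda>y. \<eta> (chart_inv ?d y) (coord_field AN ?d u (chart_inv ?d y))) has_derivative
        (\<lambda>w. \<eta> (i p) (christoffel AN nab (i p) w u))) (at (snd ?d (i p)))" for u
      using has_der_metric[OF cs s xi o dd(2), of u] nab_xi[OF cs o dd(2) s]
      by (simp add: eta_eq[OF cs] nab_coord_field bilinear_rzero[OF bil])
    have inv: "chart_inv ?d (snd ?d (i p)) = i p"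
      by (rule chart_inv_left[OF atlas_chart[OF atN dd(1)] dd(2)])
    show "((\<lambda>y. t (chart_inv ?d y) (coord_field AN ?d u (chart_inv ?d y))
        (coord_field AN ?d v (chart_inv ?d y))) has_derivative
      (\<lambda>w. t (i p) (christoffel AN nab (i p) w u) v + t (i p) u (christoffel AN nab (i p) w v)))
      (at (snd ?d (i p)))" for u v
      unfolding t_def
      using has_derivative_mult[OF e[of u] e[of v]]
      by (simp add: inv coord_field_chart_at[OF atN] add.commute)
  qed
  then have "\<eta> (i p) (cov p w z) = 0"
    by (simp add: t_def eta_TF[OF z] s[symmetric] cs_eta_xi[OF cs])
  then show ?thesis using inner_productD(2)[OF inn] by (simp add: eta_eq[OF cs])
qed

section \<open>The Koszul formula for the warped metric\<close>

definition dlnf :: "'b \<times> 'f \<Rightarrow> 'eb \<times> 'ef \<Rightarrow> real" where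
  "dlnf p = dfun AM (\<lambda>q. ln (f (fst q))) p"

text \<open>Each sum K p w u v + K p w v u is the derivative along w of a metric coefficient. Mixed
  coefficients vanish, those of B do not see the F coordinates, and those of F vary along B only
  through f^2, whose logarithmic derivative is 2 dlnf.\<close>

lemma metric_derivatives:
  shows "snd a = 0 \<Longrightarrow> fst z = 0 \<Longrightarrow> K p w a z + K p w z a = 0"
    and "snd a = 0 \<Longrightarrow> snd a' = 0 \<Longrightarrow> fst w = 0 \<Longrightarrow> K p w a a' + K p w a' a = 0"
    and "fst z = 0 \<Longrightarrow> fst z' = 0 \<Longrightarrow> snd w = 0 \<Longrightarrow> K p w z z' + K p w z' z =
      2 * dlnf p w * g (i p) (P p z) (P p z')"
    and "linear (dlnf p)" and "fst z = 0 \<Longrightarrow> dlnf p z = 0"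
proof -
  obtain c1 c2 where c: "c1 \<in> AB" "c2 \<in> AF"
    "ch p = (fst c1 \<times> fst c2, map_prod (snd c1) (snd c2))" by (rule chart_at_prod)
  let ?c = "ch p"
  note cp = chart_at(2)[OF atM, of p]
  note pc = prod_chart[OF atB atF atM c cp]
  define S where "S = snd ?c ` fst ?c"
  define x0 where "x0 = snd ?c p"
  note S = dim_open_chart[of p, folded S_def x0_def]
  have x0: "fst x0 = snd c1 (fst p)" "snd x0 = snd c2 (snd p)" using pc(3) by (simp_all add: x0_def)
  have invB: "chart_inv c1 (fst x0) = fst p"
    unfolding x0 by (simp add: chart_inv_left[OF atlas_chart[OF atB c(1)] pc(1)])
  define fh where "fh = f \<circ> chart_inv c1"
  define \<beta> where "\<beta> = (\<lambda>u v y. gB (chart_inv c1 y) (coord_field AB c1 u (chart_inv c1 y))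
    (coord_field AB c1 v (chart_inv c1 y)))"
  define \<gamma> where "\<gamma> = (\<lambda>u v y. gF (chart_inv c2 y) (coord_field AF c2 u (chart_inv c2 y))
    (coord_field AF c2 v (chart_inv c2 y)))"
  have d\<beta>: "(\<beta> u v has_derivative der (\<beta> u v) (fst x0)) (at (fst x0))" for u v
    unfolding \<beta>_def x0 by (rule riemannian_has_der[OF rB c(1) pc(1)])
  have d\<gamma>: "(\<gamma> u v has_derivative der (\<gamma> u v) (snd x0)) (at (snd x0))" for u v
    unfolding \<gamma>_def x0 by (rule riemannian_has_der[OF rF c(2) pc(2)])
  have dfh: "(fh has_derivative der fh (fst x0)) (at (fst x0))"
    unfolding fh_def x0 by (rule smooth_on_has_der[OF smooth_funD[OF atB f c(1)]]) (use pc in auto)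
  have bilB: "bilinear (gB q)" for q
    by (rule inner_productD(1)) (use rB in \<open>simp add: riemannian_manifold_def\<close>)
  have bilF: "bilinear (gF q)" for q
    by (rule inner_productD(1)) (use rF in \<open>simp add: riemannian_manifold_def\<close>)
  have E0: "coord_field AB c1 0 q = 0" "coord_field AF c2 0 r = 0" for q r
    using linear_0[OF linear_coord_field[OF atB c(1)]] linear_0[OF linear_coord_field[OF atF
        c(2)]] by auto
  have \<beta>0: "\<beta> 0 v y = 0" "\<beta> v 0 y = 0" for v y
    by (simp_all add: \<beta>_def E0 bilinear_lzero[OF bilB] bilinear_rzero[OF bilB])
  have \<gamma>0: "\<gamma> 0 v y = 0" "\<gamma> v 0 y = 0" for v y
    by (simp_all add: \<gamma>_def E0 bilinear_lzero[OF bilF] bilinear_rzero[OF bilF])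
  have inv: "chart_inv ?c x = (chart_inv c1 (fst x), chart_inv c2 (snd x))" if "x \<in> S" for x
    using prod_chart_inv[OF atB atF atM c] that unfolding S_def .
  have warp: "warped_metric AB AF gB gF f (chart_inv ?c x) (chart_frame AM ?c (chart_inv ?c x) u)
      (chart_frame AM ?c (chart_inv ?c x) v) =
    \<beta> (fst u) (fst v) (fst x) + (fh (fst x))\<^sup>2 * \<gamma> (snd u) (snd v) (snd x)" if x: "x \<in> S" for x u v
  proof -
    have "chart_inv ?c x \<in> fst ?c" using x unfolding S_def by (rule chart_inv_in)
    from warped_metric_frame[OF atB atF atM c this] show ?thesis
      by (simp add: inv[OF x] \<beta>_def \<gamma>_def fh_def)
  qed
  have d: "((\<lambda>x. \<beta> (fst u) (fst v) (fst x) + (fh (fst x))\<^sup>2 * \<gamma> (snd u) (snd v) (snd x))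
      has_derivative (\<lambda>w. K p w u v + K p w v u)) (at x0)" for u v
    unfolding x0_def
    by (rule has_derivative_transform_within_open[OF pullback_metric S(1) _ warp])
      (simp_all add: S(2)[unfolded x0_def])
  have dfst: "(fst has_derivative fst) (at x0)" and dsnd: "(snd has_derivative snd) (at x0)"
    by (auto intro: bounded_linear_imp_has_derivative bounded_linear_fst bounded_linear_snd)
  note dfst' = has_derivative_compose[OF dfst] and dsnd' = has_derivative_compose[OF dsnd]
  show "K p w a z + K p w z a = 0" if "snd a = 0" "fst z = 0" for a z w
    using fun_cong[OF has_derivative_unique[OF d[of a z]], of "\<lambda>_. 0" w] that
    by (simp add: \<beta>0 \<gamma>0)
  show "K p w a a' + K p w a' a = 0" if "snd a = 0" "snd a' = 0" "fst w = 0" for a a' w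
  proof -
    have "((\<lambda>x. \<beta> (fst a) (fst a') (fst x)) has_derivative (\<lambda>w. K p w a a' + K p w a' a)) (at x0)"
      using d[of a a'] that by (simp add: \<gamma>0)
    from fun_cong[OF has_derivative_unique[OF this dfst'[OF d\<beta>]], of w] show ?thesis
      using that linear_0[OF has_derivative_linear[OF d\<beta>]] by simp
  qed
  define f0 where "f0 = f (fst p)"
  have f0: "f0 > 0" "fh (fst x0) = f0" using f_pos invB by (simp_all add: f0_def fh_def)
  have "((\<lambda>x. ln (fh (fst x))) has_derivative (\<lambda>w. der fh (fst x0) (fst w) / f0)) (at x0)"
    using has_derivative_ln[OF _ dfst'[OF dfh]] f0 by (simp add: divide_inverse mult.commute)
  then have "((\<lambda>q. ln (f (fst q))) \<circ> chart_inv ?c has_derivative (\<lambda>w. der fh (fst x0) (fst w) /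
      f0)) (at x0)"
    by (rule has_derivative_transform_within_open[OF _ S]) (simp add: inv fh_def)
  then have l: "dlnf p = (\<lambda>w. der fh (fst x0) (fst w) / f0)"
    unfolding dlnf_def dfun_def x0_def by (rule der_eqI)
  note linf = has_derivative_linear[OF dfh]
  show "linear (dlnf p)"
    unfolding l by (rule linearI) (simp_all add: linear_add[OF linf] linear_scale[OF linf]
        add_divide_distrib)
  show "dlnf p z = 0" if "fst z = 0" for z
    using that by (simp add: l linear_0[OF linf])
  show "K p w z z' + K p w z' z = 2 * dlnf p w * g (i p) (P p z) (P p z')"
    if "fst z = 0" "fst z' = 0" "snd w = 0" for z z' w
  proof -
    have "((\<lambda>x. (fh (fst x))\<^sup>2 * \<gamma> (snd z) (snd z') (snd x)) has_derivative
        (\<lambda>w. K p w z z' + K p w z' z)) (at x0)"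
      using d[of z z'] that by (simp add: \<beta>0)
    moreover have "((\<lambda>x. (fh (fst x))\<^sup>2 * \<gamma> (snd z) (snd z') (snd x)) has_derivative
        (\<lambda>w. f0\<^sup>2 * der (\<gamma> (snd z) (snd z')) (snd x0) (snd w) +
          2 * der fh (fst x0) (fst w) * f0 * \<gamma> (snd z) (snd z') (snd x0))) (at x0)"
      using has_derivative_mult[OF has_derivative_power[OF dfst'[OF dfh], of 2] dsnd'[OF d\<gamma>[of
          "snd z" "snd z'"]]] f0(2)
      by (simp add: mult_ac)
    ultimately have "K p w z z' + K p w z' z =
        f0\<^sup>2 * der (\<gamma> (snd z) (snd z')) (snd x0) (snd w) +
          2 * der fh (fst x0) (fst w) * f0 * \<gamma> (snd z) (snd z') (snd x0)"
      by (rule fun_cong[OF has_derivative_unique])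
    also have "\<dots> = 2 * dlnf p w * (f0\<^sup>2 * \<gamma> (snd z) (snd z') (snd x0))"
      using that linear_0[OF has_derivative_linear[OF d\<gamma>]] f0 by (simp add: l power2_eq_square)
    also have "f0\<^sup>2 * \<gamma> (snd z) (snd z') (snd x0) = g (i p) (P p z) (P p z')"
    proof -
      have "g (i p) (P p z) (P p z') = warped_metric AB AF gB gF f p z z'"
        using fun_cong[OF fun_cong[OF fun_cong[OF warped, of p], of z], of z']
        by (simp only: induced_metric_def)
      also have "\<dots> = f0\<^sup>2 * \<gamma> (snd z) (snd z') (snd x0)"
        using warp[OF S(2), of z z'] that f0(2)
        by (simp add: \<beta>0 x0_def chart_inv_left[OF atlas_chart[OF atM chart_at(1)[OF atM]] cp]
            chart_frame_chart_at[OF atM])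
      finally show ?thesis ..
    qed
    finally show ?thesis .
  qed
qed

text \<open>Torsion-freeness makes the Christoffel part symmetric, and Schwarz's theorem the second
  derivatives of the inclusion.\<close>

lemma coord_cov_sym: "cov p u v = cov p v u"
  unfolding coord_cov_def
  by (simp add: christoffel_sym[OF cs] der_der_commute[OF coord_dom[OF sub atN]
      smooth_coord_incl[OF sub atN]])

lemma semi_slant_point_at:
  "semi_slant_point (g (i p)) (\<phi> (i p)) (\<xi> (i p)) (P p) (D1 p) (D2 p) (\<theta> p) m1 m2
    (cov p) (dlnf p)"
proof -
  have sym: "K p w u v = K p u w v" for u v w by (simp add: K_def coord_cov_sym[of p w])
  note md = metric_derivatives[where p = p]
  show ?thesis
    unfolding semi_slant_point_def semi_slant_point_axioms_def TB_iff TF_iff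
  proof (intro conjI allI impI semi_slant_fibre_at)
    show "bilinear (cov p)" by (rule bilinear_coord_cov[OF sub atN conn])
    show "cov p u v = cov p v u" for u v by (rule coord_cov_sym)
    show "dlnf p v = 0" if "fst v = 0" for v by (rule md(5)[OF that])
    \<comment> \<open>Koszul's trick: \<open>sym\<close> exchanges the first two vectors in K, so
      signed sums of metric derivatives over permuted arguments isolate a single K.\<close>
    show 1: "g (i p) (cov p a a') (P p z) = 0"
      and 2: "g (i p) (cov p a z) (P p a') = 0"
      if "snd a = 0" "snd a' = 0" "fst z = 0" for a a' z
      using md(1)[OF that(2,3), of a] md(1)[OF that(1,3), of a'] md(2)[OF that]
        sym[of a' a z] sym[of z a a'] sym[of z a' a] unfolding K_def by linarith+
    show "g (i p) (cov p z w) (P p a) =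
        - dlnf p a * g (i p) (P p z) (P p w)"
      and "g (i p) (cov p z a) (P p w) =
        dlnf p a * g (i p) (P p z) (P p w)"
      if "snd a = 0" "fst z = 0" "fst w = 0" for a z w
      using md(1)[OF that(1,2), of w] md(1)[OF that(1,3), of z] md(3)[OF that(2,3,1)]
        sym[of w z a] sym[of w a z] sym[of z a w] unfolding K_def by (simp_all add: algebra_simps)
    show "g (i p) (cov p u a) (\<phi> (i p) (P p z)) =
        g (i p) (\<phi> (i p) (P p a)) (cov p u z)"
      if "snd a = 0" "fst z = 0" for a z u
      by (rule phi_pullback) (simp_all add: TB_iff TF_iff that)
    show "g (i p) (\<xi> (i p)) (cov p u z) = 0" if "fst z = 0" for z u
      by (rule xi_pullback) (simp add: TF_iff that)
  qed
qed

section \<open>The norm of h and the equality case\<close>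

abbreviation sff where "sff \<equiv> second_fundamental_form AM AN i g nab"

lemma sff_eq_h: "sff p = semi_slant_point.h (g (i p)) (P p) (cov p)"
  by (intro ext) (simp add: semi_slant_point.h_def[OF semi_slant_point_at]
      second_fundamental_form_eq[OF sub atN conn inn])

lemma induced_metric_eq_gP:
  "induced_metric AM AN i g p = semi_slant_fibre.gP (g (i p)) (P p)"
  by (intro ext) (simp add: semi_slant_fibre.gP_def[OF semi_slant_fibre_at] induced_metric_def)

lemma inner_induced: "inner_product (induced_metric AM AN i g p)"
  unfolding induced_metric_eq_gP by (rule semi_slant_fibre.gP[OF semi_slant_fibre_at])

text \<open>The norm uses a chosen orthonormal basis; one exists, so the choice is a genuine basis,
  and \<open>norm2_h\<close> holds for every basis.\<close>

lemma norm2_sff_decompose: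
  defines "v \<equiv> \<lambda>p. P p (grad p)"
  obtains R where "norm2_sff AM AN i g nab p =
      4 * real m2 * ((1 / sin (\<theta> p))\<^sup>2 + (cot (\<theta> p))\<^sup>2) * g (i p) (\<phi> (i p) (v p)) (\<phi> (i p) (v p)) + R"
    and "R \<ge> 0" and "R = 0 \<longleftrightarrow> (\<forall>z\<in>D2 p. \<forall>w\<in>D2 p. sff p z w = 0)"
proof -
  let ?b = "induced_metric AM AN i g p"
  define E where "E = (SOME E. orthonormal_basis ?b E)"
  have iff: "orthonormal_basis ?b E \<longleftrightarrow> orthonormal ?b E \<and> span E = UNIV" for E
    using orthonormal_finite[OF inner_induced] unfolding orthonormal_basis_def orthonormal_def by blast
  obtain E0 where "orthonormal ?b E0" "span E0 = UNIV"
    using exists_orthonormal_basis[OF inner_induced subspace_UNIV] by metis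
  then have "\<exists>E. orthonormal_basis ?b E" using iff by blast
  from someI_ex[OF this] have E: "orthonormal ?b E" "span E = UNIV" unfolding E_def iff by auto
  have "g (i p) (v p) (P p w) = dlnf p w" for w
  proof -
    have "linear (dfun AM (\<lambda>q. ln (f (fst q))) p)"
      using metric_derivatives(4)[of p] unfolding dlnf_def .
    from gradient_inner[where g = "induced_metric AM AN i g", OF inner_induced this, where w = w]
        show ?thesis
      by (simp add: v_def induced_metric_def dlnf_def)
  qed
  then show ?thesis
    using semi_slant_point.norm2_h[OF semi_slant_point_at E[unfolded induced_metric_eq_gP],
        of "grad p"] that
    unfolding norm2_sff_def Let_def E_def[symmetric] sff_eq_h[symmetric] v_def by blast
qed

lemma sff_normal: "g (i p) (sff p u w) (P p t) = 0"
  unfolding sff_eq_h by (rule semi_slant_point.h_normal[OF semi_slant_point_at])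

text \<open>To pass from sections to points, coordinate fields extend z and w inside D2, and the
  test section V goes through h z w itself, so that the vanishing pairing is its square
  norm.\<close>

lemma sff_TF_zero_iff:
  "(\<forall>p. \<forall>z\<in>D2 p. \<forall>w\<in>D2 p. sff p z w = 0) \<longleftrightarrow>
    (\<forall>U Z W V. open U \<and>
       smooth_vf AM U Z \<and> (\<forall>p\<in>U. Z p \<in> D2 p) \<and>
       smooth_vf AM U W \<and> (\<forall>p\<in>U. W p \<in> D2 p) \<and>
       smooth_vf_along AM AN i U V \<and> (\<forall>p\<in>U. V p \<in> normal_fibre AM AN i g p) \<longrightarrow>
       (\<forall>p\<in>U. g (i p) (sff p (Z p) (W p)) (V p) = 0))" (is "?L \<longleftrightarrow> ?R")
proof
  assume L: ?L
  show ?R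
  proof (intro allI impI ballI)
    fix U Z W V p
    assume "open U \<and> smooth_vf AM U Z \<and> (\<forall>p\<in>U. Z p \<in> D2 p) \<and>
       smooth_vf AM U W \<and> (\<forall>p\<in>U. W p \<in> D2 p) \<and>
       smooth_vf_along AM AN i U V \<and> (\<forall>p\<in>U. V p \<in> normal_fibre AM AN i g p)" and "p \<in> U"
    with L have "sff p (Z p) (W p) = 0" by blast
    then show "g (i p) (sff p (Z p) (W p)) (V p) = 0" by (simp add: bilinear_lzero[OF bil])
  qed
next
  assume R: ?R
  show ?L
  proof (intro allI ballI)
    fix p z w assume z: "z \<in> D2 p" and w: "w \<in> D2 p"
    let ?c = "ch p"
    have riem: "riemannian_manifold AN g"
      using cs unfolding cosymplectic_manifold_def almost_contact_metric_manifold_def by blast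
    have "sff p z w \<in> normal_fibre AM AN i g p"
      unfolding normal_fibre_def by (simp add: sff_normal)
    from exists_normal_section[OF sub riem this] obtain U V where
      U: "open U" "p \<in> U" "U \<subseteq> fst ?c" "smooth_vf_along AM AN i U V"
        "\<And>q. q \<in> U \<Longrightarrow> V q \<in> normal_fibre AM AN i g q" "V p = sff p z w" by blast
    have sm: "smooth_vf AM U (coord_field AM ?c x)" for x
      by (rule smooth_vf_subset[OF atM smooth_vf_coord_field[OF atM chart_at(1)[OF atM]] U(3)])
    have tf: "\<forall>q\<in>U. coord_field AM ?c x q \<in> D2 q" if "x \<in> D2 p" for x
    proof
      fix q assume "q \<in> U"
      then have "q \<in> fst ?c" using U(3) by blast
      then show "coord_field AM ?c x q \<in> D2 q"
        using that chart_frame_TB_TF(2)[of q p x] by (simp add: coord_field_def TF_iff)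
    qed
    have nV: "\<forall>q\<in>U. V q \<in> normal_fibre AM AN i g q" using U(5) by blast
    have "g (i p) (sff p (coord_field AM ?c z p) (coord_field AM ?c w p)) (V p) = 0"
      by (rule R[rule_format, of U "coord_field AM ?c z" "coord_field AM ?c w" V p])
        (intro conjI U(1,2,4) sm tf[OF z] tf[OF w] nV)+
    then show "sff p z w = 0"
      using inner_productD(5)[OF inn] by (simp add: U(6) coord_field_chart_at[OF atM])
  qed
qed

end

theorem theorem10p2:
  fixes AN :: "('n::{t2_space, second_countable_topology}, 'en::euclidean_space) chart set"
    and AB :: "('b::{t2_space, second_countable_topology}, 'eb::euclidean_space) chart set"
    and AF :: "('f::{t2_space, second_countable_topology}, 'ef::euclidean_space) chart set"
    and \<phi> :: "'n \<Rightarrow> 'en \<Rightarrow> 'en" and \<xi> :: "'n \<Rightarrow> 'en" and \<eta> :: "'n \<Rightarrow> 'en \<Rightarrow> real"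
    and g :: "'n \<Rightarrow> 'en \<Rightarrow> 'en \<Rightarrow> real"
    and nab :: "('n \<Rightarrow> 'en) \<Rightarrow> ('n \<Rightarrow> 'en) \<Rightarrow> 'n \<Rightarrow> 'en"
    and gB :: "'b \<Rightarrow> 'eb \<Rightarrow> 'eb \<Rightarrow> real" and gF :: "'f \<Rightarrow> 'ef \<Rightarrow> 'ef \<Rightarrow> real"
    and f :: "'b \<Rightarrow> real"
    and i :: "'b \<times> 'f \<Rightarrow> 'n"
    and D1 D2 :: "'b \<times> 'f \<Rightarrow> ('eb \<times> 'ef) set"
    and \<theta> :: "'b \<times> 'f \<Rightarrow> real"
    and n m m1 m2 :: nat
  defines "AM \<equiv> prod_atlas AB AF"
    and "h \<equiv> second_fundamental_form (prod_atlas AB AF) AN i g nab"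
  assumes "cosymplectic_manifold AN \<phi> \<xi> \<eta> g nab"
    and "DIM('en) = 2 * n + 1"
    and "riemannian_manifold AB gB" and "riemannian_manifold AF gF"
    and "smooth_fun AB UNIV f" and "\<forall>x. f x > 0"
    and nontrivial: "\<not> (\<exists>c. \<forall>x. f x = c)"
    and "pointwise_semi_slant AM AN i \<phi> g D1 D2 \<theta>"
    and proper: "\<forall>p. 0 < \<theta> p \<and> \<theta> p < pi / 2"
    and warped: "induced_metric AM AN i g = warped_metric AB AF gB gF f"
    and "D1 = TB AB AF" and "D2 = TF AB AF"
    and \<xi>_tangent: "\<forall>p. \<xi> (i p) \<in> range (dmap AM AN i p)"
    and "DIM('eb \<times> 'ef) = m"
    and "\<forall>p. dim (D1 p) = 2 * m1 + 1" and "\<forall>p. dim (D2 p) = 2 * m2"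
    and "n = m1 + 2 * m2"
  defines "gradlnf \<equiv> gradient AM (induced_metric AM AN i g) (\<lambda>p. ln (f (fst p)))"
  defines "bound \<equiv> (\<lambda>p. 4 * real m2 * ((1 / sin (\<theta> p))\<^sup>2 + (cot (\<theta> p))\<^sup>2) *
                     g (i p) (\<phi> (i p) (dmap AM AN i p (gradlnf p)))
                             (\<phi> (i p) (dmap AM AN i p (gradlnf p))))"
  shows "(\<forall>p. norm2_sff AM AN i g nab p \<ge> bound p) \<and>
         ((\<forall>p. norm2_sff AM AN i g nab p = bound p) \<longleftrightarrow>
          (\<forall>U Z W V. open U \<and>
             smooth_vf AM U Z \<and> (\<forall>p\<in>U. Z p \<in> TF AB AF p) \<and>
             smooth_vf AM U W \<and> (\<forall>p\<in>U. W p \<in> TF AB AF p) \<and>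
             smooth_vf_along AM AN i U V \<and> (\<forall>p\<in>U. V p \<in> normal_fibre AM AN i g p) \<longrightarrow>
             (\<forall>p\<in>U. g (i p) (h p (Z p) (W p)) (V p) = 0)))"
proof -
  interpret S: warped_semi_slant AN AB AF \<phi> \<xi> \<eta> g nab gB gF f i \<theta> m1 m2
    using assms by unfold_locales (simp_all only: simp_thms)
  have key: "norm2_sff AM AN i g nab p \<ge> bound p"
    "norm2_sff AM AN i g nab p = bound p \<longleftrightarrow> (\<forall>z\<in>TF AB AF p. \<forall>w\<in>TF AB AF p. h p z w = 0)" for p
  proof -
    obtain R where "norm2_sff AM AN i g nab p = bound p + R" "R \<ge> 0"
      "R = 0 \<longleftrightarrow> (\<forall>z\<in>TF AB AF p. \<forall>w\<in>TF AB AF p. h p z w = 0)"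
      unfolding bound_def gradlnf_def AM_def h_def by (rule S.norm2_sff_decompose[of p])
    then show "norm2_sff AM AN i g nab p \<ge> bound p"
      "norm2_sff AM AN i g nab p = bound p \<longleftrightarrow> (\<forall>z\<in>TF AB AF p. \<forall>w\<in>TF AB AF p. h p z w = 0)"
      by simp_all
  qed
  show ?thesis
    by (intro conjI allI key(1), unfold key(2)) (rule S.sff_TF_zero_iff[folded h_def, folded AM_def])
qed

end
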